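(* Let $\mathcal P\subset\mathcal M_1(\Omega,\mathcal A)$ be a nonempty family of probability measures, $k:\mathcal P\to\mathbb R$ a functional differentiable at $P_0\in\mathcal P$ with canonical gradient $\widetilde k$ satisfying $\int\widetilde k^2\,dP_0\neq0$, and $\alpha\in(0,1)$. Suppose there is a subset $$D\subset K(P_0,\mathcal P)\cap N(\widetilde k,P_0,\mathcal P)$$ which is dense in $N(\widetilde k,P_0,\mathcal P)$ with respect to the $L_2(P_0)$-norm. Then the test sequence $(\varphi_n)_n$ on $\Omega^n$ given by $$\varphi_n=1\ \text{ if }\ \frac1{\sqrt n}\sum_{i=1}^n\widetilde k(\omega_i)>u_{1-\alpha}\|\widetilde k\|_{L_2(P_0)},\qquad\varphi_n=0\ \text{ otherwise,}$$ is asymptotically optimal in the set of all asymptotically level-$\alpha$-similar test sequences for $\mathcal H_3$ against $\mathcal K_3$.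
   Context: $\Phi$ is the standard normal distribution function, $u_{1-\alpha}=\Phi^{-1}(1-\alpha)$; tests are measurable $[0,1]$-valued functions. $L_2^{(0)}(P)=\{h\in L_2(P):\int h\,dP=0\}$. With $dP/dQ$ the density quotient (a $[0,\infty]$-valued measurable $L$ with $P(A)=\int_AL\,dQ+P(A\cap\{L=\infty\})$, $Q(L<\infty)=1$), a curve $t\mapsto P_t$, $|t|<\varepsilon$, in $\mathcal P$ is $L_2(P_0)$-differentiable with tangent $g\in L_2(P_0)$ if $\|2((dP_t/dP_0)^{1/2}-1)-tg\|_{L_2(P_0)}=o(|t|)$ and $P_t(dP_t/dP_0=\infty)=o(t^2)$ as $t\to0$. The tangent cone $K(P_0,\mathcal P)\subset L_2^{(0)}(P_0)$ is the set of tangents of all such curves in $\mathcal P$ through $P_0$ at $t=0$; the tangent space $T(P_0,\mathcal P)$ is the $L_2(P_0)$-closure of its linear span. $k$ is differentiable at $P_0$ with gradient $\dot k\in L_2^{(0)}(P_0)$ if $\lim_{t\downarrow0}t^{-1}(k(P_t)-k(P_0))=\int\dot kg\,dP_0$ for each such curve with tangent $g$; the canonical gradient $\widetilde k$ is the unique gradient in $T(P_0,\mathcal P)$. $N(\widetilde k,P_0,\mathcal P)=\{h\in T(P_0,\mathcal P):\int\widetilde kh\,dP_0=0\}$. $\mathcal F_1$ is the set of sequences $(P_{t_n})_n$ (identified with the sequences of product measures $(P_{t_n}^n)_n$) such that $t_n\to0$, $\lim_nt_n\sqrt n>0$, and there are $\varepsilon>0$ and an $L_2(P_0)$-differentiable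 curve $f:(-\varepsilon,\varepsilon)\to\mathcal P$, $t\mapsto P_t$ (through $P_0$ at $t=0$) with $f(t_n)=P_{t_n}$ for all $n$. Implicit alternatives: $\mathcal K_3=\{(P_{t_n}^n)_n\in\mathcal F_1:\lim_n\sqrt n(k(P_{t_n})-k(P_0))>0\}$; implicit hypotheses: $\mathcal H_3=\{(P_{t_n}^n)_n\in\mathcal F_1:\lim_n\sqrt n(k(P_{t_n})-k(P_0))\le0\}$. A sequence of tests $\psi_n$ on $\Omega^n$ is asymptotically level-$\alpha$-similar for $\mathcal H_3$ against $\mathcal K_3$ if $\lim_n\int\psi_n\,dP_{t_n}^n=\alpha$ for all $(P_{t_n}^n)_n\in\mathcal H_3$ with $\lim_n\sqrt n(k(P_{t_n})-k(P_0))=0$. "$(\varphi_n)$ is asymptotically optimal" in this class means: $(\varphi_n)$ belongs to the class, and for every $(\psi_n)$ in the class, $\limsup_n\int\psi_n\,dP_{t_n}^n\le\lim_n\int\varphi_n\,dP_{t_n}^n$ for all $(P_{t_n}^n)_n\in\mathcal K_3$ and $\liminf_n\int\psi_n\,dP_{t_n}^n\ge\lim_n\int\varphi_n\,dP_{t_n}^n$ for all $(P_{t_n}^n)_n\in\mathcal H_3$ (the limits for $\varphi_n$ existing). *)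

theory Defs
  imports "HOL-Probability.Probability" "HOL-Library.Landau_Symbols"
begin

text \<open>
  Elements of \<open>L\<^sub>2(P)\<close> are represented by functions rather than by classes modulo \<open>P\<close>-null sets;
  accordingly \<open>L2_norm\<close> is a seminorm, and the tangent cone, the tangent space and the set of
  gradients are closed under measurable almost-everywhere modification.
\<close>

definition L2 :: "'a measure \<Rightarrow> ('a \<Rightarrow> real) set" where
  "L2 P = {h. h \<in> borel_measurable P \<and> integrable P (\<lambda>x. (h x)\<^sup>2)}"

definition L2_zero :: "'a measure \<Rightarrow> ('a \<Rightarrow> real) set" where
  "L2_zero P = {h \<in> L2 P. (\<integral>x. h x \<partial>P) = 0}"

definition L2_norm :: "'a measure \<Rightarrow> ('a \<Rightarrow> real) \<Rightarrow> real" where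
  "L2_norm P h = sqrt (\<integral>x. (h x)\<^sup>2 \<partial>P)"

definition lin_span :: "('a \<Rightarrow> real) set \<Rightarrow> ('a \<Rightarrow> real) set" where
  "lin_span S = {(\<lambda>x. \<Sum>i<m. c i * g i x) | (m :: nat) c g. \<forall>i<m. g i \<in> S}"

definition L2_closure :: "'a measure \<Rightarrow> ('a \<Rightarrow> real) set \<Rightarrow> ('a \<Rightarrow> real) set" where
  "L2_closure P S = {h \<in> L2 P. \<forall>e>0. \<exists>s\<in>S. L2_norm P (\<lambda>x. h x - s x) < e}"

definition is_density_quotient :: "'a measure \<Rightarrow> 'a measure \<Rightarrow> ('a \<Rightarrow> ennreal) \<Rightarrow> bool" where
  "is_density_quotient P Q L \<longleftrightarrow>
     L \<in> borel_measurable Q \<and>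
     (\<forall>A\<in>sets Q. emeasure P A =
        (\<integral>\<^sup>+x\<in>A. L x \<partial>Q) + emeasure P (A \<inter> {x \<in> space Q. L x = \<infinity>})) \<and>
     emeasure Q {x \<in> space Q. L x < \<infinity>} = 1"

text \<open>
  A density quotient of \<open>P\<close> with respect to \<open>Q\<close> exists and is unique up to \<open>(P + Q)\<close>-null sets
  (Lebesgue decomposition), so the choice of the versions \<open>L t\<close> below is immaterial. Since
  \<open>L t < \<infinity>\<close> holds \<open>P\<^sub>0\<close>-almost everywhere, \<open>enn2real\<close> does not affect the norm.
\<close>

definition L2_diff_curve ::
  "'a measure set \<Rightarrow> 'a measure \<Rightarrow> real \<Rightarrow> (real \<Rightarrow> 'a measure) \<Rightarrow> ('a \<Rightarrow> real) \<Rightarrow> bool" where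
  "L2_diff_curve \<P> P0 \<epsilon> f g \<longleftrightarrow>
     \<epsilon> > 0 \<and> (\<forall>t. \<bar>t\<bar> < \<epsilon> \<longrightarrow> f t \<in> \<P>) \<and> f 0 = P0 \<and> g \<in> L2 P0 \<and>
     (\<exists>L. (\<forall>t. \<bar>t\<bar> < \<epsilon> \<longrightarrow> is_density_quotient (f t) P0 (L t)) \<and>
          (\<lambda>t. L2_norm P0 (\<lambda>x. 2 * (sqrt (enn2real (L t x)) - 1) - t * g x)) \<in> o[at 0](\<lambda>t. \<bar>t\<bar>) \<and>
          (\<lambda>t. measure (f t) {x \<in> space P0. L t x = \<infinity>}) \<in> o[at 0](\<lambda>t. t\<^sup>2))"

definition tangent_cone :: "'a measure \<Rightarrow> 'a measure set \<Rightarrow> ('a \<Rightarrow> real) set" where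
  "tangent_cone P0 \<P> = {g. \<exists>\<epsilon> f. L2_diff_curve \<P> P0 \<epsilon> f g}"

definition tangent_space :: "'a measure \<Rightarrow> 'a measure set \<Rightarrow> ('a \<Rightarrow> real) set" where
  "tangent_space P0 \<P> = L2_closure P0 (lin_span (tangent_cone P0 \<P>))"

definition is_gradient ::
  "'a measure set \<Rightarrow> 'a measure \<Rightarrow> ('a measure \<Rightarrow> real) \<Rightarrow> ('a \<Rightarrow> real) \<Rightarrow> bool" where
  "is_gradient \<P> P0 k kd \<longleftrightarrow>
     kd \<in> L2_zero P0 \<and>
     (\<forall>\<epsilon> f g. L2_diff_curve \<P> P0 \<epsilon> f g \<longrightarrow>
        ((\<lambda>t. (k (f t) - k P0) / t) \<longlongrightarrow> (\<integral>x. kd x * g x \<partial>P0)) (at_right 0))"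

definition is_canonical_gradient ::
  "'a measure set \<Rightarrow> 'a measure \<Rightarrow> ('a measure \<Rightarrow> real) \<Rightarrow> ('a \<Rightarrow> real) \<Rightarrow> bool" where
  "is_canonical_gradient \<P> P0 k kt \<longleftrightarrow> is_gradient \<P> P0 k kt \<and> kt \<in> tangent_space P0 \<P>"

definition nuisance_space ::
  "('a \<Rightarrow> real) \<Rightarrow> 'a measure \<Rightarrow> 'a measure set \<Rightarrow> ('a \<Rightarrow> real) set" where
  "nuisance_space kt P0 \<P> = {h \<in> tangent_space P0 \<P>. (\<integral>x. kt x * h x \<partial>P0) = 0}"

text \<open>
  Sequences \<open>(P\<^bsub>t\<^sub>n\<^esub>)\<^sub>n\<close> are represented by \<open>Q\<close> with \<open>Q n = P\<^bsub>t\<^sub>n\<^esub>\<close>. The index \<open>n = 0\<close> is included; it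
  imposes no restriction, as a sequence given for \<open>n \<ge> 1\<close> can be extended by \<open>t\<^sub>0 = 0\<close>.
  The limit of \<open>t\<^sub>n sqrt n\<close> is required to be finite: the differentiability of \<open>k\<close> does not control
  \<open>sqrt n (k(P\<^bsub>t\<^sub>n\<^esub>) - k(P\<^sub>0))\<close> otherwise.
\<close>

definition F1_seqs :: "'a measure set \<Rightarrow> 'a measure \<Rightarrow> (nat \<Rightarrow> 'a measure) set" where
  "F1_seqs \<P> P0 = {Q. \<exists>t \<epsilon> f g.
     t \<longlonglongrightarrow> 0 \<and> (\<exists>c>0. (\<lambda>n. t n * sqrt (real n)) \<longlonglongrightarrow> c) \<and>
     L2_diff_curve \<P> P0 \<epsilon> f g \<and> (\<forall>n. \<bar>t n\<bar> < \<epsilon> \<and> f (t n) = Q n)}"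

definition implicit_alternatives ::
  "'a measure set \<Rightarrow> 'a measure \<Rightarrow> ('a measure \<Rightarrow> real) \<Rightarrow> (nat \<Rightarrow> 'a measure) set" where
  "implicit_alternatives \<P> P0 k =
     {Q \<in> F1_seqs \<P> P0. \<exists>c>0. (\<lambda>n. sqrt (real n) * (k (Q n) - k P0)) \<longlonglongrightarrow> c}"

definition implicit_hypotheses ::
  "'a measure set \<Rightarrow> 'a measure \<Rightarrow> ('a measure \<Rightarrow> real) \<Rightarrow> (nat \<Rightarrow> 'a measure) set" where
  "implicit_hypotheses \<P> P0 k =
     {Q \<in> F1_seqs \<P> P0. \<exists>c\<le>0. (\<lambda>n. sqrt (real n) * (k (Q n) - k P0)) \<longlonglongrightarrow> c}"

text \<open>Points of \<open>\<Omega>\<^sup>n\<close> are functions \<open>\<omega>\<close> on the index set \<open>{..<n}\<close>.\<close>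

definition is_test_seq :: "'a measure \<Rightarrow> (nat \<Rightarrow> (nat \<Rightarrow> 'a) \<Rightarrow> real) \<Rightarrow> bool" where
  "is_test_seq M \<psi> \<longleftrightarrow>
     (\<forall>n. \<psi> n \<in> borel_measurable (\<Pi>\<^sub>M i\<in>{..<n}. M) \<and>
          (\<forall>\<omega>\<in>space (\<Pi>\<^sub>M i\<in>{..<n}. M). 0 \<le> \<psi> n \<omega> \<and> \<psi> n \<omega> \<le> 1))"

definition power_fn ::
  "(nat \<Rightarrow> (nat \<Rightarrow> 'a) \<Rightarrow> real) \<Rightarrow> (nat \<Rightarrow> 'a measure) \<Rightarrow> nat \<Rightarrow> real" where
  "power_fn \<psi> Q n = (\<integral>\<omega>. \<psi> n \<omega> \<partial>(\<Pi>\<^sub>M i\<in>{..<n}. Q n))"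

definition asymp_similar_tests ::
  "'a measure \<Rightarrow> 'a measure set \<Rightarrow> 'a measure \<Rightarrow> ('a measure \<Rightarrow> real) \<Rightarrow> real
    \<Rightarrow> (nat \<Rightarrow> (nat \<Rightarrow> 'a) \<Rightarrow> real) set" where
  "asymp_similar_tests M \<P> P0 k \<alpha> =
     {\<psi>. is_test_seq M \<psi> \<and>
          (\<forall>Q\<in>implicit_hypotheses \<P> P0 k.
             (\<lambda>n. sqrt (real n) * (k (Q n) - k P0)) \<longlonglongrightarrow> 0 \<longrightarrow> power_fn \<psi> Q \<longlonglongrightarrow> \<alpha>)}"

definition asymp_optimal ::
  "(nat \<Rightarrow> (nat \<Rightarrow> 'a) \<Rightarrow> real) set \<Rightarrow> (nat \<Rightarrow> 'a measure) set \<Rightarrow> (nat \<Rightarrow> 'a measure) set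
    \<Rightarrow> (nat \<Rightarrow> (nat \<Rightarrow> 'a) \<Rightarrow> real) \<Rightarrow> bool" where
  "asymp_optimal C H K \<phi> \<longleftrightarrow>
     \<phi> \<in> C \<and>
     (\<forall>Q\<in>H \<union> K. convergent (power_fn \<phi> Q)) \<and>
     (\<forall>\<psi>\<in>C.
        (\<forall>Q\<in>K. limsup (\<lambda>n. ereal (power_fn \<psi> Q n)) \<le> ereal (lim (power_fn \<phi> Q))) \<and>
        (\<forall>Q\<in>H. liminf (\<lambda>n. ereal (power_fn \<psi> Q n)) \<ge> ereal (lim (power_fn \<phi> Q))))"

definition std_normal_quantile :: "real \<Rightarrow> real" where
  "std_normal_quantile = inv (cdf std_normal_distribution)"

definition gradient_test ::
  "('a \<Rightarrow> real) \<Rightarrow> 'a measure \<Rightarrow> real \<Rightarrow> nat \<Rightarrow> (nat \<Rightarrow> 'a) \<Rightarrow> real" where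
  "gradient_test kt P0 \<alpha> n \<omega> =
     (if 1 / sqrt (real n) * (\<Sum>i<n. kt (\<omega> i)) > std_normal_quantile (1 - \<alpha>) * L2_norm P0 kt
      then 1 else 0)"

end

theory Submission
  imports Defs
begin

text \<open>
  Along an \<open>L\<^sub>2\<close>-differentiable curve with tangent \<open>g\<close> and \<open>t\<^sub>n sqrt n \<longlonglongrightarrow> c\<close>, the square roots \<open>s\<^sub>n\<close> of the
  densities satisfy \<open>sqrt n (s\<^sub>n - 1) \<longlonglongrightarrow> c g / 2\<close> in \<open>L\<^sub>2(P\<^sub>0)\<close>. Expanding characteristic functions under
  \<open>P\<^bsub>t\<^sub>n\<^esub>\<close> itself, without contiguity or joint limit laws, shows that \<open>n\<^bsup>-1/2\<^esup> \<Sum> X(\<omega>\<^sub>i)\<close>, for centered \<open>X\<close>, is asymptotically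
  normal with mean \<open>\<integral> X c g dP\<^sub>0\<close> and variance \<open>\<integral> X\<^sup>2 dP\<^sub>0\<close>, which gives the power of \<open>\<phi>\<^sub>n\<close>.

  For the upper bound write \<open>c g = w + h\<close> with \<open>w\<close> a multiple of the canonical gradient and \<open>h\<close> in the
  nuisance space, and let \<open>d \<in> D\<close> be close to \<open>h\<close>. A similar test has limiting power \<open>\<alpha>\<close> along the curve
  with tangent \<open>d\<close> at \<open>t\<^sub>n = n\<^bsup>-1/2\<^esup>\<close>, so the Neyman-Pearson lemma for these two simple hypotheses applies.
  The likelihood ratio is replaced by \<open>exp (n\<^bsup>-1/2\<^esup> \<Sum> X(\<omega>\<^sub>i) - const)\<close> for a bounded centered
  approximation \<open>X\<close> of \<open>w\<close>; the error is controlled by a Hellinger affinity of product form, with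
  limit \<open>exp (- \<parallel>c g - d - X\<parallel>\<^sup>2 / 8)\<close>. Letting \<open>d \<longlonglongrightarrow> h\<close> and \<open>X \<longlonglongrightarrow> w\<close> gives the Gaussian shift bound. The
  statement on the hypotheses is the same bound for \<open>1 - \<psi>\<^sub>n\<close>.
\<close>

section \<open>Convergence in \<open>L\<^sub>2\<close>\<close>

lemma L2_measurable: "h \<in> L2 P \<Longrightarrow> h \<in> borel_measurable P"
  by (simp add: L2_def)

lemma L2_square_integrable: "h \<in> L2 P \<Longrightarrow> integrable P (\<lambda>x. (h x)\<^sup>2)"
  by (simp add: L2_def)

lemma L2_mult_integrable:
  assumes "f \<in> L2 P" "g \<in> L2 P"
  shows "integrable P (\<lambda>x. f x * g x)"
proof (rule Bochner_Integration.integrable_bound)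
  show "integrable P (\<lambda>x. (f x)\<^sup>2 + (g x)\<^sup>2)"
    using assms by (intro Bochner_Integration.integrable_add L2_square_integrable)
  show "(\<lambda>x. f x * g x) \<in> borel_measurable P"
    using assms[THEN L2_measurable] by measurable
  have "\<bar>a * b\<bar> \<le> \<bar>a\<^sup>2 + b\<^sup>2\<bar>" for a b :: real
  proof -
    have "2 * \<bar>a * b\<bar> \<le> a\<^sup>2 + b\<^sup>2"
      using sum_squares_bound[of "\<bar>a\<bar>" "\<bar>b\<bar>"] by (simp add: abs_mult)
    then show ?thesis by linarith
  qed
  then show "AE x in P. norm (f x * g x) \<le> norm ((f x)\<^sup>2 + (g x)\<^sup>2)"
    by simp
qed

lemma L2_add: "f \<in> L2 P \<Longrightarrow> g \<in> L2 P \<Longrightarrow> (\<lambda>x. f x + g x) \<in> L2 P"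
  using L2_mult_integrable[of f P g]
  by (auto simp: L2_def power2_sum mult.assoc)

lemma L2_cmult: "f \<in> L2 P \<Longrightarrow> (\<lambda>x. c * f x) \<in> L2 P"
  by (auto simp: L2_def power_mult_distrib)

lemma L2_diff: "f \<in> L2 P \<Longrightarrow> g \<in> L2 P \<Longrightarrow> (\<lambda>x. f x - g x) \<in> L2 P"
  using L2_add[of f P "\<lambda>x. (-1) * g x"] L2_cmult[of g P "-1"] by simp

lemma L2_bounded:
  assumes "finite_measure P" "f \<in> borel_measurable P" "\<And>x. \<bar>f x\<bar> \<le> B"
  shows "f \<in> L2 P"
proof -
  interpret finite_measure P by fact
  have "\<bar>(f x)\<^sup>2\<bar> \<le> B\<^sup>2" for x
    using assms(3)[of x] by (simp add: abs_le_square_iff[symmetric])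
  then show ?thesis
    using assms(2) by (auto simp: L2_def intro!: integrable_const_bound[where B="B\<^sup>2"])
qed

lemma L2_const: "finite_measure P \<Longrightarrow> (\<lambda>x. c) \<in> L2 P"
  by (rule L2_bounded[where B="\<bar>c\<bar>"]) auto

lemma L2_abs: "f \<in> L2 P \<Longrightarrow> (\<lambda>x. \<bar>f x\<bar>) \<in> L2 P"
  by (auto simp: L2_def)

lemma L2_integrable: "finite_measure P \<Longrightarrow> f \<in> L2 P \<Longrightarrow> integrable P f"
  using L2_mult_integrable[of f P "\<lambda>x. 1"] L2_const[of P 1] by simp

lemma L2_norm_nonneg [simp]: "0 \<le> L2_norm P f"
  by (simp add: L2_norm_def)

lemma L2_norm_power2: "(L2_norm P f)\<^sup>2 = (\<integral>x. (f x)\<^sup>2 \<partial>P)"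
  by (simp add: L2_norm_def)

lemma L2_norm_cmult: "L2_norm P (\<lambda>x. c * f x) = \<bar>c\<bar> * L2_norm P f"
  by (simp add: L2_norm_def power_mult_distrib real_sqrt_mult)

lemma L2_norm_minus_commute: "L2_norm P (\<lambda>x. f x - g x) = L2_norm P (\<lambda>x. g x - f x)"
  by (simp add: L2_norm_def power2_commute)

text \<open>Weighted arithmetic-geometric mean: with \<open>a\<close>, \<open>b\<close> the two
  norms, integrate \<open>0 \<le> (b * \<bar>f x\<bar> - a * \<bar>g x\<bar>)\<^sup>2 / (2 * a *
  b)\<close>. If one norm is zero, that factor vanishes almost everywhere. The absolute value stays
  inside the integral because the lemma is used for \<open>L\<^sub>1\<close> errors.\<close>

lemma L2_Cauchy_Schwarz:
  assumes f: "f \<in> L2 P" and g: "g \<in> L2 P"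
  shows "(\<integral>x. \<bar>f x * g x\<bar> \<partial>P) \<le> L2_norm P f * L2_norm P g"
proof -
  define a b where "a = L2_norm P f" and "b = L2_norm P g"
  note [measurable] = L2_measurable[OF f] L2_measurable[OF g]
  have int: "integrable P (\<lambda>x. \<bar>f x * g x\<bar>)"
    using L2_mult_integrable[OF f g] by (rule integrable_abs)
  have null: "AE x in P. h x = 0" if "L2_norm P h = 0" "h \<in> L2 P" for h
  proof -
    have "(\<integral>x. (h x)\<^sup>2 \<partial>P) = 0"
      using that(1) by (simp add: L2_norm_def)
    then have "AE x in P. (h x)\<^sup>2 = 0"
      using integral_nonneg_eq_0_iff_AE[OF L2_square_integrable[OF that(2)]] by simp
    then show ?thesis by simp
  qed
  show ?thesis
  proof (cases "a = 0 \<or> b = 0")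
    case True
    then have "AE x in P. f x = 0 \<or> g x = 0"
      using null[OF _ f] null[OF _ g] by (auto simp: a_def b_def)
    then have "(\<integral>x. \<bar>f x * g x\<bar> \<partial>P) = (\<integral>x. 0 \<partial>P)"
      by (intro integral_cong_AE) auto
    then show ?thesis by simp
  next
    case False
    then have pos: "a > 0" "b > 0"
      using L2_norm_nonneg[of P f] L2_norm_nonneg[of P g] unfolding a_def b_def by linarith+
    have le: "\<bar>f x * g x\<bar> \<le> (b / (2 * a)) * (f x)\<^sup>2 + (a / (2 * b)) * (g x)\<^sup>2" for x
    proof -
      have "0 \<le> (b * \<bar>f x\<bar> - a * \<bar>g x\<bar>)\<^sup>2 / (2 * a * b)"
        using pos by simp
      also have "\<dots> = (b / (2 * a)) * (f x)\<^sup>2 + (a / (2 * b)) * (g x)\<^sup>2 - \<bar>f x * g x\<bar>"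
        using pos by (simp add: power2_diff power_mult_distrib abs_mult field_simps power2_eq_square)
      finally show ?thesis by simp
    qed
    have "(\<integral>x. \<bar>f x * g x\<bar> \<partial>P) \<le> (\<integral>x. (b / (2 * a)) * (f x)\<^sup>2 + (a / (2 * b)) * (g x)\<^sup>2 \<partial>P)"
      using L2_square_integrable[OF f] L2_square_integrable[OF g] by (intro integral_mono int le) auto
    also have "\<dots> = (b / (2 * a)) * a\<^sup>2 + (a / (2 * b)) * b\<^sup>2"
      using L2_square_integrable[OF f] L2_square_integrable[OF g]
      by (simp add: a_def b_def L2_norm_power2)
    also have "\<dots> = a * b"
      using pos by (simp add: power2_eq_square)
    finally show ?thesis by (simp add: a_def b_def)
  qed
qed

lemma L2_inner_le:
  assumes "f \<in> L2 P" "g \<in> L2 P"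
  shows "\<bar>\<integral>x. f x * g x \<partial>P\<bar> \<le> L2_norm P f * L2_norm P g"
  using integral_abs_bound[of P "\<lambda>x. f x * g x"] L2_Cauchy_Schwarz[OF assms] by linarith

lemma L2_norm_triangle:
  assumes f: "f \<in> L2 P" and g: "g \<in> L2 P"
  shows "L2_norm P (\<lambda>x. f x + g x) \<le> L2_norm P f + L2_norm P g"
proof (rule power2_le_imp_le)
  have "(L2_norm P (\<lambda>x. f x + g x))\<^sup>2 = (\<integral>x. ((f x)\<^sup>2 + (g x)\<^sup>2) + 2 * (f x * g x) \<partial>P)"
    by (simp add: L2_norm_power2 power2_sum mult.assoc)
  also have "\<dots> = (L2_norm P f)\<^sup>2 + (L2_norm P g)\<^sup>2 + 2 * (\<integral>x. f x * g x \<partial>P)"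
    using L2_square_integrable[OF f] L2_square_integrable[OF g] L2_mult_integrable[OF f g]
    by (simp add: L2_norm_power2)
  also have "\<dots> \<le> (L2_norm P f + L2_norm P g)\<^sup>2"
    using L2_inner_le[OF f g] by (simp add: power2_sum)
  finally show "(L2_norm P (\<lambda>x. f x + g x))\<^sup>2 \<le> (L2_norm P f + L2_norm P g)\<^sup>2" .
qed simp

section \<open>Convergence in the \<open>L\<^sub>2\<close> seminorm\<close>

text \<open>Membership in \<open>L2 P\<close> is part of the notion: the integral of a
  non-integrable function is 0 by default, so a small \<open>L2_norm\<close> alone would say nothing
  about a difference outside \<open>L2 P\<close>.\<close>

definition L2_tendsto :: "'a measure \<Rightarrow> (nat \<Rightarrow> 'a \<Rightarrow> real) \<Rightarrow> ('a \<Rightarrow> real) \<Rightarrow> bool" where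
  "L2_tendsto P F f \<longleftrightarrow>
     (\<forall>n. F n \<in> L2 P) \<and> f \<in> L2 P \<and> (\<lambda>n. L2_norm P (\<lambda>x. F n x - f x)) \<longlonglongrightarrow> 0"

lemma L2_tendstoD:
  assumes "L2_tendsto P F f"
  shows "F n \<in> L2 P" "f \<in> L2 P" "(\<lambda>n. L2_norm P (\<lambda>x. F n x - f x)) \<longlonglongrightarrow> 0"
  using assms by (auto simp: L2_tendsto_def)

lemma L2_tendsto_const: "f \<in> L2 P \<Longrightarrow> L2_tendsto P (\<lambda>n. f) f"
  by (simp add: L2_tendsto_def L2_norm_def)

lemma L2_tendsto_cmult: "L2_tendsto P F f \<Longrightarrow> L2_tendsto P (\<lambda>n x. c * F n x) (\<lambda>x. c * f x)"
  unfolding L2_tendsto_def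
  by (auto simp: L2_norm_cmult right_diff_distrib[symmetric] intro!: L2_cmult tendsto_mult_right_zero)

lemma L2_tendsto_add:
  assumes F: "L2_tendsto P F f" and G: "L2_tendsto P G g"
  shows "L2_tendsto P (\<lambda>n x. F n x + G n x) (\<lambda>x. f x + g x)"
proof -
  have "(\<lambda>n. L2_norm P (\<lambda>x. F n x + G n x - (f x + g x))) \<longlonglongrightarrow> 0"
  proof (rule tendsto_sandwich[OF _ _ tendsto_const])
    show "(\<lambda>n. L2_norm P (\<lambda>x. F n x - f x) + L2_norm P (\<lambda>x. G n x - g x)) \<longlonglongrightarrow> 0"
      using tendsto_add[OF L2_tendstoD(3)[OF F] L2_tendstoD(3)[OF G]] by simp
    show "\<forall>\<^sub>F n in sequentially. L2_norm P (\<lambda>x. F n x + G n x - (f x + g x))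
        \<le> L2_norm P (\<lambda>x. F n x - f x) + L2_norm P (\<lambda>x. G n x - g x)"
    proof (intro always_eventually allI)
      fix n
      show "L2_norm P (\<lambda>x. F n x + G n x - (f x + g x))
        \<le> L2_norm P (\<lambda>x. F n x - f x) + L2_norm P (\<lambda>x. G n x - g x)"
        using L2_norm_triangle[of "\<lambda>x. F n x - f x" P "\<lambda>x. G n x - g x"] F G
        by (simp add: L2_tendsto_def L2_diff algebra_simps)
    qed
  qed auto
  then show ?thesis
    using F G by (auto simp: L2_tendsto_def intro: L2_add)
qed

lemma L2_tendsto_diff:
  assumes "L2_tendsto P F f" "L2_tendsto P G g"
  shows "L2_tendsto P (\<lambda>n x. F n x - G n x) (\<lambda>x. f x - g x)"
  using L2_tendsto_add[OF assms(1) L2_tendsto_cmult[OF assms(2), of "-1"]] by simp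

text \<open>Write \<open>F G - f g = (F - f) (G - g) + f (G - g) + (F - f) g\<close> and apply
  Cauchy-Schwarz to each term; products of \<open>L\<^sub>2\<close>-convergent sequences converge in
  \<open>L\<^sub>1\<close>.\<close>

lemma L2_tendsto_mult:
  assumes F: "L2_tendsto P F f" and G: "L2_tendsto P G g"
  shows "(\<lambda>n. \<integral>x. \<bar>F n x * G n x - f x * g x\<bar> \<partial>P) \<longlonglongrightarrow> 0"
proof (rule tendsto_sandwich[OF _ _ tendsto_const])
  note F' = L2_tendstoD[OF F] and G' = L2_tendstoD[OF G]
  let ?a = "\<lambda>n. L2_norm P (\<lambda>x. F n x - f x)" and ?b = "\<lambda>n. L2_norm P (\<lambda>x. G n x - g x)"
  show "(\<lambda>n. ?a n * ?b n + (L2_norm P f * ?b n + ?a n * L2_norm P g)) \<longlonglongrightarrow> 0"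
    using F'(3) G'(3) by (auto intro!: tendsto_eq_intros)
  show "\<forall>\<^sub>F n in sequentially. 0 \<le> (\<integral>x. \<bar>F n x * G n x - f x * g x\<bar> \<partial>P)"
    by simp
  show "\<forall>\<^sub>F n in sequentially. (\<integral>x. \<bar>F n x * G n x - f x * g x\<bar> \<partial>P)
      \<le> ?a n * ?b n + (L2_norm P f * ?b n + ?a n * L2_norm P g)"
  proof (intro always_eventually allI)
    fix n
    have dF: "(\<lambda>x. F n x - f x) \<in> L2 P" and dG: "(\<lambda>x. G n x - g x) \<in> L2 P"
      using F' G' by (auto intro: L2_diff)
    let ?A = "\<lambda>x. (F n x - f x) * (G n x - g x)" and ?B = "\<lambda>x. f x * (G n x - g x)"
      and ?C = "\<lambda>x. (F n x - f x) * g x"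
    have ints: "integrable P ?A" "integrable P ?B" "integrable P ?C"
      "integrable P (\<lambda>x. F n x * G n x)" "integrable P (\<lambda>x. f x * g x)"
      by (intro L2_mult_integrable dF dG F'(1,2) G'(1,2))+
    have "(\<integral>x. \<bar>F n x * G n x - f x * g x\<bar> \<partial>P) \<le> (\<integral>x. \<bar>?A x\<bar> + (\<bar>?B x\<bar> + \<bar>?C x\<bar>) \<partial>P)"
    proof (rule integral_mono)
      fix x
      have "F n x * G n x - f x * g x = ?A x + (?B x + ?C x)"
        by (simp add: algebra_simps)
      then show "\<bar>F n x * G n x - f x * g x\<bar> \<le> \<bar>?A x\<bar> + (\<bar>?B x\<bar> + \<bar>?C x\<bar>)"
        by linarith
    next
      show "integrable P (\<lambda>x. \<bar>F n x * G n x - f x * g x\<bar>)"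
        using ints by (intro integrable_abs Bochner_Integration.integrable_diff)
      show "integrable P (\<lambda>x. \<bar>?A x\<bar> + (\<bar>?B x\<bar> + \<bar>?C x\<bar>))"
        using ints by (intro integrable_abs Bochner_Integration.integrable_add)
    qed
    also have "\<dots> = (\<integral>x. \<bar>?A x\<bar> \<partial>P) + ((\<integral>x. \<bar>?B x\<bar> \<partial>P) + (\<integral>x. \<bar>?C x\<bar> \<partial>P))"
      using ints(1-3)[THEN integrable_abs]
      by (subst Bochner_Integration.integral_add, simp, intro Bochner_Integration.integrable_add, simp_all)
    also have "\<dots> \<le> ?a n * ?b n + (L2_norm P f * ?b n + ?a n * L2_norm P g)"
      using L2_Cauchy_Schwarz[OF dF dG] L2_Cauchy_Schwarz[OF F'(2) dG] L2_Cauchy_Schwarz[OF dF G'(2)]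
      by linarith
    finally show "(\<integral>x. \<bar>F n x * G n x - f x * g x\<bar> \<partial>P)
      \<le> ?a n * ?b n + (L2_norm P f * ?b n + ?a n * L2_norm P g)" .
  qed
qed

lemma L2_tendsto_inner:
  assumes F: "L2_tendsto P F f" and G: "L2_tendsto P G g"
  shows "(\<lambda>n. \<integral>x. F n x * G n x \<partial>P) \<longlonglongrightarrow> (\<integral>x. f x * g x \<partial>P)"
proof (rule Lim_transform[OF tendsto_const], rule Lim_null_comparison[OF _ L2_tendsto_mult[OF F G]],
    intro always_eventually allI)
  fix n
  have "(\<integral>x. F n x * G n x \<partial>P) - (\<integral>x. f x * g x \<partial>P) = (\<integral>x. F n x * G n x - f x * g x \<partial>P)"
    using L2_mult_integrable[OF L2_tendstoD(1)[OF F] L2_tendstoD(1)[OF G], of n n]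
      L2_mult_integrable[OF L2_tendstoD(2)[OF F] L2_tendstoD(2)[OF G]] by simp
  then show "norm ((\<integral>x. F n x * G n x \<partial>P) - (\<integral>x. f x * g x \<partial>P)) \<le> (\<integral>x. \<bar>F n x * G n x - f x * g x\<bar> \<partial>P)"
    using integral_abs_bound[of P "\<lambda>x. F n x * G n x - f x * g x"] by simp
qed

lemma L2_tendsto_square:
  "L2_tendsto P F f \<Longrightarrow> (\<lambda>n. \<integral>x. (F n x)\<^sup>2 \<partial>P) \<longlonglongrightarrow> (\<integral>x. (f x)\<^sup>2 \<partial>P)"
  using L2_tendsto_inner[of P F f F f] by (simp add: power2_eq_square)

lemma L2_tendsto_norm: "L2_tendsto P F f \<Longrightarrow> (\<lambda>n. L2_norm P (F n)) \<longlonglongrightarrow> L2_norm P f"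
  unfolding L2_norm_def by (intro tendsto_real_sqrt L2_tendsto_square)

section \<open>Limits of integrals with an \<open>L\<^sub>1\<close>-convergent factor, and of
  \<open>n\<close>-th powers\<close>

text \<open>Dominated convergence treats \<open>F n\<close> against the fixed limit
  \<open>z\<close>, and replacing \<open>Z n\<close> by \<open>z\<close> costs at most
  \<open>C\<close> times their \<open>L\<^sub>1\<close> distance. In this way no common dominating
  function for the \<open>Z n\<close> has to be found.\<close>

lemma tendsto_integral_bounded_mult_L1:
  fixes F :: "nat \<Rightarrow> 'a \<Rightarrow> complex" and Z :: "nat \<Rightarrow> 'a \<Rightarrow> real"
  assumes F [measurable]: "\<And>n. F n \<in> borel_measurable P" "f \<in> borel_measurable P"
    and bound: "\<And>n x. x \<in> space P \<Longrightarrow> cmod (F n x) \<le> C"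
    and lim: "\<And>x. x \<in> space P \<Longrightarrow> (\<lambda>n. F n x) \<longlonglongrightarrow> f x"
    and Z: "\<And>n. integrable P (Z n)" "integrable P z"
    and Zlim: "(\<lambda>n. \<integral>x. \<bar>Z n x - z x\<bar> \<partial>P) \<longlonglongrightarrow> 0"
  shows "(\<lambda>n. \<integral>x. F n x * of_real (Z n x) \<partial>P) \<longlonglongrightarrow> (\<integral>x. f x * of_real (z x) \<partial>P)"
proof -
  note [measurable] = borel_measurable_integrable[OF Z(1)] borel_measurable_integrable[OF Z(2)]
  have int: "integrable P (\<lambda>x. F n x * of_real (h x))" if h: "integrable P h" for n h
  proof (rule Bochner_Integration.integrable_bound)
    show "integrable P (\<lambda>x. C * h x)" using h by simp
    note [measurable] = borel_measurable_integrable[OF h]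
    show "(\<lambda>x. F n x * of_real (h x)) \<in> borel_measurable P" by measurable
    have "cmod (F n x * of_real (h x)) \<le> cmod (of_real (C * h x))" if "x \<in> space P" for x
      using bound[OF that, of n] by (auto simp: norm_mult intro!: mult_right_mono)
    then show "AE x in P. norm (F n x * of_real (h x)) \<le> norm (C * h x)"
      by (intro AE_I2) (simp only: norm_of_real real_norm_def)
  qed
  have 1: "(\<lambda>n. \<integral>x. F n x * of_real (z x) \<partial>P) \<longlonglongrightarrow> (\<integral>x. f x * of_real (z x) \<partial>P)"
  proof (rule integral_dominated_convergence[where w="\<lambda>x. C * \<bar>z x\<bar>"])
    show "integrable P (\<lambda>x. C * \<bar>z x\<bar>)" using Z by simp
    show "AE x in P. (\<lambda>n. F n x * of_real (z x)) \<longlonglongrightarrow> f x * of_real (z x)"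
      using lim by (intro AE_I2 tendsto_mult tendsto_const)
    show "AE x in P. norm (F n x * of_real (z x)) \<le> C * \<bar>z x\<bar>" for n
      using bound by (intro AE_I2) (auto simp: norm_mult intro!: mult_right_mono)
  qed measurable
  have 2: "(\<lambda>n. \<integral>x. F n x * of_real (Z n x - z x) \<partial>P) \<longlonglongrightarrow> 0"
  proof (rule Lim_null_comparison)
    show "(\<lambda>n. C * (\<integral>x. \<bar>Z n x - z x\<bar> \<partial>P)) \<longlonglongrightarrow> 0"
      by (rule tendsto_mult_right_zero[OF Zlim])
    show "\<forall>\<^sub>F n in sequentially. norm (\<integral>x. F n x * of_real (Z n x - z x) \<partial>P) \<le> C * (\<integral>x. \<bar>Z n x - z x\<bar> \<partial>P)"
    proof (intro always_eventually allI)
      fix n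
      have "norm (\<integral>x. F n x * of_real (Z n x - z x) \<partial>P) \<le> (\<integral>x. norm (F n x * of_real (Z n x - z x)) \<partial>P)"
        by (rule integral_norm_bound)
      also have "\<dots> \<le> (\<integral>x. C * \<bar>Z n x - z x\<bar> \<partial>P)"
      proof (rule integral_mono)
        show "integrable P (\<lambda>x. norm (F n x * of_real (Z n x - z x)))"
          using Z by (intro integrable_norm int) auto
        show "integrable P (\<lambda>x. C * \<bar>Z n x - z x\<bar>)" using Z by simp
        show "norm (F n x * of_real (Z n x - z x)) \<le> C * \<bar>Z n x - z x\<bar>" if "x \<in> space P" for x
          unfolding norm_mult norm_of_real using bound[OF that] by (rule mult_right_mono) simp
      qed
      finally show "norm (\<integral>x. F n x * of_real (Z n x - z x) \<partial>P) \<le> C * (\<integral>x. \<bar>Z n x - z x\<bar> \<partial>P)"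
        by simp
    qed
  qed
  have "(\<integral>x. F n x * of_real (z x) \<partial>P) + (\<integral>x. F n x * of_real (Z n x - z x) \<partial>P)
      = (\<integral>x. F n x * of_real (Z n x) \<partial>P)" for n
    using int[OF Z(1), of n n] int[OF Z(2), of n] by (simp add: right_diff_distrib)
  then show ?thesis
    using tendsto_add[OF 1 2] by simp
qed

text \<open>The hypothesis forces \<open>y n\<close> to tend to 1; then
  \<open>y n ^ n = exp (n * Ln (y n))\<close>, and \<open>Ln w\<close> is asymptotic to
  \<open>w - 1\<close> at 1. This replaces expansions of log-likelihoods: all limits over product
  measures below are limits of such powers.\<close>

lemma power_tendsto_exp:
  fixes y :: "nat \<Rightarrow> complex"
  assumes "(\<lambda>n. of_nat n * (y n - 1)) \<longlonglongrightarrow> a"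
  shows "(\<lambda>n. y n ^ n) \<longlonglongrightarrow> exp a"
proof -
  have "(\<lambda>n. (1 / of_nat n) * (of_nat n * (y n - 1))) \<longlonglongrightarrow> 0 * a"
    by (intro tendsto_mult assms lim_1_over_n)
  moreover have "\<forall>\<^sub>F n in sequentially. (1 / of_nat n) * (of_nat n * (y n - 1)) = y n - 1"
    using eventually_gt_at_top[of 0] by eventually_elim auto
  ultimately have "(\<lambda>n. y n - 1) \<longlonglongrightarrow> 0"
    using tendsto_cong by fastforce
  then have y1: "y \<longlonglongrightarrow> 1"
    using LIM_zero_cancel by blast
  \<comment> \<open>\<open>q\<close> extends \<open>Ln w / (w - 1)\<close> continuously to
    \<open>w = 1\<close>, so that indices with \<open>y n = 1\<close> fit the same identity
    \<open>q w * (w - 1) = Ln w\<close>.\<close>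
  define q where "q w = (if w = 1 then 1 else Ln w / (w - 1))" for w :: complex
  have "((\<lambda>w. (Ln w - Ln 1) / (w - 1)) \<longlongrightarrow> 1) (at 1)"
    using has_field_derivative_Ln[of 1] by (simp add: has_field_derivative_iff)
  then have "(q \<longlongrightarrow> 1) (at 1)"
    by (rule Lim_transform_eventually) (auto simp: q_def eventually_at_filter)
  then have "isCont q 1"
    by (simp add: isCont_def q_def)
  then have "(\<lambda>n. q (y n)) \<longlonglongrightarrow> q 1"
    using y1 by (rule isCont_tendsto_compose)
  then have "(\<lambda>n. exp (q (y n) * (of_nat n * (y n - 1)))) \<longlonglongrightarrow> exp (1 * a)"
    by (intro tendsto_exp tendsto_mult assms) (simp add: q_def)
  moreover have "\<forall>\<^sub>F n in sequentially. y n \<noteq> 0"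
    using y1 by (rule tendsto_imp_eventually_ne) simp
  then have "\<forall>\<^sub>F n in sequentially. exp (q (y n) * (of_nat n * (y n - 1))) = y n ^ n"
  proof eventually_elim
    case (elim n)
    have "q (y n) * (of_nat n * (y n - 1)) = of_nat n * Ln (y n)"
      by (auto simp: q_def)
    then have "exp (q (y n) * (of_nat n * (y n - 1))) = exp (of_nat n * Ln (y n))"
      by (rule arg_cong)
    also have "\<dots> = y n ^ n"
      using elim by (simp add: exp_of_nat_mult)
    finally show ?case .
  qed
  ultimately show ?thesis
    using tendsto_cong by fastforce
qed

lemma power_tendsto_exp_real:
  fixes y :: "nat \<Rightarrow> real"
  assumes "(\<lambda>n. real n * (y n - 1)) \<longlonglongrightarrow> a"
  shows "(\<lambda>n. y n ^ n) \<longlonglongrightarrow> exp a"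
proof -
  have "(\<lambda>n. complex_of_real (real n * (y n - 1))) \<longlonglongrightarrow> of_real a"
    using assms by (rule tendsto_of_real)
  then have "(\<lambda>n. of_nat n * (complex_of_real (y n) - 1)) \<longlonglongrightarrow> of_real a"
    by simp
  from power_tendsto_exp[OF this] show ?thesis
    by (simp add: exp_of_real tendsto_of_real_iff flip: of_real_power)
qed

section \<open>Expansions of root densities\<close>

definition L2_root_expansion :: "'a measure \<Rightarrow> (nat \<Rightarrow> 'a \<Rightarrow> real) \<Rightarrow> ('a \<Rightarrow> real) \<Rightarrow> bool" where
  "L2_root_expansion P s g \<longleftrightarrow>
     (\<forall>n. s n \<in> L2 P) \<and> g \<in> L2 P \<and>
     L2_tendsto P (\<lambda>n x. sqrt n * (s n x - 1)) (\<lambda>x. g x / 2) \<and>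
     (\<lambda>n. n * ((\<integral>x. (s n x)\<^sup>2 \<partial>P) - 1)) \<longlonglongrightarrow> 0"

lemma L2_root_expansionD:
  assumes "L2_root_expansion P s g"
  shows "s n \<in> L2 P" "g \<in> L2 P" "L2_tendsto P (\<lambda>n x. sqrt n * (s n x - 1)) (\<lambda>x. g x / 2)"
    "(\<lambda>n. n * ((\<integral>x. (s n x)\<^sup>2 \<partial>P) - 1)) \<longlonglongrightarrow> 0"
  using assms by (auto simp: L2_root_expansion_def)

lemma L2_root_expansion_mean:
  assumes "prob_space P" and s: "L2_root_expansion P s g"
  shows "(\<lambda>n. n * ((\<integral>x. s n x \<partial>P) - 1)) \<longlonglongrightarrow> - (\<integral>x. (g x)\<^sup>2 \<partial>P) / 8"
proof -
  interpret prob_space P by fact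
  note s' = L2_root_expansionD[OF s]
  have int: "integrable P (s n)" "integrable P (\<lambda>x. (s n x)\<^sup>2)" for n
    using s'(1)[of n] by (auto intro: L2_integrable L2_square_integrable finite_measure_axioms)
  have eq: "n * ((\<integral>x. s n x \<partial>P) - 1) =
      (n * ((\<integral>x. (s n x)\<^sup>2 \<partial>P) - 1) - (\<integral>x. (sqrt n * (s n x - 1))\<^sup>2 \<partial>P)) / 2" for n
  proof -
    have "(\<integral>x. (sqrt n * (s n x - 1))\<^sup>2 \<partial>P) = (\<integral>x. n * (s n x)\<^sup>2 - 2 * n * s n x + n \<partial>P)"
      by (intro Bochner_Integration.integral_cong refl) (simp add: power_mult_distrib power2_diff algebra_simps)
    also have "\<dots> = n * (\<integral>x. (s n x)\<^sup>2 \<partial>P) - 2 * n * (\<integral>x. s n x \<partial>P) + n"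
      using int[of n] by (simp add: prob_space)
    finally show ?thesis by (simp add: algebra_simps)
  qed
  have "(\<lambda>n. (n * ((\<integral>x. (s n x)\<^sup>2 \<partial>P) - 1) - (\<integral>x. (sqrt n * (s n x - 1))\<^sup>2 \<partial>P)) / 2)
      \<longlonglongrightarrow> (0 - (\<integral>x. (g x / 2)\<^sup>2 \<partial>P)) / 2"
    by (intro tendsto_intros s'(4) L2_tendsto_square s'(3)) simp
  then show ?thesis
    unfolding eq by (simp add: power_divide)
qed

text \<open>From \<open>s s' - 1 = (s - 1) + (s' - 1) + (s - 1) (s' - 1)\<close>: the two means
  contribute \<open>-1/8\<close> of the squared norms, the product contributes \<open>1/4\<close> of
  the inner product, and together they form a square. This is the local form of the Hellinger
  affinity.\<close>

lemma L2_root_expansion_affinity: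
  assumes "prob_space P" and s: "L2_root_expansion P s g" and s': "L2_root_expansion P s' g'"
  shows "(\<lambda>n. n * ((\<integral>x. s n x * s' n x \<partial>P) - 1)) \<longlonglongrightarrow> - (\<integral>x. (g x - g' x)\<^sup>2 \<partial>P) / 8"
proof -
  interpret prob_space P by fact
  note S = L2_root_expansionD[OF s] and S' = L2_root_expansionD[OF s']
  note fin = finite_measure_axioms
  have "n * ((\<integral>x. s n x * s' n x \<partial>P) - 1) = n * ((\<integral>x. s n x \<partial>P) - 1) + n * ((\<integral>x. s' n x \<partial>P) - 1)
      + (\<integral>x. (sqrt n * (s n x - 1)) * (sqrt n * (s' n x - 1)) \<partial>P)" for n
  proof -
    have "(\<integral>x. (sqrt n * (s n x - 1)) * (sqrt n * (s' n x - 1)) \<partial>P)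
        = (\<integral>x. n * (s n x * s' n x) - n * s n x - n * s' n x + n \<partial>P)"
    proof (intro Bochner_Integration.integral_cong refl)
      fix x
      have "(sqrt n * (s n x - 1)) * (sqrt n * (s' n x - 1)) = (sqrt n)\<^sup>2 * ((s n x - 1) * (s' n x - 1))"
        by (simp only: power2_eq_square mult_ac)
      then show "(sqrt n * (s n x - 1)) * (sqrt n * (s' n x - 1)) = n * (s n x * s' n x) - n * s n x - n * s' n x + n"
        by (simp add: algebra_simps)
    qed
    also have "\<dots> = n * (\<integral>x. s n x * s' n x \<partial>P) - n * (\<integral>x. s n x \<partial>P) - n * (\<integral>x. s' n x \<partial>P) + n"
      using L2_mult_integrable[OF S(1) S'(1), of n n] L2_integrable[OF fin S(1), of n] L2_integrable[OF fin S'(1), of n]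
      by (simp add: prob_space)
    finally show ?thesis by (simp add: algebra_simps)
  qed
  moreover have "(\<lambda>n. n * ((\<integral>x. s n x \<partial>P) - 1) + n * ((\<integral>x. s' n x \<partial>P) - 1)
      + (\<integral>x. (sqrt n * (s n x - 1)) * (sqrt n * (s' n x - 1)) \<partial>P))
      \<longlonglongrightarrow> - (\<integral>x. (g x)\<^sup>2 \<partial>P) / 8 + - (\<integral>x. (g' x)\<^sup>2 \<partial>P) / 8 + (\<integral>x. (g x / 2) * (g' x / 2) \<partial>P)"
    by (intro tendsto_add L2_root_expansion_mean[OF assms(1)] s s' L2_tendsto_inner S(3) S'(3))
  moreover have "- (\<integral>x. (g x)\<^sup>2 \<partial>P) / 8 + - (\<integral>x. (g' x)\<^sup>2 \<partial>P) / 8 + (\<integral>x. (g x / 2) * (g' x / 2) \<partial>P)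
      = - (\<integral>x. (g x - g' x)\<^sup>2 \<partial>P) / 8"
  proof -
    have "(\<integral>x. (g x - g' x)\<^sup>2 \<partial>P) = (\<integral>x. (g x)\<^sup>2 + (g' x)\<^sup>2 - 2 * (g x * g' x) \<partial>P)"
      by (simp add: power2_diff mult.assoc)
    also have "\<dots> = (\<integral>x. (g x)\<^sup>2 \<partial>P) + (\<integral>x. (g' x)\<^sup>2 \<partial>P) - 2 * (\<integral>x. g x * g' x \<partial>P)"
      using L2_square_integrable[OF S(2)] L2_square_integrable[OF S'(2)] L2_mult_integrable[OF S(2) S'(2)]
      by simp
    finally show ?thesis by simp
  qed
  ultimately show ?thesis by simp
qed

text \<open>Taylor remainders of orders 0, 1 and 2. Only the real part of \<open>u\<close> is
  bounded, which covers both imaginary exponents of any size (characteristic functions) and bounded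
  real ones (exponential tilting).\<close>

lemma norm_exp_diff_le:
  fixes u :: complex assumes "\<bar>Re u\<bar> \<le> B"
  shows "cmod (exp u - 1) \<le> exp B * cmod u"
    and "cmod (exp u - 1 - u) \<le> exp B * (cmod u)\<^sup>2"
    and "cmod (exp u - 1 - u - u\<^sup>2 / 2) \<le> exp B * (cmod u) ^ 3"
proof -
  have e: "exp \<bar>Re u\<bar> \<le> exp B" using assms by simp
  have "cmod (exp u - 1) \<le> exp \<bar>Re u\<bar> * cmod u"
    using Taylor_exp[of u 0] by simp
  also have "\<dots> \<le> exp B * cmod u" by (intro mult_right_mono e) simp
  finally show "cmod (exp u - 1) \<le> exp B * cmod u" .
  have "cmod (exp u - 1 - u) \<le> exp \<bar>Re u\<bar> * (cmod u)\<^sup>2"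
    using Taylor_exp[of u 1] by (simp add: power2_eq_square diff_diff_eq)
  also have "\<dots> \<le> exp B * (cmod u)\<^sup>2" by (intro mult_right_mono e) simp
  finally show "cmod (exp u - 1 - u) \<le> exp B * (cmod u)\<^sup>2" .
  have "(\<Sum>k\<le>2. u ^ k / fact k) = 1 + u + u\<^sup>2 / 2"
    by (simp add: numeral_2_eq_2)
  then have "cmod (exp u - 1 - u - u\<^sup>2 / 2) \<le> exp \<bar>Re u\<bar> * (cmod u) ^ 3 / 2"
    using Taylor_exp[of u 2] by (simp add: diff_diff_eq numeral_3_eq_3 numeral_2_eq_2)
  also have "\<dots> \<le> exp \<bar>Re u\<bar> * (cmod u) ^ 3" by simp
  also have "\<dots> \<le> exp B * (cmod u) ^ 3" by (intro mult_right_mono e) simp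
  finally show "cmod (exp u - 1 - u - u\<^sup>2 / 2) \<le> exp B * (cmod u) ^ 3" .
qed

text \<open>The Taylor bounds at \<open>u = w / sqrt n\<close>. The estimates uniform in
  \<open>n\<close> serve as dominating functions and the limits as pointwise limits in the expansion
  that follows; at \<open>n = 0\<close> the quotient is 0 by convention.\<close>

lemma exp_div_sqrt_bounds:
  fixes w :: complex assumes w: "\<bar>Re w\<bar> \<le> B"
  shows "\<And>n::nat. \<bar>Re (w / sqrt n)\<bar> \<le> B"
    and "\<And>n::nat. cmod (sqrt n * (exp (w / sqrt n) - 1)) \<le> exp B * cmod w"
    and "\<And>n::nat. cmod (n * (exp (w / sqrt n) - 1 - w / sqrt n)) \<le> exp B * (cmod w)\<^sup>2"
    and "(\<lambda>n::nat. n * (exp (w / sqrt n) - 1 - w / sqrt n)) \<longlonglongrightarrow> w\<^sup>2 / 2"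
    and "(\<lambda>n::nat. sqrt n * (exp (w / sqrt n) - 1)) \<longlonglongrightarrow> w"
    and "(\<lambda>n::nat. exp (w / sqrt n) - 1) \<longlonglongrightarrow> 0"
proof -
  have B: "0 \<le> B" using w by linarith
  show Re: "\<bar>Re (w / sqrt n)\<bar> \<le> B" for n :: nat
  proof (cases "n = 0")
    case False
    then have "\<bar>Re w\<bar> / sqrt n \<le> \<bar>Re w\<bar> / 1"
      by (intro divide_left_mono) auto
    then show ?thesis using w by (simp add: Re_divide_of_real abs_divide)
  qed (use B in simp)
  show 1: "cmod (sqrt n * (exp (w / sqrt n) - 1)) \<le> exp B * cmod w" for n :: nat
  proof (cases "n = 0")
    case False
    have "sqrt n * cmod (exp (w / sqrt n) - 1) \<le> sqrt n * (exp B * cmod (w / sqrt n))"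
      by (intro mult_left_mono norm_exp_diff_le Re) simp
    also have "\<dots> = exp B * cmod w" using False by (simp add: norm_divide)
    finally show ?thesis by (simp add: norm_mult)
  qed simp
  show "cmod (n * (exp (w / sqrt n) - 1 - w / sqrt n)) \<le> exp B * (cmod w)\<^sup>2" for n :: nat
  proof (cases "n = 0")
    case False
    have "n * cmod (exp (w / sqrt n) - 1 - w / sqrt n) \<le> n * (exp B * (cmod (w / sqrt n))\<^sup>2)"
      by (intro mult_left_mono norm_exp_diff_le Re) simp
    also have "\<dots> = exp B * (cmod w)\<^sup>2" using False by (simp add: norm_divide power_divide)
    finally show ?thesis by (simp add: norm_mult)
  qed simp
  have inv: "(\<lambda>n::nat. 1 / sqrt n) \<longlonglongrightarrow> 0"
    by (intro tendsto_divide_0[OF tendsto_const] filterlim_at_top_imp_at_infinity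
        filterlim_compose[OF sqrt_at_top] filterlim_real_sequentially)
  show "(\<lambda>n::nat. n * (exp (w / sqrt n) - 1 - w / sqrt n)) \<longlonglongrightarrow> w\<^sup>2 / 2"
  proof (rule Lim_transform[OF tendsto_const], rule Lim_null_comparison)
    show "(\<lambda>n::nat. exp B * (cmod w) ^ 3 * (1 / sqrt n)) \<longlonglongrightarrow> 0"
      by (rule tendsto_mult_right_zero[OF inv])
    show "\<forall>\<^sub>F n in sequentially. cmod (n * (exp (w / sqrt n) - 1 - w / sqrt n) - w\<^sup>2 / 2)
        \<le> exp B * (cmod w) ^ 3 * (1 / sqrt (real n))"
      using eventually_gt_at_top[of 0]
    proof eventually_elim
      case (elim n)
      let ?u = "w / complex_of_real (sqrt n)"
      have "of_nat n * ?u\<^sup>2 = w\<^sup>2"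
        using elim by (simp add: power_divide flip: of_real_power)
      then have "n * (exp ?u - 1 - ?u) - w\<^sup>2 / 2 = n * (exp ?u - 1 - ?u - ?u\<^sup>2 / 2)"
        by (simp add: right_diff_distrib)
      also have "cmod \<dots> \<le> n * (exp B * (cmod ?u) ^ 3)"
        unfolding norm_mult norm_of_nat by (intro mult_left_mono norm_exp_diff_le Re) simp
      also have "\<dots> = exp B * (cmod w) ^ 3 * (n / (sqrt n * sqrt n * sqrt n))"
        using elim by (simp add: norm_divide power_divide power3_eq_cube)
      also have "\<dots> = exp B * (cmod w) ^ 3 * (1 / sqrt (real n))"
        using elim by simp
      finally show ?case .
    qed
  qed
  show 0: "(\<lambda>n::nat. exp (w / sqrt n) - 1) \<longlonglongrightarrow> 0"
  proof (rule Lim_null_comparison)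
    show "(\<lambda>n::nat. exp B * cmod w * (1 / sqrt n)) \<longlonglongrightarrow> 0"
      by (rule tendsto_mult_right_zero[OF inv])
    show "\<forall>\<^sub>F n in sequentially. cmod (exp (w / sqrt n) - 1) \<le> exp B * cmod w * (1 / sqrt (real n))"
      using norm_exp_diff_le(1)[OF Re] by (intro always_eventually allI) (simp add: norm_divide)
  qed
  show "(\<lambda>n::nat. sqrt n * (exp (w / sqrt n) - 1)) \<longlonglongrightarrow> w"
  proof (rule Lim_transform[OF tendsto_const], rule Lim_null_comparison)
    show "(\<lambda>n::nat. exp B * (cmod w)\<^sup>2 * (1 / sqrt n)) \<longlonglongrightarrow> 0"
      by (rule tendsto_mult_right_zero[OF inv])
    show "\<forall>\<^sub>F n in sequentially. cmod (sqrt n * (exp (w / sqrt n) - 1) - w)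
        \<le> exp B * (cmod w)\<^sup>2 * (1 / sqrt (real n))"
      using eventually_gt_at_top[of 0]
    proof eventually_elim
      case (elim n)
      let ?u = "w / complex_of_real (sqrt n)"
      have "sqrt n * (exp ?u - 1) - w = sqrt n * (exp ?u - 1 - ?u)"
        using elim by (simp add: right_diff_distrib)
      also have "cmod \<dots> \<le> sqrt n * (exp B * (cmod ?u)\<^sup>2)"
        unfolding norm_mult norm_of_real by (simp, intro mult_left_mono norm_exp_diff_le Re) simp
      also have "\<dots> = exp B * (cmod w)\<^sup>2 * (sqrt n / (sqrt n * sqrt n))"
        using elim by (simp add: norm_divide power_divide power2_eq_square)
      also have "\<dots> = exp B * (cmod w)\<^sup>2 * (1 / sqrt (real n))"
        using elim by (simp del: real_sqrt_mult_self)
      finally show ?case .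
    qed
  qed
qed

text \<open>With \<open>E = exp (z X / sqrt n) - 1\<close>, \<open>T = sqrt n (s - 1)\<close> and
  \<open>T'\<close> likewise, \<open>n E s s' = n E + sqrt n E (T + T') + E T T'\<close>. The first
  two terms yield the quadratic and the mixed term of the limit, the third vanishes, and the
  affinity gives the rest. Since only \<open>Re z * X\<close> must be bounded, an imaginary
  \<open>z\<close> admits every centered \<open>X\<close> in \<open>L2 P\<close>.\<close>

lemma L2_root_expansion_exp:
  fixes z :: complex
  assumes "prob_space P" and s: "L2_root_expansion P s g" and s': "L2_root_expansion P s' g'"
    and X: "X \<in> L2 P" and X0: "(\<integral>x. X x \<partial>P) = 0"
    and B: "\<And>x. x \<in> space P \<Longrightarrow> \<bar>Re z * X x\<bar> \<le> B"
  shows "integrable P (\<lambda>x. exp (z * X x / sqrt (real n)) * of_real (s n x * s' n x))"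
    and "(\<lambda>n. of_nat n * ((\<integral>x. exp (z * X x / sqrt (real n)) * of_real (s n x * s' n x) \<partial>P) - 1))
      \<longlonglongrightarrow> - of_real (\<integral>x. (g x - g' x)\<^sup>2 \<partial>P) / 8 + z * of_real (\<integral>x. X x * (g x + g' x) \<partial>P) / 2
            + z\<^sup>2 * of_real (\<integral>x. (X x)\<^sup>2 \<partial>P) / 2"
proof -
  interpret prob_space P by fact
  note fin = finite_measure_axioms
  note S = L2_root_expansionD[OF s] and S' = L2_root_expansionD[OF s']
  note [measurable] = L2_measurable[OF X] L2_measurable[OF S(1)] L2_measurable[OF S'(1)]
  define E where "E n x = exp (z * X x / complex_of_real (sqrt (real n))) - 1" for n x
  have [measurable]: "E n \<in> borel_measurable P" for n
    unfolding E_def by measurable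
  define T where "T n x = sqrt n * (s n x - 1)" for n x
  define T' where "T' n x = sqrt n * (s' n x - 1)" for n x
  have Re: "\<bar>Re (z * X x)\<bar> \<le> B" if "x \<in> space P" for x
    using B[OF that] by simp
  note bnd = exp_div_sqrt_bounds[OF Re]
  have Xint: "integrable P X" "integrable P (\<lambda>x. (X x)\<^sup>2)"
    using X by (auto intro: L2_integrable fin L2_square_integrable)
  have Ebound: "cmod (E n x) \<le> exp B + 1" if "x \<in> space P" for n x
  proof -
    have "cmod (E n x) \<le> cmod (exp (z * X x / complex_of_real (sqrt (real n)))) + 1"
      unfolding E_def using norm_triangle_ineq4[of _ 1] by (metis norm_one)
    also have "\<dots> \<le> exp B + 1"
      using abs_le_D1[OF bnd(1)[OF that, of n]] by (simp add: norm_exp_eq_Re)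
    finally show ?thesis .
  qed
  have Eint: "integrable P (\<lambda>x. E n x * of_real (h x))" if h: "integrable P h" for n h
  proof (rule Bochner_Integration.integrable_bound)
    show "integrable P (\<lambda>x. (exp B + 1) * h x)" using h by simp
    note [measurable] = borel_measurable_integrable[OF h]
    show "(\<lambda>x. E n x * of_real (h x)) \<in> borel_measurable P" by measurable
    have "cmod (E n x * of_real (h x)) \<le> norm ((exp B + 1) * h x)" if "x \<in> space P" for x
      using mult_right_mono[OF Ebound[OF that, of n], of "\<bar>h x\<bar>"] by (simp add: norm_mult abs_mult)
    then show "AE x in P. norm (E n x * of_real (h x)) \<le> norm ((exp B + 1) * h x)"
      by (intro AE_I2)
  qed
  have ss': "integrable P (\<lambda>x. s n x * s' n x)" for n
    by (rule L2_mult_integrable[OF S(1) S'(1)])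
  have eq: "exp (z * X x / sqrt (real n)) * of_real (s n x * s' n x)
      = E n x * of_real (s n x * s' n x) + of_real (s n x * s' n x)" for n x
    by (simp add: E_def algebra_simps)
  have int: "integrable P (\<lambda>x. exp (z * X x / sqrt (real n)) * of_real (s n x * s' n x))" for n
    unfolding eq by (intro Bochner_Integration.integrable_add Eint integrable_of_real ss')
  show "integrable P (\<lambda>x. exp (z * X x / sqrt (real n)) * of_real (s n x * s' n x))" by (rule int)

  have lim1: "(\<lambda>n. \<integral>x. of_nat n * (E n x - z * X x / sqrt (real n)) \<partial>P) \<longlonglongrightarrow> (\<integral>x. (z * X x)\<^sup>2 / 2 \<partial>P)"
  proof (rule integral_dominated_convergence[where w="\<lambda>x. (exp B * (cmod z)\<^sup>2) * (X x)\<^sup>2"])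
    show "integrable P (\<lambda>x. (exp B * (cmod z)\<^sup>2) * (X x)\<^sup>2)" using Xint by simp
    show "AE x in P. (\<lambda>n. of_nat n * (E n x - z * X x / sqrt (real n))) \<longlonglongrightarrow> (z * X x)\<^sup>2 / 2"
      unfolding E_def using bnd(4) by (intro AE_I2)
    show "AE x in P. norm (of_nat n * (E n x - z * X x / sqrt (real n))) \<le> (exp B * (cmod z)\<^sup>2) * (X x)\<^sup>2" for n
    proof (intro AE_I2)
      fix x assume "x \<in> space P"
      from bnd(3)[OF this, of n] show "norm (of_nat n * (E n x - z * X x / sqrt (real n))) \<le> (exp B * (cmod z)\<^sup>2) * (X x)\<^sup>2"
        unfolding E_def by (simp add: norm_mult power_mult_distrib mult.assoc)
    qed
  qed measurable

  have TL: "L2_tendsto P T (\<lambda>x. g x / 2)" and TL': "L2_tendsto P T' (\<lambda>x. g' x / 2)"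
    using S(3) S'(3) unfolding T_def T'_def .
  \<comment> \<open>The weight \<open>Y\<close> shares out the growth: \<open>sqrt n * E n\<close>
    is only bounded by a multiple of \<open>\<bar>X\<bar>\<close>, but becomes uniformly bounded
    after division by \<open>Y\<close>, while \<open>Y * (T n + T' n)\<close> still converges in
    \<open>L\<^sub>1\<close> because \<open>Y\<close> is in \<open>L2 P\<close>.\<close>
  define Y where "Y x = 1 + \<bar>X x\<bar>" for x
  have Y: "Y \<in> L2 P" unfolding Y_def by (intro L2_add L2_const fin L2_abs X)
  note [measurable] = L2_measurable[OF Y]
  have lim2: "(\<lambda>n. \<integral>x. (sqrt (real n) * E n x / Y x) * of_real (Y x * (T n x + T' n x)) \<partial>P)
      \<longlonglongrightarrow> (\<integral>x. (z * X x / Y x) * of_real (Y x * (g x / 2 + g' x / 2)) \<partial>P)"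
  proof (rule tendsto_integral_bounded_mult_L1[where C="exp B * cmod z"])
    note L = L2_tendsto_add[OF TL TL']
    show "integrable P (\<lambda>x. Y x * (T n x + T' n x))" "integrable P (\<lambda>x. Y x * (g x / 2 + g' x / 2))" for n
      by (intro L2_mult_integrable Y L2_tendstoD[OF L])+
    show "(\<lambda>n. \<integral>x. \<bar>Y x * (T n x + T' n x) - Y x * (g x / 2 + g' x / 2)\<bar> \<partial>P) \<longlonglongrightarrow> 0"
      by (rule L2_tendsto_mult[OF L2_tendsto_const[OF Y] L])
    fix x n assume x: "x \<in> space P"
    have Ypos: "Y x > 0" by (simp add: Y_def)
    have "cmod (sqrt (real n) * E n x / Y x) \<le> exp B * cmod (z * X x) / Y x"
      unfolding norm_divide norm_of_real using bnd(2)[OF x, of n] Ypos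
      by (simp add: E_def divide_right_mono)
    also have "\<dots> \<le> exp B * cmod z"
      using Ypos by (simp add: norm_mult pos_divide_le_eq) (simp add: Y_def algebra_simps)
    finally show "cmod (sqrt (real n) * E n x / Y x) \<le> exp B * cmod z" .
    have "(\<lambda>n. (sqrt (real n) * E n x)) \<longlonglongrightarrow> (z * X x)"
      unfolding E_def using bnd(5)[OF x] .
    then show "(\<lambda>n. sqrt (real n) * E n x / Y x) \<longlonglongrightarrow> (z * X x / Y x)"
      using Ypos by (intro tendsto_divide tendsto_const) auto
  qed measurable
  have lim3: "(\<lambda>n. \<integral>x. E n x * of_real (T n x * T' n x) \<partial>P) \<longlonglongrightarrow> (\<integral>x. 0 * of_real ((g x / 2) * (g' x / 2)) \<partial>P)"
  proof (rule tendsto_integral_bounded_mult_L1[where C="exp B + 1", OF _ _ Ebound])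
    show "integrable P (\<lambda>x. T n x * T' n x)" "integrable P (\<lambda>x. (g x / 2) * (g' x / 2))" for n
      by (intro L2_mult_integrable L2_tendstoD[OF TL] L2_tendstoD[OF TL'])+
    show "(\<lambda>n. \<integral>x. \<bar>T n x * T' n x - (g x / 2) * (g' x / 2)\<bar> \<partial>P) \<longlonglongrightarrow> 0"
      by (rule L2_tendsto_mult[OF TL TL'])
    show "(\<lambda>n. E n x) \<longlonglongrightarrow> 0" if "x \<in> space P" for x
      unfolding E_def by (rule bnd(6)[OF that])
  qed measurable

  have decomp: "of_nat n * ((\<integral>x. exp (z * X x / sqrt (real n)) * of_real (s n x * s' n x) \<partial>P) - 1)
     = of_real (n * ((\<integral>x. s n x * s' n x \<partial>P) - 1))
       + (\<integral>x. of_nat n * (E n x - z * X x / sqrt (real n)) \<partial>P)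
       + (\<integral>x. (sqrt (real n) * E n x / Y x) * of_real (Y x * (T n x + T' n x)) \<partial>P)
       + (\<integral>x. E n x * of_real (T n x * T' n x) \<partial>P)" for n
  proof -
    note TLn = L2_tendstoD(1)[OF TL, of n] L2_tendstoD(1)[OF TL', of n]
    have i1: "integrable P (\<lambda>x. E n x)" using Eint[of "\<lambda>x. 1" n] by simp
    have i2: "integrable P (\<lambda>x. E n x * of_real (sqrt n * (T n x + T' n x)))"
      using TLn by (intro Eint integrable_mult_right Bochner_Integration.integrable_add L2_integrable fin)
    have i3: "integrable P (\<lambda>x. E n x * of_real (T n x * T' n x))"
      by (intro Eint L2_mult_integrable TLn)
    have "(\<integral>x. exp (z * X x / sqrt (real n)) * of_real (s n x * s' n x) \<partial>P)
       = (\<integral>x. E n x * of_real (s n x * s' n x) \<partial>P) + of_real (\<integral>x. s n x * s' n x \<partial>P)"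
      unfolding eq
      by (subst Bochner_Integration.integral_add) (intro Eint integrable_of_real ss' | simp del: of_real_mult)+
    then have "of_nat n * ((\<integral>x. exp (z * X x / sqrt (real n)) * of_real (s n x * s' n x) \<partial>P) - 1)
       = of_real (n * ((\<integral>x. s n x * s' n x \<partial>P) - 1)) + (\<integral>x. of_nat n * (E n x * of_real (s n x * s' n x)) \<partial>P)"
      by (simp add: algebra_simps)
    also have "(\<integral>x. of_nat n * (E n x * of_real (s n x * s' n x)) \<partial>P) =
       (\<integral>x. of_nat n * E n x + E n x * of_real (sqrt n * (T n x + T' n x)) + E n x * of_real (T n x * T' n x) \<partial>P)"
    proof (intro Bochner_Integration.integral_cong refl)
      fix x
      have "sqrt n * (T n x + T' n x) = (sqrt n)\<^sup>2 * (s n x + s' n x - 2)"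
        unfolding T_def T'_def power2_eq_square by (simp only: algebra_simps)
      moreover have "T n x * T' n x = (sqrt n)\<^sup>2 * ((s n x - 1) * (s' n x - 1))"
        unfolding T_def T'_def power2_eq_square by (simp only: mult_ac)
      ultimately have "n * (s n x * s' n x) = n + sqrt n * (T n x + T' n x) + T n x * T' n x"
        by (simp add: algebra_simps)
      then have "E n x * of_real (n * (s n x * s' n x)) = E n x * of_real (n + sqrt n * (T n x + T' n x) + T n x * T' n x)"
        by simp
      then show "of_nat n * (E n x * of_real (s n x * s' n x))
        = of_nat n * E n x + E n x * of_real (sqrt n * (T n x + T' n x)) + E n x * of_real (T n x * T' n x)"
        by (simp add: algebra_simps)
    qed
    also have "\<dots> = (\<integral>x. of_nat n * E n x \<partial>P) + (\<integral>x. E n x * of_real (sqrt n * (T n x + T' n x)) \<partial>P)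
        + (\<integral>x. E n x * of_real (T n x * T' n x) \<partial>P)"
      using i1 i2 i3 by (subst Bochner_Integration.integral_add; simp?)+
    also have "(\<integral>x. E n x * of_real (sqrt n * (T n x + T' n x)) \<partial>P)
        = (\<integral>x. (sqrt (real n) * E n x / Y x) * of_real (Y x * (T n x + T' n x)) \<partial>P)"
    proof (intro Bochner_Integration.integral_cong refl)
      fix x
      have "Y x \<noteq> 0" by (simp add: Y_def add_nonneg_eq_0_iff)
      then show "E n x * of_real (sqrt n * (T n x + T' n x))
         = (sqrt (real n) * E n x / Y x) * of_real (Y x * (T n x + T' n x))" by simp
    qed
    \<comment> \<open>The linear term \<open>z X / sqrt n\<close> can be subtracted because
      \<open>X\<close> has mean zero; multiplied by \<open>n\<close> it would otherwise be of order
      \<open>sqrt n\<close>.\<close>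
    also have "(\<integral>x. of_nat n * E n x \<partial>P) = (\<integral>x. of_nat n * (E n x - z * X x / sqrt (real n)) \<partial>P)"
      using i1 Xint(1) X0 by simp
    finally show ?thesis by (simp add: add.assoc)
  qed
  have "(\<lambda>n. of_real (n * ((\<integral>x. s n x * s' n x \<partial>P) - 1))
       + (\<integral>x. of_nat n * (E n x - z * X x / sqrt (real n)) \<partial>P)
       + (\<integral>x. (sqrt (real n) * E n x / Y x) * of_real (Y x * (T n x + T' n x)) \<partial>P)
       + (\<integral>x. E n x * of_real (T n x * T' n x) \<partial>P))
     \<longlonglongrightarrow> of_real (- (\<integral>x. (g x - g' x)\<^sup>2 \<partial>P) / 8) + (\<integral>x. (z * X x)\<^sup>2 / 2 \<partial>P)
       + (\<integral>x. (z * X x / Y x) * of_real (Y x * (g x / 2 + g' x / 2)) \<partial>P)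
       + (\<integral>x. 0 * of_real ((g x / 2) * (g' x / 2)) \<partial>P)"
    by (intro tendsto_add tendsto_of_real lim1 lim2 lim3 L2_root_expansion_affinity assms(1) s s')
  also have "(\<integral>x. (z * X x / Y x) * of_real (Y x * (g x / 2 + g' x / 2)) \<partial>P)
     = (\<integral>x. (z / 2) * of_real (X x * (g x + g' x)) \<partial>P)"
  proof (intro Bochner_Integration.integral_cong refl)
    fix x
    have "Y x \<noteq> 0" by (simp add: Y_def add_nonneg_eq_0_iff)
    then show "(z * X x / Y x) * of_real (Y x * (g x / 2 + g' x / 2)) = (z / 2) * of_real (X x * (g x + g' x))"
      by (simp add: field_simps)
  qed
  also have "\<dots> = (z / 2) * of_real (\<integral>x. X x * (g x + g' x) \<partial>P)"
    by (simp del: of_real_mult of_real_add)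
  also have "(\<integral>x. (z * X x)\<^sup>2 / 2 \<partial>P) = z\<^sup>2 * of_real (\<integral>x. (X x)\<^sup>2 \<partial>P) / 2"
    by (simp add: power_mult_distrib flip: of_real_power)
  finally show "(\<lambda>n. of_nat n * ((\<integral>x. exp (z * X x / sqrt (real n)) * of_real (s n x * s' n x) \<partial>P) - 1))
      \<longlonglongrightarrow> - of_real (\<integral>x. (g x - g' x)\<^sup>2 \<partial>P) / 8 + z * of_real (\<integral>x. X x * (g x + g' x) \<partial>P) / 2
            + z\<^sup>2 * of_real (\<integral>x. (X x)\<^sup>2 \<partial>P) / 2"
    unfolding decomp by (rule tendsto_eq_rhs) (simp add: ac_simps)
qed

section \<open>Products of density quotients\<close>

lemma integral_PiM_power:
  fixes f :: "'a \<Rightarrow> 'b::{real_normed_field,banach,second_countable_topology}"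
  assumes "prob_space P" and f: "integrable P f"
  shows "integrable (\<Pi>\<^sub>M i\<in>{..<n}. P) (\<lambda>\<omega>. \<Prod>i<n. f (\<omega> i))"
    and "(\<integral>\<omega>. (\<Prod>i<n. f (\<omega> i)) \<partial>(\<Pi>\<^sub>M i\<in>{..<n}. P)) = (\<integral>x. f x \<partial>P) ^ n"
proof -
  interpret prob_space P by fact
  interpret product_sigma_finite "\<lambda>i::nat. P"
    by standard
  show "integrable (\<Pi>\<^sub>M i\<in>{..<n}. P) (\<lambda>\<omega>. \<Prod>i<n. f (\<omega> i))"
    using f by (intro product_integrable_prod) auto
  show "(\<integral>\<omega>. (\<Prod>i<n. f (\<omega> i)) \<partial>(\<Pi>\<^sub>M i\<in>{..<n}. P)) = (\<integral>x. f x \<partial>P) ^ n"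
    using f by (subst product_integral_prod) auto
qed

text \<open>Rectangles determine a product measure, and on them the density and the indicator both
  factorize over the coordinates. The measures are merely finite because the densities below are
  restrictions of probabilities and may have mass less than 1.\<close>

lemma PiM_density:
  fixes I :: "'i set"
  assumes "finite_measure P" and I: "finite I" and L [measurable]: "L \<in> borel_measurable P"
    and fin: "finite_measure (density P L)"
  shows "(\<Pi>\<^sub>M i\<in>I. density P L) = density (\<Pi>\<^sub>M i\<in>I. P) (\<lambda>\<omega>. \<Prod>i\<in>I. L (\<omega> i))"
proof -
  interpret finite_measure P by fact
  interpret D: finite_measure "density P L" by fact
  interpret P: product_sigma_finite "\<lambda>i::'i. P" by standard
  interpret Q: product_sigma_finite "\<lambda>i::'i. density P L" by standard
  have "density (\<Pi>\<^sub>M i\<in>I. P) (\<lambda>\<omega>. \<Prod>i\<in>I. L (\<omega> i)) = (\<Pi>\<^sub>M i\<in>I. density P L)"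
  proof (rule Q.PiM_eqI[OF I])
    show "sets (density (\<Pi>\<^sub>M i\<in>I. P) (\<lambda>\<omega>. \<Prod>i\<in>I. L (\<omega> i))) = sets (\<Pi>\<^sub>M i\<in>I. density P L)"
      by (simp cong: sets_PiM_cong)
    fix A assume "\<And>i. i \<in> I \<Longrightarrow> A i \<in> sets (density P L)"
    then have A: "A i \<in> sets P" if "i \<in> I" for i using that by simp
    have [measurable]: "Pi\<^sub>E I A \<in> sets (\<Pi>\<^sub>M i\<in>I. P)"
      using I A by (intro sets_PiM_I_finite) auto
    have "emeasure (density (\<Pi>\<^sub>M i\<in>I. P) (\<lambda>\<omega>. \<Prod>i\<in>I. L (\<omega> i))) (Pi\<^sub>E I A)
        = (\<integral>\<^sup>+\<omega>. (\<Prod>i\<in>I. L (\<omega> i)) * indicator (Pi\<^sub>E I A) \<omega> \<partial>(\<Pi>\<^sub>M i\<in>I. P))"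
      by (rule emeasure_density) auto
    also have "\<dots> = (\<integral>\<^sup>+\<omega>. (\<Prod>i\<in>I. L (\<omega> i) * indicator (A i) (\<omega> i)) \<partial>(\<Pi>\<^sub>M i\<in>I. P))"
    proof (rule nn_integral_cong)
      fix \<omega> assume "\<omega> \<in> space (\<Pi>\<^sub>M i\<in>I. P)"
      then have "\<omega> \<in> Pi\<^sub>E I A \<longleftrightarrow> (\<forall>i\<in>I. \<omega> i \<in> A i)"
        by (auto simp: space_PiM PiE_iff)
      then have "(indicator (Pi\<^sub>E I A) \<omega> :: ennreal) = (\<Prod>i\<in>I. indicator (A i) (\<omega> i))"
        using I by (auto simp: indicator_def)
      then show "(\<Prod>i\<in>I. L (\<omega> i)) * indicator (Pi\<^sub>E I A) \<omega> = (\<Prod>i\<in>I. L (\<omega> i) * indicator (A i) (\<omega> i))"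
        by (simp add: prod.distrib)
    qed
    also have "\<dots> = (\<Prod>i\<in>I. \<integral>\<^sup>+x. L x * indicator (A i) x \<partial>P)"
      using I A by (intro P.product_nn_integral_prod) auto
    also have "\<dots> = (\<Prod>i\<in>I. emeasure (density P L) (A i))"
      using A by (intro prod.cong refl) (simp add: emeasure_density)
    finally show "emeasure (density (\<Pi>\<^sub>M i\<in>I. P) (\<lambda>\<omega>. \<Prod>i\<in>I. L (\<omega> i))) (Pi\<^sub>E I A)
        = (\<Prod>i\<in>I. emeasure (density P L) (A i))" .
  qed
  then show ?thesis ..
qed

text \<open>On \<open>{L < \<infinity>}\<close> the measure \<open>Q\<close> has density
  \<open>L\<close> with respect to \<open>P\<close>: split \<open>Q A\<close> along this set and
  cancel the singular term, which is finite. Consequently the integral of \<open>L\<close> falls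
  short of 1 by exactly the singular mass.\<close>

lemma density_quotient_restrict:
  assumes "prob_space P" "prob_space Q" and sets: "sets Q = sets P"
    and L: "is_density_quotient Q P L"
  shows "density Q (indicator {x\<in>space P. L x < \<infinity>}) = density P (\<lambda>x. ennreal (enn2real (L x)))"
    and "integrable P (\<lambda>x. enn2real (L x))"
    and "(\<integral>x. enn2real (L x) \<partial>P) = measure Q {x\<in>space P. L x < \<infinity>}"
    and "(\<integral>x. enn2real (L x) \<partial>P) = 1 - measure Q {x\<in>space P. L x = \<infinity>}"
proof -
  interpret P: prob_space P by fact
  interpret Q: prob_space Q by fact
  note [measurable_cong] = sets
  have sp: "space Q = space P" using sets by (rule sets_eq_imp_space_eq)
  have [measurable]: "L \<in> borel_measurable P"
    and LA: "\<And>A. A \<in> sets P \<Longrightarrow> emeasure Q A = (\<integral>\<^sup>+x\<in>A. L x \<partial>P) + emeasure Q (A \<inter> {x \<in> space P. L x = \<infinity>})"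
    and L1: "emeasure P {x \<in> space P. L x < \<infinity>} = 1"
    using L by (auto simp: is_density_quotient_def)
  define F where "F = {x\<in>space P. L x < \<infinity>}"
  have F [measurable]: "F \<in> sets P" unfolding F_def by measurable
  have "P.prob F = 1" using L1 by (simp add: measure_def F_def)
  \<comment> \<open>\<open>enn2real\<close> changes \<open>L\<close> only where it is infinite,
    which is a \<open>P\<close>-null set.\<close>
  have ae: "AE x in P. ennreal (enn2real (L x)) = L x"
  proof (rule eventually_mono[OF P.AE_prob_1[OF \<open>P.prob F = 1\<close>]])
    fix x assume "x \<in> F"
    then show "ennreal (enn2real (L x)) = L x" by (simp add: F_def)
  qed
  have e: "emeasure Q (A \<inter> F) = (\<integral>\<^sup>+x. ennreal (enn2real (L x)) * indicator A x \<partial>P)" if A [measurable]: "A \<in> sets P" for A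
  proof -
    have "emeasure Q A = emeasure Q (A \<inter> F) + emeasure Q (A \<inter> {x \<in> space P. L x = \<infinity>})"
    proof -
      have "A = (A \<inter> F) \<union> (A \<inter> {x \<in> space P. L x = \<infinity>})"
        using sets.sets_into_space[OF A] by (auto simp: F_def less_top)
      moreover have "(A \<inter> F) \<inter> (A \<inter> {x \<in> space P. L x = \<infinity>}) = {}" by (auto simp: F_def)
      moreover have "A \<inter> F \<in> sets Q" "A \<inter> {x \<in> space P. L x = \<infinity>} \<in> sets Q"
        unfolding sets by measurable
      ultimately show ?thesis using plus_emeasure[of "A \<inter> F" Q "A \<inter> {x \<in> space P. L x = \<infinity>}"] by simp
    qed
    then have "emeasure Q (A \<inter> {x \<in> space P. L x = \<infinity>}) + emeasure Q (A \<inter> F)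
        = emeasure Q (A \<inter> {x \<in> space P. L x = \<infinity>}) + (\<integral>\<^sup>+x\<in>A. L x \<partial>P)"
      using LA[OF A] by (simp only: add.commute)
    then have "emeasure Q (A \<inter> F) = (\<integral>\<^sup>+x\<in>A. L x \<partial>P)"
      unfolding ennreal_add_left_cancel using Q.emeasure_finite by simp
    also have "\<dots> = (\<integral>\<^sup>+x. ennreal (enn2real (L x)) * indicator A x \<partial>P)"
    proof (rule nn_integral_cong_AE)
      show "AE x in P. L x * indicator A x = ennreal (enn2real (L x)) * indicator A x"
        using ae by eventually_elim simp
    qed
    finally show ?thesis .
  qed
  show "density Q (indicator {x\<in>space P. L x < \<infinity>}) = density P (\<lambda>x. ennreal (enn2real (L x)))"
    unfolding F_def[symmetric]
  proof (rule measure_eqI)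
    show "sets (density Q (indicator F)) = sets (density P (\<lambda>x. ennreal (enn2real (L x))))"
      by (simp add: sets)
    fix A assume "A \<in> sets (density Q (indicator F))"
    then have A: "A \<in> sets P" by (simp add: sets)
    have "emeasure (density Q (indicator F)) A = (\<integral>\<^sup>+x. indicator F x * indicator A x \<partial>Q)"
      using A F by (intro emeasure_density) (auto simp: sets)
    also have "\<dots> = (\<integral>\<^sup>+x. indicator (A \<inter> F) x \<partial>Q)"
      by (intro nn_integral_cong) (auto simp: indicator_def)
    also have "\<dots> = emeasure Q (A \<inter> F)"
      using A F by (intro nn_integral_indicator) (auto simp: sets)
    also have "\<dots> = emeasure (density P (\<lambda>x. ennreal (enn2real (L x)))) A"
      using A by (simp add: e emeasure_density)
    finally show "emeasure (density Q (indicator F)) A = emeasure (density P (\<lambda>x. ennreal (enn2real (L x)))) A" .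
  qed
  have tot: "(\<integral>\<^sup>+x. ennreal (enn2real (L x)) \<partial>P) = emeasure Q F"
  proof -
    have "space P \<inter> F = F" by (auto simp: F_def)
    then have "emeasure Q F = (\<integral>\<^sup>+x. ennreal (enn2real (L x)) * indicator (space P) x \<partial>P)"
      using e[of "space P"] by simp
    also have "\<dots> = (\<integral>\<^sup>+x. ennreal (enn2real (L x)) \<partial>P)"
      by (intro nn_integral_cong) simp
    finally show ?thesis ..
  qed
  show int: "integrable P (\<lambda>x. enn2real (L x))"
    using tot by (intro integrableI_nonneg) (auto simp: less_top[symmetric])
  show eq: "(\<integral>x. enn2real (L x) \<partial>P) = measure Q {x\<in>space P. L x < \<infinity>}"
    using tot by (subst integral_eq_nn_integral) (auto simp: measure_def F_def)
  have "{x\<in>space P. L x = \<infinity>} = space Q - F" by (auto simp: F_def sp less_top[symmetric])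
  then show "(\<integral>x. enn2real (L x) \<partial>P) = 1 - measure Q {x\<in>space P. L x = \<infinity>}"
    unfolding eq F_def[symmetric] using F by (simp add: Q.prob_compl sets)
qed

text \<open>Integrating \<open>h L\<close> against \<open>P\<close> is integrating \<open>h\<close>
  against \<open>Q\<close> over \<open>{L < \<infinity>}\<close>. What is lost is an integral over
  the singular set, bounded by its mass since \<open>h\<close> is bounded by 1.\<close>

lemma density_quotient_integral_diff:
  fixes h :: "'a \<Rightarrow> complex"
  assumes "prob_space P" "prob_space Q" and sets: "sets Q = sets P"
    and L: "is_density_quotient Q P L"
    and h: "h \<in> borel_measurable P" and h1: "\<And>x. x \<in> space P \<Longrightarrow> cmod (h x) \<le> 1"
  shows "cmod ((\<integral>x. h x \<partial>Q) - (\<integral>x. h x * of_real (enn2real (L x)) \<partial>P)) \<le> 1 - (\<integral>x. enn2real (L x) \<partial>P)"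
proof -
  interpret P: prob_space P by fact
  interpret Q: prob_space Q by fact
  note R = density_quotient_restrict[OF assms(1-4)]
  have [measurable]: "L \<in> borel_measurable P"
    using L by (auto simp: is_density_quotient_def)
  note [measurable] = h
  note [measurable_cong] = sets
  have sp: "space Q = space P" using sets by (rule sets_eq_imp_space_eq)
  define F where "F = {x\<in>space P. L x < \<infinity>}"
  have F [measurable]: "F \<in> sets P" unfolding F_def by measurable
  have F' [measurable]: "F \<in> sets Q" unfolding sets by measurable
  have "(\<integral>x. h x * of_real (enn2real (L x)) \<partial>P) = (\<integral>x. enn2real (L x) *\<^sub>R h x \<partial>P)"
    by (simp add: scaleR_conv_of_real mult.commute)
  also have "\<dots> = (\<integral>x. h x \<partial>density P (\<lambda>x. ennreal (enn2real (L x))))"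
    by (rule integral_density[symmetric]) auto
  also have "\<dots> = (\<integral>x. h x \<partial>density Q (\<lambda>x. ennreal (indicator F x)))"
    unfolding R(1)[symmetric] F_def[symmetric] by (simp add: ennreal_indicator)
  also have "\<dots> = (\<integral>x. indicator F x *\<^sub>R h x \<partial>Q)"
    by (rule integral_density) auto
  finally have eq: "(\<integral>x. h x * of_real (enn2real (L x)) \<partial>P) = (\<integral>x. indicator F x *\<^sub>R h x \<partial>Q)" .
  have i1: "integrable Q h"
    using h1 sp by (intro Q.integrable_const_bound[where B=1]) auto
  then have i2: "integrable Q (\<lambda>x. indicator F x *\<^sub>R h x)"
    by (rule integrable_mult_indicator[OF F'])
  have "cmod ((\<integral>x. h x \<partial>Q) - (\<integral>x. indicator F x *\<^sub>R h x \<partial>Q)) = cmod (\<integral>x. h x - indicator F x *\<^sub>R h x \<partial>Q)"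
    using i1 i2 by simp
  also have "\<dots> \<le> (\<integral>x. cmod (h x - indicator F x *\<^sub>R h x) \<partial>Q)"
    by (rule integral_norm_bound)
  also have "\<dots> \<le> (\<integral>x. 1 - indicator F x \<partial>Q)"
  proof (rule integral_mono)
    show "integrable Q (\<lambda>x. cmod (h x - indicator F x *\<^sub>R h x))"
      using i1 i2 by (intro integrable_norm Bochner_Integration.integrable_diff)
    show "integrable Q (\<lambda>x. 1 - indicator F x :: real)"
      by (simp add: Q.emeasure_eq_measure)
    show "cmod (h x - indicator F x *\<^sub>R h x) \<le> 1 - indicator F x" if "x \<in> space Q" for x
      using h1 sp that by (auto split: split_indicator)
  qed
  also have "\<dots> = 1 - measure Q F"
  proof -
    have "integrable Q (indicator F :: 'a \<Rightarrow> real)" by (simp add: Q.emeasure_eq_measure)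
    then show ?thesis by (simp add: Q.prob_space)
  qed
  finally show ?thesis
    unfolding eq using R(3) by (simp add: F_def)
qed

text \<open>The same argument for products: with \<open>F = {L < \<infinity>}\<close>, the product
  of the \<open>L (\<omega> i)\<close> is a density of the product of the \<open>Q\<close>
  restricted to points with all coordinates in \<open>F\<close>. The lost mass is one minus the
  \<open>n\<close>-th power of the mass of \<open>F\<close>.\<close>

lemma density_quotient_power_integral_diff:
  fixes \<psi> :: "(nat \<Rightarrow> 'a) \<Rightarrow> real"
  assumes "prob_space P" "prob_space Q" and sets: "sets Q = sets P"
    and L: "is_density_quotient Q P L"
    and \<psi>: "\<psi> \<in> borel_measurable (\<Pi>\<^sub>M i\<in>{..<n}. P)"
    and \<psi>01: "\<And>\<omega>. \<omega> \<in> space (\<Pi>\<^sub>M i\<in>{..<n}. P) \<Longrightarrow> 0 \<le> \<psi> \<omega> \<and> \<psi> \<omega> \<le> 1"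
  shows "\<bar>(\<integral>\<omega>. \<psi> \<omega> \<partial>(\<Pi>\<^sub>M i\<in>{..<n}. Q)) - (\<integral>\<omega>. \<psi> \<omega> * (\<Prod>i<n. enn2real (L (\<omega> i))) \<partial>(\<Pi>\<^sub>M i\<in>{..<n}. P))\<bar>
    \<le> 1 - (\<integral>x. enn2real (L x) \<partial>P) ^ n"
proof -
  interpret P: prob_space P by fact
  interpret Q: prob_space Q by fact
  let ?P = "\<Pi>\<^sub>M i\<in>{..<n}. P" and ?Q = "\<Pi>\<^sub>M i\<in>{..<n}. Q"
  interpret QQ: prob_space ?Q by (intro prob_space_PiM assms(2))
  have setsn: "sets ?Q = sets ?P" by (intro sets_PiM_cong refl sets)
  have spn: "space ?Q = space ?P" using setsn by (rule sets_eq_imp_space_eq)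
  note R = density_quotient_restrict[OF assms(1-4)]
  have [measurable]: "L \<in> borel_measurable P"
    using L by (auto simp: is_density_quotient_def)
  note [measurable] = \<psi>
  define F where "F = {x\<in>space P. L x < \<infinity>}"
  have F [measurable]: "F \<in> sets P" unfolding F_def by measurable
  have F' [measurable]: "F \<in> sets Q" unfolding sets by measurable
  have \<psi>' [measurable]: "\<psi> \<in> borel_measurable ?Q"
    using \<psi> setsn by (simp cong: measurable_cong_sets)
  have int1: "integrable Q (indicator F :: 'a \<Rightarrow> real)"
    by (simp add: Q.emeasure_eq_measure)
  have dens: "finite_measure (density Q (indicator F))"
    by (intro finite_measureI) (simp add: emeasure_density cong: nn_integral_cong)
  have "density ?P (\<lambda>\<omega>. \<Prod>i<n. ennreal (enn2real (L (\<omega> i)))) = (\<Pi>\<^sub>M i\<in>{..<n}. density P (\<lambda>x. ennreal (enn2real (L x))))"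
    using dens R(1) by (intro PiM_density[symmetric] P.finite_measure_axioms) (auto simp: F_def)
  also have "\<dots> = (\<Pi>\<^sub>M i\<in>{..<n}. density Q (indicator F))"
    by (simp add: R(1)[symmetric] F_def)
  also have "\<dots> = density ?Q (\<lambda>\<omega>. \<Prod>i<n. indicator F (\<omega> i))"
    by (intro PiM_density Q.finite_measure_axioms dens) auto
  finally have D: "density ?P (\<lambda>\<omega>. \<Prod>i<n. ennreal (enn2real (L (\<omega> i)))) = density ?Q (\<lambda>\<omega>. \<Prod>i<n. indicator F (\<omega> i))" .
  have "(\<integral>\<omega>. \<psi> \<omega> * (\<Prod>i<n. enn2real (L (\<omega> i))) \<partial>?P) = (\<integral>\<omega>. (\<Prod>i<n. enn2real (L (\<omega> i))) *\<^sub>R \<psi> \<omega> \<partial>?P)"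
    by (simp add: mult.commute)
  also have "\<dots> = (\<integral>\<omega>. \<psi> \<omega> \<partial>density ?P (\<lambda>\<omega>. ennreal (\<Prod>i<n. enn2real (L (\<omega> i)))))"
    by (rule integral_density[symmetric]) (auto intro!: prod_nonneg)
  also have "\<dots> = (\<integral>\<omega>. \<psi> \<omega> \<partial>density ?Q (\<lambda>\<omega>. ennreal (\<Prod>i<n. indicator F (\<omega> i))))"
    using D by (simp add: prod_ennreal[symmetric] ennreal_indicator)
  also have "\<dots> = (\<integral>\<omega>. (\<Prod>i<n. indicator F (\<omega> i)) *\<^sub>R \<psi> \<omega> \<partial>?Q)"
    by (rule integral_density) (auto intro!: prod_nonneg)
  finally have eq: "(\<integral>\<omega>. \<psi> \<omega> * (\<Prod>i<n. enn2real (L (\<omega> i))) \<partial>?P) = (\<integral>\<omega>. (\<Prod>i<n. indicator F (\<omega> i)) * \<psi> \<omega> \<partial>?Q)"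
    by simp
  have p01: "0 \<le> (\<Prod>i<n. indicator F (\<omega> i) :: real)" "(\<Prod>i<n. indicator F (\<omega> i) :: real) \<le> 1" for \<omega> :: "nat \<Rightarrow> 'a"
    by (auto intro!: prod_nonneg prod_le_1)
  have i1: "integrable ?Q \<psi>"
    using \<psi>01 spn by (intro QQ.integrable_const_bound[where B=1]) auto
  have i0: "integrable ?Q (\<lambda>\<omega>. \<Prod>i<n. indicator F (\<omega> i) :: real)"
    by (rule integral_PiM_power(1)[OF assms(2) int1])
  have i2: "integrable ?Q (\<lambda>\<omega>. (\<Prod>i<n. indicator F (\<omega> i)) * \<psi> \<omega>)"
  proof (rule QQ.integrable_const_bound[where B=1])
    show "AE \<omega> in ?Q. norm ((\<Prod>i<n. indicator F (\<omega> i)) * \<psi> \<omega>) \<le> 1"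
    proof (intro AE_I2)
      fix \<omega> assume "\<omega> \<in> space ?Q"
      then show "norm ((\<Prod>i<n. indicator F (\<omega> i)) * \<psi> \<omega>) \<le> 1"
        using \<psi>01[of \<omega>] spn p01[of \<omega>] by (auto simp: abs_mult intro!: mult_le_one)
    qed
  qed measurable
  have "(\<integral>\<omega>. \<psi> \<omega> \<partial>?Q) - (\<integral>\<omega>. (\<Prod>i<n. indicator F (\<omega> i)) * \<psi> \<omega> \<partial>?Q)
      = (\<integral>\<omega>. (1 - (\<Prod>i<n. indicator F (\<omega> i))) * \<psi> \<omega> \<partial>?Q)"
    using i1 i2 by (simp add: left_diff_distrib)
  moreover have "0 \<le> (\<integral>\<omega>. (1 - (\<Prod>i<n. indicator F (\<omega> i))) * \<psi> \<omega> \<partial>?Q)"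
    using p01 \<psi>01 spn by (intro Bochner_Integration.integral_nonneg_AE AE_I2 mult_nonneg_nonneg) auto
  moreover have "(\<integral>\<omega>. (1 - (\<Prod>i<n. indicator F (\<omega> i))) * \<psi> \<omega> \<partial>?Q) \<le> (\<integral>\<omega>. 1 - (\<Prod>i<n. indicator F (\<omega> i)) \<partial>?Q)"
  proof (rule integral_mono)
    show "integrable ?Q (\<lambda>\<omega>. (1 - (\<Prod>i<n. indicator F (\<omega> i))) * \<psi> \<omega>)"
      using i1 i2 by (simp add: left_diff_distrib)
    show "integrable ?Q (\<lambda>\<omega>. 1 - (\<Prod>i<n. indicator F (\<omega> i) :: real))"
      using i0 by simp
    show "(1 - (\<Prod>i<n. indicator F (\<omega> i))) * \<psi> \<omega> \<le> 1 - (\<Prod>i<n. indicator F (\<omega> i))" if "\<omega> \<in> space ?Q" for \<omega>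
      using p01[of \<omega>] \<psi>01[of \<omega>] that spn by (intro mult_left_le) auto
  qed
  moreover have "(\<integral>\<omega>. 1 - (\<Prod>i<n. indicator F (\<omega> i)) \<partial>?Q) = 1 - (\<integral>x. enn2real (L x) \<partial>P) ^ n"
    using i0 integral_PiM_power(2)[OF assms(2) int1, of n] R(3) F'
    by (simp add: QQ.prob_space F_def)
  ultimately show ?thesis
    unfolding eq by linarith
qed

section \<open>Asymptotic normality under local alternatives\<close>

abbreviation std_normal_cdf :: "real \<Rightarrow> real" ("\<Phi>") where
  "\<Phi> \<equiv> cdf std_normal_distribution"

interpretation std_normal: real_distribution std_normal_distribution
  by (rule real_dist_normal_dist)

lemma std_normal_singleton: "measure std_normal_distribution {x} = 0"
proof -
  have "emeasure std_normal_distribution {x} = (\<integral>\<^sup>+y. ennreal (std_normal_density y) * indicator {x} y \<partial>lborel)"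
    by (rule emeasure_density) auto
  also have "\<dots> = 0" by simp
  finally show ?thesis by (simp add: measure_def)
qed

lemma isCont_std_normal_cdf: "isCont \<Phi> x"
  by (simp add: std_normal.isCont_cdf std_normal_singleton)

text \<open>Reflection leaves Lebesgue measure and the normal density invariant; as points are null
  sets, the closed half-line may be exchanged for the complement of \<open>{..u}\<close>.\<close>

lemma std_normal_cdf_minus: "\<Phi> (- u) = 1 - \<Phi> u"
proof -
  have "emeasure std_normal_distribution {..-u} = (\<integral>\<^sup>+y. ennreal (std_normal_density y) * indicator {..-u} y \<partial>lborel)"
    by (rule emeasure_density) auto
  also have "\<dots> = (\<integral>\<^sup>+y. ennreal (std_normal_density y) * indicator {..-u} y \<partial>distr lborel borel uminus)"
    by (simp add: lborel_distr_uminus)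
  also have "\<dots> = (\<integral>\<^sup>+y. ennreal (std_normal_density (- y)) * indicator {..-u} (- y) \<partial>lborel)"
    by (rule nn_integral_distr) auto
  also have "\<dots> = (\<integral>\<^sup>+y. ennreal (std_normal_density y) * indicator {u..} y \<partial>lborel)"
    by (intro nn_integral_cong) (auto simp: std_normal_density_def indicator_def)
  also have "\<dots> = emeasure std_normal_distribution {u..}"
    by (rule emeasure_density[symmetric]) auto
  finally have "\<Phi> (- u) = measure std_normal_distribution {u..}"
    by (simp add: cdf_def measure_def)
  also have "{u..} = {u} \<union> {u<..}" by auto
  also have "measure std_normal_distribution ({u} \<union> {u<..}) = measure std_normal_distribution {u<..}"
    using std_normal_singleton[of u] std_normal.finite_measure_Union[of "{u}" "{u<..}"] by simp
  also have "\<dots> = 1 - \<Phi> u"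
  proof -
    have "{u<..} = space std_normal_distribution - {..u}" by auto
    then show ?thesis
      using std_normal.prob_compl[of "{..u}"] by (simp add: cdf_def)
  qed
  finally show ?thesis .
qed

lemma std_normal_cdf_surj:
  assumes "0 < p" "p < 1" shows "\<exists>u. \<Phi> u = p"
proof -
  obtain a where a: "\<Phi> a < p"
    using order_tendstoD(2)[OF std_normal.cdf_lim_at_bot assms(1)]
    by (auto simp: eventually_at_bot_linorder)
  obtain b where b: "p < \<Phi> b"
    using order_tendstoD(1)[OF std_normal.cdf_lim_at_top_prob assms(2)]
    by (auto simp: eventually_at_top_linorder)
  have "a \<le> b"
    using a b std_normal.cdf_nondecreasing[of b a] by linarith
  then show ?thesis
    using IVT[of \<Phi> a p b] a b isCont_std_normal_cdf by auto
qed

text \<open>The quantile is defined by \<open>inv\<close>, which picks a genuine preimage only for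
  values in the range of \<open>\<Phi>\<close>; the intermediate value theorem supplies
  this.\<close>

lemma std_normal_cdf_quantile:
  assumes "0 < p" "p < 1" shows "\<Phi> (std_normal_quantile p) = p"
proof -
  have "p \<in> range \<Phi>"
    using std_normal_cdf_surj[OF assms] by blast
  then show ?thesis
    unfolding std_normal_quantile_def by (rule f_inv_into_f)
qed

section \<open>Normalized sums along density sequences\<close>

text \<open>Both the gradient test and the Neyman-Pearson tests it is compared with have this form,
  the latter with bounded approximations \<open>X\<close> of a multiple of the gradient.\<close>

definition sum_test :: "('a \<Rightarrow> real) \<Rightarrow> real \<Rightarrow> nat \<Rightarrow> (nat \<Rightarrow> 'a) \<Rightarrow> real" where
  "sum_test X a n \<omega> = (if 1 / sqrt (real n) * (\<Sum>i<n. X (\<omega> i)) > a then 1 else 0)"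

lemma sum_test_measurable [measurable]:
  assumes [measurable]: "X \<in> borel_measurable M"
  shows "sum_test X a n \<in> borel_measurable (\<Pi>\<^sub>M i\<in>{..<n}. M)"
  unfolding sum_test_def by measurable

lemma sum_test_01: "0 \<le> sum_test X a n \<omega>" "sum_test X a n \<omega> \<le> 1"
  by (auto simp: sum_test_def)

text \<open>A sequence of local alternatives with chosen versions \<open>L n\<close> of the density
  quotients. For a sequence taken from a curve, \<open>g\<close> is the tangent multiplied by the
  limit of \<open>t\<^sub>n sqrt n\<close>.\<close>

definition density_sequence :: "'a measure \<Rightarrow> (nat \<Rightarrow> 'a measure) \<Rightarrow> (nat \<Rightarrow> 'a \<Rightarrow> ennreal) \<Rightarrow> ('a \<Rightarrow> real) \<Rightarrow> bool" where
  "density_sequence P Q L g \<longleftrightarrow>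
     (\<forall>n. prob_space (Q n) \<and> sets (Q n) = sets P \<and> is_density_quotient (Q n) P (L n)) \<and>
     L2_root_expansion P (\<lambda>n x. sqrt (enn2real (L n x))) g"

lemma density_sequenceD:
  assumes "density_sequence P Q L g"
  shows "prob_space (Q n)" "sets (Q n) = sets P" "is_density_quotient (Q n) P (L n)"
    "L2_root_expansion P (\<lambda>n x. sqrt (enn2real (L n x))) g"
    "L n \<in> borel_measurable P" "g \<in> L2 P"
    "(\<lambda>n. n * ((\<integral>x. enn2real (L n x) \<partial>P) - 1)) \<longlonglongrightarrow> 0"
  using assms
  by (auto simp: density_sequence_def is_density_quotient_def L2_root_expansion_def)

text \<open>Apply the exponential expansion with both roots equal to that of \<open>L n\<close>, so
  that their product is \<open>L n\<close> and the affinity term disappears. Passing from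
  \<open>L n\<close> to \<open>Q n\<close> costs at most \<open>n\<close> times the singular mass,
  which tends to 0.\<close>

lemma density_sequence_char:
  assumes "prob_space P" and d: "density_sequence P Q L g"
    and X: "X \<in> L2 P" and X0: "(\<integral>x. X x \<partial>P) = 0"
  shows "(\<lambda>n. (\<integral>x. iexp (s * X x / sqrt (real n)) \<partial>Q n) ^ n)
    \<longlonglongrightarrow> exp (\<i> * s * (\<integral>x. X x * g x \<partial>P) - s\<^sup>2 * (\<integral>x. (X x)\<^sup>2 \<partial>P) / 2)"
proof (rule power_tendsto_exp)
  note D = density_sequenceD[OF d]
  note [measurable] = L2_measurable[OF X]
  let ?h = "\<lambda>n x. iexp (s * X x / sqrt (real n))"
  have eq: "exp (\<i> * s * X x / sqrt (real n)) * of_real (sqrt (enn2real (L n x)) * sqrt (enn2real (L n x)))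
     = ?h n x * of_real (enn2real (L n x))" for n x
    by (simp add: mult.assoc)
  have "(\<lambda>n. of_nat n * ((\<integral>x. ?h n x * of_real (enn2real (L n x)) \<partial>P) - 1))
      \<longlonglongrightarrow> - of_real (\<integral>x. (g x - g x)\<^sup>2 \<partial>P) / 8 + (\<i> * s) * of_real (\<integral>x. X x * (g x + g x) \<partial>P) / 2
            + (\<i> * s)\<^sup>2 * of_real (\<integral>x. (X x)\<^sup>2 \<partial>P) / 2"
    \<comment> \<open>The exponent \<open>\<i> * s\<close> has real part 0, hence the bound 0 holds
      for unbounded \<open>X\<close> too.\<close>
    using L2_root_expansion_exp(2)[OF assms(1) D(4) D(4) X X0, of "\<i> * s" 0] unfolding eq by simp
  also have "(\<integral>x. X x * (g x + g x) \<partial>P) = (\<integral>x. 2 * (X x * g x) \<partial>P)"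
    by (intro Bochner_Integration.integral_cong refl) simp
  finally have 1: "(\<lambda>n. of_nat n * ((\<integral>x. ?h n x * of_real (enn2real (L n x)) \<partial>P) - 1))
      \<longlonglongrightarrow> \<i> * s * (\<integral>x. X x * g x \<partial>P) - s\<^sup>2 * (\<integral>x. (X x)\<^sup>2 \<partial>P) / 2"
    by (simp add: power_mult_distrib mult.assoc)
  show "(\<lambda>n. of_nat n * ((\<integral>x. ?h n x \<partial>Q n) - 1)) \<longlonglongrightarrow> \<i> * s * (\<integral>x. X x * g x \<partial>P) - s\<^sup>2 * (\<integral>x. (X x)\<^sup>2 \<partial>P) / 2"
  proof (rule Lim_transform[OF 1], rule Lim_null_comparison)
    show "(\<lambda>n. - (n * ((\<integral>x. enn2real (L n x) \<partial>P) - 1))) \<longlonglongrightarrow> 0"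
      using tendsto_minus[OF D(7)] by simp
    show "\<forall>\<^sub>F n in sequentially. cmod (of_nat n * ((\<integral>x. ?h n x \<partial>Q n) - 1) - of_nat n * ((\<integral>x. ?h n x * of_real (enn2real (L n x)) \<partial>P) - 1))
       \<le> - (n * ((\<integral>x. enn2real (L n x) \<partial>P) - 1))"
    proof (intro always_eventually allI)
      fix n :: nat
      have "of_nat n * ((\<integral>x. ?h n x \<partial>Q n) - 1) - of_nat n * ((\<integral>x. ?h n x * of_real (enn2real (L n x)) \<partial>P) - 1)
        = of_nat n * ((\<integral>x. ?h n x \<partial>Q n) - (\<integral>x. ?h n x * of_real (enn2real (L n x)) \<partial>P))"
        by (simp add: algebra_simps)
      also have "cmod \<dots> \<le> n * (1 - (\<integral>x. enn2real (L n x) \<partial>P))"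
        unfolding norm_mult norm_of_nat
        by (intro mult_left_mono density_quotient_integral_diff assms(1) D(1-3)) auto
      finally show "cmod (of_nat n * ((\<integral>x. ?h n x \<partial>Q n) - 1) - of_nat n * ((\<integral>x. ?h n x * of_real (enn2real (L n x)) \<partial>P) - 1))
       \<le> - (n * ((\<integral>x. enn2real (L n x) \<partial>P) - 1))"
        by (simp add: algebra_simps)
    qed
  qed
qed

text \<open>A central limit theorem with drift: after centering by the limiting mean
  \<open>m\<close> and scaling by \<open>\<sigma>\<close>, the characteristic functions are
  \<open>n\<close>-th powers converging to the standard normal one. Levy continuity then gives the
  power at every threshold, since \<open>\<Phi>\<close> is continuous.\<close>

lemma density_sequence_power_sum_test:
  assumes "prob_space P" and d: "density_sequence P Q L g"
    and X: "X \<in> L2 P" and X0: "(\<integral>x. X x \<partial>P) = 0" and pos: "L2_norm P X > 0"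
  shows "(\<lambda>n. power_fn (sum_test X a) Q n) \<longlonglongrightarrow> 1 - \<Phi> ((a - (\<integral>x. X x * g x \<partial>P)) / L2_norm P X)"
proof -
  note D = density_sequenceD[OF d]
  define m \<sigma> where "m = (\<integral>x. X x * g x \<partial>P)" and "\<sigma> = L2_norm P X"
  have \<sigma>: "\<sigma> > 0" using pos by (simp add: \<sigma>_def)
  have [measurable]: "X \<in> borel_measurable (Q n)" for n
    using L2_measurable[OF X] D(2)[of n] by (simp cong: measurable_cong_sets)
  define S where "S n \<omega> = (1 / sqrt (real n) * (\<Sum>i<n. X (\<omega> i)) - m) / \<sigma>" for n and \<omega> :: "nat \<Rightarrow> 'a"
  let ?Q = "\<lambda>n. \<Pi>\<^sub>M i\<in>{..<n}. Q n"
  have S [measurable]: "S n \<in> borel_measurable (?Q n)" for n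
    unfolding S_def by measurable
  have ps: "prob_space (?Q n)" for n
    by (intro prob_space_PiM D(1))
  have rd: "real_distribution (distr (?Q n) borel (S n))" for n
    by (rule prob_space.real_distribution_distr[OF ps S])
  have "weak_conv_m (\<lambda>n. distr (?Q n) borel (S n)) std_normal_distribution"
  proof (rule levy_continuity[OF rd real_dist_normal_dist])
    fix t :: real
    define s where "s = t / \<sigma>"
    have "char (distr (?Q n) borel (S n)) t = iexp (- (s * m)) * (\<integral>x. iexp (s * X x / sqrt (real n)) \<partial>Q n) ^ n" for n
    proof -
      interpret Qn: prob_space "Q n" by (rule D(1))
      have i: "integrable (Q n) (\<lambda>x. iexp (s * X x / sqrt (real n)))"
        by (intro Qn.integrable_const_bound[where B=1]) auto
      have "char (distr (?Q n) borel (S n)) t = (\<integral>\<omega>. iexp (t * S n \<omega>) \<partial>?Q n)"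
        unfolding char_def by (rule integral_distr) auto
      also have "\<dots> = (\<integral>\<omega>. iexp (- (s * m)) * (\<Prod>i<n. iexp (s * X (\<omega> i) / sqrt (real n))) \<partial>?Q n)"
      proof (intro Bochner_Integration.integral_cong refl)
        fix \<omega>
        have "t * S n \<omega> = - (s * m) + (\<Sum>i<n. s * X (\<omega> i) / sqrt (real n))"
          unfolding S_def s_def by (simp add: diff_divide_distrib right_diff_distrib sum_distrib_left sum_divide_distrib mult_ac)
        then have "\<i> * complex_of_real (t * S n \<omega>) = \<i> * of_real (- (s * m)) + (\<Sum>i<n. \<i> * of_real (s * X (\<omega> i) / sqrt (real n)))"
          by (simp only: of_real_add of_real_sum distrib_left sum_distrib_left)
        then show "iexp (t * S n \<omega>) = iexp (- (s * m)) * (\<Prod>i<n. iexp (s * X (\<omega> i) / sqrt (real n)))"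
          by (simp only: exp_add exp_sum[OF finite_lessThan])
      qed
      also have "\<dots> = iexp (- (s * m)) * (\<integral>\<omega>. (\<Prod>i<n. iexp (s * X (\<omega> i) / sqrt (real n))) \<partial>?Q n)"
        by (rule integral_mult_right_zero)
      also have "(\<integral>\<omega>. (\<Prod>i<n. iexp (s * X (\<omega> i) / sqrt (real n))) \<partial>?Q n) = (\<integral>x. iexp (s * X x / sqrt (real n)) \<partial>Q n) ^ n"
        by (rule integral_PiM_power[OF D(1) i])
      finally show ?thesis .
    qed
    moreover have "(\<lambda>n. iexp (- (s * m)) * (\<integral>x. iexp (s * X x / sqrt (real n)) \<partial>Q n) ^ n)
      \<longlonglongrightarrow> iexp (- (s * m)) * exp (\<i> * s * (\<integral>x. X x * g x \<partial>P) - s\<^sup>2 * (\<integral>x. (X x)\<^sup>2 \<partial>P) / 2)"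
      by (intro tendsto_mult tendsto_const density_sequence_char[OF assms(1) d X X0])
    moreover have "iexp (- (s * m)) * exp (\<i> * s * (\<integral>x. X x * g x \<partial>P) - s\<^sup>2 * (\<integral>x. (X x)\<^sup>2 \<partial>P) / 2)
       = char std_normal_distribution t"
    proof -
      have "s\<^sup>2 * (\<integral>x. (X x)\<^sup>2 \<partial>P) = (s * \<sigma>)\<^sup>2"
        by (simp add: \<sigma>_def L2_norm_power2 power_mult_distrib)
      also have "\<dots> = t\<^sup>2" using \<sigma> by (simp add: s_def)
      finally have "complex_of_real (s\<^sup>2 * (\<integral>x. (X x)\<^sup>2 \<partial>P)) = of_real (t\<^sup>2)" by simp
      then have "iexp (- (s * m)) * exp (\<i> * s * (\<integral>x. X x * g x \<partial>P) - s\<^sup>2 * (\<integral>x. (X x)\<^sup>2 \<partial>P) / 2)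
         = exp (complex_of_real (- t\<^sup>2 / 2))"
        by (simp add: m_def exp_add[symmetric])
      then show ?thesis by (simp only: char_std_normal_distribution exp_of_real)
    qed
    ultimately show "(\<lambda>n. char (distr (?Q n) borel (S n)) t) \<longlonglongrightarrow> char std_normal_distribution t"
      by (simp only:)
  qed
  then have "(\<lambda>n. 1 - cdf (distr (?Q n) borel (S n)) ((a - m) / \<sigma>)) \<longlonglongrightarrow> 1 - \<Phi> ((a - m) / \<sigma>)"
    unfolding weak_conv_m_def weak_conv_def by (intro tendsto_diff tendsto_const) (simp add: isCont_std_normal_cdf)
  moreover have "1 - cdf (distr (?Q n) borel (S n)) ((a - m) / \<sigma>) = power_fn (sum_test X a) Q n" for n
  proof -
    interpret prob_space "?Q n" by (rule ps)
    let ?A = "{\<omega> \<in> space (?Q n). 1 / sqrt (real n) * (\<Sum>i<n. X (\<omega> i)) > a}"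
    have "cdf (distr (?Q n) borel (S n)) ((a - m) / \<sigma>) = prob (S n -` {..(a - m) / \<sigma>} \<inter> space (?Q n))"
      unfolding cdf_def by (rule measure_distr) auto
    also have "S n -` {..(a - m) / \<sigma>} \<inter> space (?Q n) = space (?Q n) - ?A"
      using \<sigma> by (auto simp: S_def divide_le_cancel not_less)
    also have "prob (space (?Q n) - ?A) = 1 - prob ?A"
      by (intro prob_compl) measurable
    finally have "1 - cdf (distr (?Q n) borel (S n)) ((a - m) / \<sigma>) = prob ?A" by simp
    also have "\<dots> = (\<integral>\<omega>. indicator ?A \<omega> \<partial>?Q n)" by simp
    also have "\<dots> = power_fn (sum_test X a) Q n"
      unfolding power_fn_def
      by (intro Bochner_Integration.integral_cong refl) (auto simp: sum_test_def indicator_def)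
    finally show ?thesis .
  qed
  ultimately show ?thesis by (simp add: m_def \<sigma>_def)
qed

section \<open>The Neyman-Pearson bound\<close>

text \<open>The complex expansion at a real exponent. For nonzero \<open>z\<close> the bound now
  restricts \<open>X\<close> itself, which is why bounded approximations enter the Neyman-Pearson
  argument.\<close>

lemma L2_root_expansion_exp_real:
  fixes z :: real
  assumes "prob_space P" and s: "L2_root_expansion P s g" and s': "L2_root_expansion P s' g'"
    and X: "X \<in> L2 P" and X0: "(\<integral>x. X x \<partial>P) = 0"
    and B: "\<And>x. x \<in> space P \<Longrightarrow> \<bar>z * X x\<bar> \<le> B"
  shows "integrable P (\<lambda>x. exp (z * X x / sqrt (real n)) * (s n x * s' n x))"
    and "(\<lambda>n. n * ((\<integral>x. exp (z * X x / sqrt (real n)) * (s n x * s' n x) \<partial>P) - 1))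
      \<longlonglongrightarrow> - (\<integral>x. (g x - g' x)\<^sup>2 \<partial>P) / 8 + z * (\<integral>x. X x * (g x + g' x) \<partial>P) / 2
            + z\<^sup>2 * (\<integral>x. (X x)\<^sup>2 \<partial>P) / 2"
proof -
  have B': "\<bar>Re (complex_of_real z) * X x\<bar> \<le> B" if "x \<in> space P" for x
    using B[OF that] by simp
  have eq: "exp (complex_of_real z * X x / complex_of_real (sqrt (real n))) * of_real (s n x * s' n x)
     = of_real (exp (z * X x / sqrt (real n)) * (s n x * s' n x))" for n x
    by (simp flip: exp_of_real)
  note L = L2_root_expansion_exp[OF assms(1) s s' X X0 B', unfolded eq]
  show "integrable P (\<lambda>x. exp (z * X x / sqrt (real n)) * (s n x * s' n x))"
    using L(1)[of n] by (simp only: complex_of_real_integrable_eq)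
  have "(\<lambda>n. complex_of_real (n * ((\<integral>x. exp (z * X x / sqrt (real n)) * (s n x * s' n x) \<partial>P) - 1)))
      \<longlonglongrightarrow> complex_of_real (- (\<integral>x. (g x - g' x)\<^sup>2 \<partial>P) / 8 + z * (\<integral>x. X x * (g x + g' x) \<partial>P) / 2
            + z\<^sup>2 * (\<integral>x. (X x)\<^sup>2 \<partial>P) / 2)"
    using L(2) unfolding integral_complex_of_real by simp
  then show "(\<lambda>n. n * ((\<integral>x. exp (z * X x / sqrt (real n)) * (s n x * s' n x) \<partial>P) - 1))
      \<longlonglongrightarrow> - (\<integral>x. (g x - g' x)\<^sup>2 \<partial>P) / 8 + z * (\<integral>x. X x * (g x + g' x) \<partial>P) / 2
            + z\<^sup>2 * (\<integral>x. (X x)\<^sup>2 \<partial>P) / 2"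
    by (rule tendsto_of_real_iff[THEN iffD1])
qed

text \<open>The limit of the product of the norms of \<open>u - v\<close> and \<open>u + v\<close>
  when \<open>u\<close>, \<open>v\<close> have squared norms tending to 1 and affinity tending to
  \<open>exp (- r / 8)\<close>. It bounds the limiting \<open>L\<^sub>1\<close> distance of the
  densities \<open>u\<^sup>2\<close> and \<open>v\<^sup>2\<close>, and vanishes at
  \<open>r = 0\<close>.\<close>

definition hellinger_err :: "real \<Rightarrow> real" where
  "hellinger_err r = sqrt (2 - 2 * exp (- r / 8)) * sqrt (2 + 2 * exp (- r / 8))"

text \<open>The alternative with tangent \<open>g\<close> is compared with an exponential tilt by
  \<open>X\<close> of the one with tangent \<open>g'\<close>. Writing \<open>p = u\<^sup>2\<close>
  and \<open>q = v\<^sup>2\<close>, Cauchy-Schwarz reduces the \<open>L\<^sub>1\<close> distance to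
  the norms and the inner product of \<open>u\<close> and \<open>v\<close>; these factorize over the
  coordinates, so their limits follow from one-dimensional expansions. The error is small when
  \<open>g\<close> is close to \<open>g' + X\<close>.\<close>

lemma tilted_density_L1_error:
  assumes P: "prob_space P" and d: "density_sequence P Q L g" and d': "density_sequence P Q' L' g'"
    and X [measurable]: "X \<in> borel_measurable P" and B: "\<And>x. \<bar>X x\<bar> \<le> B" and X0: "(\<integral>x. X x \<partial>P) = 0"
  defines "c \<equiv> (\<integral>x. X x * g' x \<partial>P) + (\<integral>x. (X x)\<^sup>2 \<partial>P) / 2"
  defines "p \<equiv> \<lambda>n \<omega>. \<Prod>i<n. enn2real (L n (\<omega> i))"
  defines "q \<equiv> \<lambda>n \<omega>. (\<Prod>i<n. enn2real (L' n (\<omega> i))) * exp (1 / sqrt n * (\<Sum>i<n. X (\<omega> i)) - c)"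
  shows "integrable (\<Pi>\<^sub>M i\<in>{..<n}. P) (p n)" "integrable (\<Pi>\<^sub>M i\<in>{..<n}. P) (q n)"
    and "\<exists>e. (\<forall>n. (\<integral>\<omega>. \<bar>p n \<omega> - q n \<omega>\<bar> \<partial>(\<Pi>\<^sub>M i\<in>{..<n}. P)) \<le> e n) \<and>
      e \<longlonglongrightarrow> hellinger_err (\<integral>x. (g x - g' x - X x)\<^sup>2 \<partial>P)"
proof -
  interpret prob_space P by fact
  note D = density_sequenceD[OF d] and D' = density_sequenceD[OF d']
  note fin = finite_measure_axioms
  note [measurable] = D(5) D'(5)
  let ?P = "\<lambda>n. \<Pi>\<^sub>M i\<in>{..<n}. P"
  have XL: "X \<in> L2 P" by (rule L2_bounded[OF fin X B])
  define s where "s n x = sqrt (enn2real (L n x))" for n x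
  define s' where "s' n x = sqrt (enn2real (L' n x))" for n x
  \<comment> \<open>The root of one factor of the tilted density; the square root halves the
    exponent.\<close>
  define f where "f n x = s' n x * exp (X x / (2 * sqrt (real n)))" for n :: nat and x
  have [measurable]: "s n \<in> borel_measurable P" "s' n \<in> borel_measurable P" "f n \<in> borel_measurable P" for n
    unfolding s_def s'_def f_def by measurable
  have Ds: "L2_root_expansion P s g" and Ds': "L2_root_expansion P s' g'"
    using D(4) D'(4) by (simp_all add: s_def[abs_def] s'_def[abs_def])
  have s2: "(s n x)\<^sup>2 = enn2real (L n x)" for n x by (simp add: s_def)
  have f2: "(f n x)\<^sup>2 = exp (1 * X x / sqrt (real n)) * (s' n x * s' n x)" for n x
  proof -
    have "exp (X x / (2 * sqrt (real n))) * exp (X x / (2 * sqrt (real n))) = exp (X x / sqrt (real n))"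
      unfolding exp_add[symmetric] by (simp add: field_simps)
    then show ?thesis by (simp add: f_def power2_eq_square mult_ac)
  qed
  have sf: "s n x * f n x = exp ((1/2) * X x / sqrt (real n)) * (s n x * s' n x)" for n x
    by (simp add: f_def field_simps)
  \<comment> \<open>The exponent \<open>z = 1\<close> yields the mass of the tilted density,
    \<open>z = 1/2\<close> its affinity with the other density.\<close>
  have B1: "\<bar>1 * X x\<bar> \<le> B" for x using B by simp
  have B2: "\<bar>1/2 * X x\<bar> \<le> B" for x using B[of x] by (simp add: abs_mult)
  note E1 = L2_root_expansion_exp_real[OF P Ds' Ds' XL X0 B1, unfolded f2[symmetric]]
  note E2 = L2_root_expansion_exp_real[OF P Ds Ds' XL X0 B2, unfolded sf[symmetric]]
  have is2: "integrable P (\<lambda>x. (s n x)\<^sup>2)" for n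
    using L2_root_expansionD(1)[OF Ds] by (rule L2_square_integrable)
  define u where "u n \<omega> = (\<Prod>i<n. s n (\<omega> i))" for n and \<omega> :: "nat \<Rightarrow> 'a"
  define v where "v n \<omega> = exp (- c / 2) * (\<Prod>i<n. f n (\<omega> i))" for n and \<omega> :: "nat \<Rightarrow> 'a"
  have u2: "(u n \<omega>)\<^sup>2 = (\<Prod>i<n. (s n (\<omega> i))\<^sup>2)" for n \<omega>
    by (simp add: u_def prod_power_distrib)
  have v2: "(v n \<omega>)\<^sup>2 = exp (- c) * (\<Prod>i<n. (f n (\<omega> i))\<^sup>2)" for n \<omega>
    by (simp add: v_def prod_power_distrib power_mult_distrib flip: exp_double)
  have uv: "u n \<omega> * v n \<omega> = exp (- c / 2) * (\<Prod>i<n. s n (\<omega> i) * f n (\<omega> i))" for n \<omega>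
    by (simp add: u_def v_def prod.distrib)
  have up: "(u n \<omega>)\<^sup>2 = p n \<omega>" for n \<omega>
    by (simp add: u2 s2 p_def)
  have vq: "(v n \<omega>)\<^sup>2 = q n \<omega>" for n \<omega>
  proof -
    have "(\<Prod>i<n. (f n (\<omega> i))\<^sup>2) = (\<Prod>i<n. enn2real (L' n (\<omega> i))) * (\<Prod>i<n. exp (X (\<omega> i) / sqrt n))"
      by (simp add: f2 s'_def prod.distrib mult.commute)
    also have "(\<Prod>i<n. exp (X (\<omega> i) / sqrt n)) = exp (1 / sqrt n * (\<Sum>i<n. X (\<omega> i)))"
      by (simp add: exp_sum sum_divide_distrib)
    finally show ?thesis
      by (simp add: v2 q_def exp_diff exp_minus field_simps)
  qed
  have um [measurable]: "u n \<in> borel_measurable (?P n)" and vm [measurable]: "v n \<in> borel_measurable (?P n)" for n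
    unfolding u_def v_def by measurable
  have uL: "u n \<in> L2 (?P n)" for n
    using um integral_PiM_power(1)[OF P is2, of n n] by (simp add: L2_def u2)
  have vL: "v n \<in> L2 (?P n)" for n
    using vm integral_PiM_power(1)[OF P E1(1), of n n] by (simp add: L2_def v2)
  show "integrable (?P n) (p n)" "integrable (?P n) (q n)"
    using L2_square_integrable[OF uL, of n] L2_square_integrable[OF vL, of n] by (simp_all add: up vq)
  define a where "a n = (\<integral>x. (s n x)\<^sup>2 \<partial>P) ^ n" for n
  define b where "b n = exp (- c) * (\<integral>x. (f n x)\<^sup>2 \<partial>P) ^ n" for n
  define h where "h n = exp (- c / 2) * (\<integral>x. s n x * f n x \<partial>P) ^ n" for n
  have a: "(\<integral>\<omega>. (u n \<omega>)\<^sup>2 \<partial>?P n) = a n" for n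
    unfolding u2 a_def by (rule integral_PiM_power(2)[OF P is2])
  have b: "(\<integral>\<omega>. (v n \<omega>)\<^sup>2 \<partial>?P n) = b n" for n
    unfolding v2 b_def by (simp add: integral_PiM_power(2)[OF P E1(1)])
  have h: "(\<integral>\<omega>. u n \<omega> * v n \<omega> \<partial>?P n) = h n" for n
    unfolding uv h_def by (simp add: integral_PiM_power(2)[OF P E2(1)])
  have alim: "a \<longlonglongrightarrow> 1"
    unfolding a_def using power_tendsto_exp_real[OF L2_root_expansionD(4)[OF Ds]] by simp
  \<comment> \<open>The limit exponent at \<open>z = 1\<close> is exactly \<open>c\<close>, so the
    factor \<open>exp (- c)\<close> makes the tilted density asymptotically a probability
    density.\<close>
  have blim: "b \<longlonglongrightarrow> 1"
  proof -
    have "(\<integral>x. X x * (g' x + g' x) \<partial>P) = (\<integral>x. 2 * (X x * g' x) \<partial>P)"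
      by (intro Bochner_Integration.integral_cong refl) simp
    then have "(\<lambda>n. (\<integral>x. (f n x)\<^sup>2 \<partial>P) ^ n) \<longlonglongrightarrow> exp c"
      using power_tendsto_exp_real[OF E1(2)] by (simp add: c_def)
    then have "b \<longlonglongrightarrow> exp (- c) * exp c"
      unfolding b_def by (intro tendsto_mult tendsto_const)
    then show ?thesis by (simp flip: exp_add)
  qed
  define r where "r = (\<integral>x. (g x - g' x - X x)\<^sup>2 \<partial>P)"
  have hlim: "h \<longlonglongrightarrow> exp (- r / 8)"
  proof -
    note gg = D(6) D'(6)
    have "r = (\<integral>x. (g x - g' x)\<^sup>2 + (X x)\<^sup>2 - 2 * (X x * g x) + 2 * (X x * g' x) \<partial>P)"
      unfolding r_def by (intro Bochner_Integration.integral_cong refl) (simp add: power2_eq_square algebra_simps)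
    also have "\<dots> = (\<integral>x. (g x - g' x)\<^sup>2 \<partial>P) + (\<integral>x. (X x)\<^sup>2 \<partial>P) - 2 * (\<integral>x. X x * g x \<partial>P) + 2 * (\<integral>x. X x * g' x \<partial>P)"
      using L2_square_integrable[OF L2_diff[OF gg]] L2_square_integrable[OF XL]
        L2_mult_integrable[OF XL gg(1)] L2_mult_integrable[OF XL gg(2)] by simp
    finally have r: "r = \<dots>" .
    have "(\<integral>x. X x * (g x + g' x) \<partial>P) = (\<integral>x. X x * g x \<partial>P) + (\<integral>x. X x * g' x \<partial>P)"
      using L2_mult_integrable[OF XL gg(1)] L2_mult_integrable[OF XL gg(2)] by (simp add: distrib_left)
    \<comment> \<open>Completing the square: the normalization, the affinity and the tilt combine to
      the squared norm of \<open>g - g' - X\<close>.\<close>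
    then have eq: "- c / 2 + (- (\<integral>x. (g x - g' x)\<^sup>2 \<partial>P) / 8 + 1/2 * (\<integral>x. X x * (g x + g' x) \<partial>P) / 2
            + (1/2)\<^sup>2 * (\<integral>x. (X x)\<^sup>2 \<partial>P) / 2) = - r / 8"
      unfolding r c_def by (simp add: power2_eq_square field_simps)
    have "h \<longlonglongrightarrow> exp (- c / 2) * exp (- (\<integral>x. (g x - g' x)\<^sup>2 \<partial>P) / 8 + 1/2 * (\<integral>x. X x * (g x + g' x) \<partial>P) / 2
            + (1/2)\<^sup>2 * (\<integral>x. (X x)\<^sup>2 \<partial>P) / 2)"
      unfolding h_def by (intro tendsto_mult tendsto_const power_tendsto_exp_real E2(2))
    then show ?thesis unfolding exp_add[symmetric] eq .
  qed
  have iu: "integrable (?P n) (\<lambda>\<omega>. (u n \<omega>)\<^sup>2)" and iv: "integrable (?P n) (\<lambda>\<omega>. (v n \<omega>)\<^sup>2)"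
    and iuv: "integrable (?P n) (\<lambda>\<omega>. u n \<omega> * v n \<omega>)" for n
    by (intro L2_square_integrable uL vL L2_mult_integrable)+
  have "(\<integral>\<omega>. \<bar>p n \<omega> - q n \<omega>\<bar> \<partial>?P n) \<le> sqrt (a n + b n - 2 * h n) * sqrt (a n + b n + 2 * h n)" for n
  proof -
    have "(\<integral>\<omega>. \<bar>p n \<omega> - q n \<omega>\<bar> \<partial>?P n) = (\<integral>\<omega>. \<bar>(u n \<omega> - v n \<omega>) * (u n \<omega> + v n \<omega>)\<bar> \<partial>?P n)"
      by (simp add: up[symmetric] vq[symmetric] power2_eq_square square_diff_square_factored mult.commute)
    also have "\<dots> \<le> L2_norm (?P n) (\<lambda>\<omega>. u n \<omega> - v n \<omega>) * L2_norm (?P n) (\<lambda>\<omega>. u n \<omega> + v n \<omega>)"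
      by (intro L2_Cauchy_Schwarz L2_diff L2_add uL vL)
    also have "L2_norm (?P n) (\<lambda>\<omega>. u n \<omega> - v n \<omega>) = sqrt (a n + b n - 2 * h n)"
      unfolding L2_norm_def power2_diff mult.assoc using iu[of n] iv[of n] iuv[of n] by (simp add: a b h)
    also have "L2_norm (?P n) (\<lambda>\<omega>. u n \<omega> + v n \<omega>) = sqrt (a n + b n + 2 * h n)"
      unfolding L2_norm_def power2_sum mult.assoc using iu[of n] iv[of n] iuv[of n] by (simp add: a b h)
    finally show ?thesis .
  qed
  moreover have "(\<lambda>n. sqrt (a n + b n - 2 * h n) * sqrt (a n + b n + 2 * h n))
     \<longlonglongrightarrow> sqrt (1 + 1 - 2 * exp (- r / 8)) * sqrt (1 + 1 + 2 * exp (- r / 8))"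
    by (intro tendsto_intros alim blim hlim)
  ultimately show "\<exists>e. (\<forall>n. (\<integral>\<omega>. \<bar>p n \<omega> - q n \<omega>\<bar> \<partial>?P n) \<le> e n) \<and>
      e \<longlonglongrightarrow> hellinger_err (\<integral>x. (g x - g' x - X x)\<^sup>2 \<partial>P)"
    unfolding hellinger_err_def r_def[symmetric]
    by (intro exI[of _ "\<lambda>n. sqrt (a n + b n - 2 * h n) * sqrt (a n + b n + 2 * h n)"]) simp
qed

text \<open>The test \<open>sum_test X a\<close> rejects exactly when the tilting factor
  \<open>exp (S - c)\<close> exceeds \<open>exp (a - c)\<close>, hence is a Neyman-Pearson test of
  \<open>p'\<close> against \<open>q\<close>. Comparing \<open>\<psi>\<close> with it costs the
  \<open>L\<^sub>1\<close> distance from \<open>q\<close> to the true density \<open>p\<close>, plus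
  the singular masses of both product measures. The threshold \<open>a\<close> is free and will be
  adjusted to the limiting level \<open>\<beta>\<close>.\<close>

lemma neyman_pearson_limsup:
  fixes \<psi> :: "nat \<Rightarrow> (nat \<Rightarrow> 'a) \<Rightarrow> real"
  assumes P: "prob_space P" and d: "density_sequence P Q L g" and d': "density_sequence P Q' L' g'"
    and X [measurable]: "X \<in> borel_measurable P" and B: "\<And>x. \<bar>X x\<bar> \<le> B" and X0: "(\<integral>x. X x \<partial>P) = 0"
    and pos: "L2_norm P X > 0"
    and \<psi> [measurable]: "\<And>n. \<psi> n \<in> borel_measurable (\<Pi>\<^sub>M i\<in>{..<n}. P)"
    and \<psi>01: "\<And>n \<omega>. \<omega> \<in> space (\<Pi>\<^sub>M i\<in>{..<n}. P) \<Longrightarrow> 0 \<le> \<psi> n \<omega> \<and> \<psi> n \<omega> \<le> 1"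
    and lim: "power_fn \<psi> Q' \<longlonglongrightarrow> \<beta>"
  defines "c \<equiv> (\<integral>x. X x * g' x \<partial>P) + (\<integral>x. (X x)\<^sup>2 \<partial>P) / 2"
  shows "limsup (\<lambda>n. ereal (power_fn \<psi> Q n)) \<le>
    ereal (1 - \<Phi> ((a - (\<integral>x. X x * g x \<partial>P)) / L2_norm P X)
      + exp (a - c) * (\<beta> - (1 - \<Phi> ((a - (\<integral>x. X x * g' x \<partial>P)) / L2_norm P X)))
      + hellinger_err (\<integral>x. (g x - g' x - X x)\<^sup>2 \<partial>P))"
proof -
  interpret prob_space P by fact
  note D = density_sequenceD[OF d] and D' = density_sequenceD[OF d']
  note [measurable] = D(5) D'(5)
  let ?P = "\<lambda>n. \<Pi>\<^sub>M i\<in>{..<n}. P"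
  have XL: "X \<in> L2 P" by (rule L2_bounded[OF finite_measure_axioms X B])
  define p where "p n \<omega> = (\<Prod>i<n. enn2real (L n (\<omega> i)))" for n and \<omega> :: "nat \<Rightarrow> 'a"
  define p' where "p' n \<omega> = (\<Prod>i<n. enn2real (L' n (\<omega> i)))" for n and \<omega> :: "nat \<Rightarrow> 'a"
  define q where "q n \<omega> = p' n \<omega> * exp (1 / sqrt n * (\<Sum>i<n. X (\<omega> i)) - c)" for n and \<omega> :: "nat \<Rightarrow> 'a"
  have [measurable]: "p n \<in> borel_measurable (?P n)" "p' n \<in> borel_measurable (?P n)" "q n \<in> borel_measurable (?P n)" for n
    unfolding p_def p'_def q_def by measurable
  note E = tilted_density_L1_error[OF P d d' X B X0, folded c_def p_def p'_def, folded q_def]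
  obtain e where e: "\<And>n. (\<integral>\<omega>. \<bar>p n \<omega> - q n \<omega>\<bar> \<partial>?P n) \<le> e n"
    and elim: "e \<longlonglongrightarrow> hellinger_err (\<integral>x. (g x - g' x - X x)\<^sup>2 \<partial>P)"
    using E(3) by blast
  have ip: "integrable (?P n) (p n)" and iq: "integrable (?P n) (q n)" for n
    using E(1,2) by auto
  have ip': "integrable (?P n) (p' n)" for n
    unfolding p'_def
    by (rule integral_PiM_power[OF P density_quotient_restrict(2)[OF P D'(1-3)]])
  \<comment> \<open>\<open>\<delta> n\<close> and \<open>\<delta>' n\<close> bound the errors of
    replacing powers under \<open>Q n\<close> and \<open>Q' n\<close> by integrals against
    densities; they vanish because the one-dimensional defects are of smaller order than
    \<open>1/n\<close>.\<close>
  define \<delta> where "\<delta> n = 1 - (\<integral>x. enn2real (L n x) \<partial>P) ^ n" for n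
  define \<delta>' where "\<delta>' n = 1 - (\<integral>x. enn2real (L' n x) \<partial>P) ^ n" for n
  have \<delta>: "\<delta> \<longlonglongrightarrow> 0" and \<delta>': "\<delta>' \<longlonglongrightarrow> 0"
    unfolding \<delta>_def \<delta>'_def
    using tendsto_diff[OF tendsto_const power_tendsto_exp_real[OF D(7)], of 1]
      tendsto_diff[OF tendsto_const power_tendsto_exp_real[OF D'(7)], of 1] by simp_all
  let ?\<chi> = "sum_test X a"
  have \<chi>: "?\<chi> n \<in> borel_measurable (?P n)" for n by measurable
  have bd: "integrable (?P n) (\<lambda>\<omega>. t n \<omega> * r \<omega>)"
    if r: "integrable (?P n) r" and t [measurable]: "t n \<in> borel_measurable (?P n)"
      and t1: "\<And>\<omega>. \<omega> \<in> space (?P n) \<Longrightarrow> \<bar>t n \<omega>\<bar> \<le> 1"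
    for n and r :: "(nat \<Rightarrow> 'a) \<Rightarrow> real" and t
  proof (rule Bochner_Integration.integrable_bound[OF r])
    show "(\<lambda>\<omega>. t n \<omega> * r \<omega>) \<in> borel_measurable (?P n)"
      using borel_measurable_integrable[OF r] by measurable
    show "AE \<omega> in ?P n. norm (t n \<omega> * r \<omega>) \<le> norm (r \<omega>)"
    proof (intro AE_I2)
      fix \<omega> assume "\<omega> \<in> space (?P n)"
      then show "norm (t n \<omega> * r \<omega>) \<le> norm (r \<omega>)"
        using mult_right_mono[OF t1, of \<omega> "\<bar>r \<omega>\<bar>"] by (simp add: abs_mult)
    qed
  qed
  have \<psi>1: "\<bar>\<psi> n \<omega>\<bar> \<le> 1" and \<chi>1: "\<bar>?\<chi> n \<omega>\<bar> \<le> 1" and \<psi>\<chi>: "\<bar>\<psi> n \<omega> - ?\<chi> n \<omega>\<bar> \<le> 1"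
    if "\<omega> \<in> space (?P n)" for n \<omega>
    using \<psi>01[OF that] sum_test_01[of X a n \<omega>] by auto
  have le: "power_fn \<psi> Q n \<le> power_fn ?\<chi> Q n + 2 * \<delta> n + exp (a - c) * (power_fn \<psi> Q' n - power_fn ?\<chi> Q' n + 2 * \<delta>' n) + e n" for n
  proof -
    let ?I = "\<lambda>t r. \<integral>\<omega>. t n \<omega> * r n \<omega> \<partial>?P n"
    have 1: "\<bar>power_fn \<psi> Q n - ?I \<psi> p\<bar> \<le> \<delta> n" "\<bar>power_fn ?\<chi> Q n - ?I ?\<chi> p\<bar> \<le> \<delta> n"
      unfolding power_fn_def p_def \<delta>_def using \<psi>01 sum_test_01
      by (intro density_quotient_power_integral_diff[OF P D(1-3)] \<psi> \<chi>; blast)+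
    have 2: "\<bar>power_fn \<psi> Q' n - ?I \<psi> p'\<bar> \<le> \<delta>' n" "\<bar>power_fn ?\<chi> Q' n - ?I ?\<chi> p'\<bar> \<le> \<delta>' n"
      unfolding power_fn_def p'_def \<delta>'_def using \<psi>01 sum_test_01
      by (intro density_quotient_power_integral_diff[OF P D'(1-3)] \<psi> \<chi>; blast)+
    have ints: "integrable (?P n) (\<lambda>\<omega>. \<psi> n \<omega> * p n \<omega>)" "integrable (?P n) (\<lambda>\<omega>. ?\<chi> n \<omega> * p n \<omega>)"
      "integrable (?P n) (\<lambda>\<omega>. \<psi> n \<omega> * p' n \<omega>)" "integrable (?P n) (\<lambda>\<omega>. ?\<chi> n \<omega> * p' n \<omega>)"
      by (intro bd ip ip' \<psi> \<chi> \<psi>1 \<chi>1; assumption)+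
    have split: "(\<psi> n \<omega> - ?\<chi> n \<omega>) * (p n \<omega> - exp (a - c) * p' n \<omega>) =
        (\<psi> n \<omega> * p n \<omega> - ?\<chi> n \<omega> * p n \<omega>) - exp (a - c) * (\<psi> n \<omega> * p' n \<omega> - ?\<chi> n \<omega> * p' n \<omega>)" for \<omega>
      by (simp add: algebra_simps)
    have "?I \<psi> p - ?I ?\<chi> p - exp (a - c) * (?I \<psi> p' - ?I ?\<chi> p')
       = (\<integral>\<omega>. (\<psi> n \<omega> - ?\<chi> n \<omega>) * (p n \<omega> - exp (a - c) * p' n \<omega>) \<partial>?P n)"
      unfolding split using ints by simp
    also have "\<dots> \<le> (\<integral>\<omega>. \<bar>p n \<omega> - q n \<omega>\<bar> \<partial>?P n)"
    proof (rule integral_mono)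
      show "integrable (?P n) (\<lambda>\<omega>. (\<psi> n \<omega> - ?\<chi> n \<omega>) * (p n \<omega> - exp (a - c) * p' n \<omega>))"
        unfolding split using ints by simp
      show "integrable (?P n) (\<lambda>\<omega>. \<bar>p n \<omega> - q n \<omega>\<bar>)"
        using ip iq by simp
      fix \<omega> assume \<omega>: "\<omega> \<in> space (?P n)"
      have "p' n \<omega> \<ge> 0" unfolding p'_def by (intro prod_nonneg) simp
      define S where "S = 1 / sqrt n * (\<Sum>i<n. X (\<omega> i))"
      have q: "q n \<omega> - exp (a - c) * p' n \<omega> = p' n \<omega> * (exp (S - c) - exp (a - c))"
        by (simp add: q_def S_def right_diff_distrib)
      \<comment> \<open>The pointwise Neyman-Pearson inequality: above the threshold the comparison
        test is 1 and the second factor is nonnegative, otherwise the test is 0 and that factor is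
        nonpositive.\<close>
      have "(\<psi> n \<omega> - ?\<chi> n \<omega>) * (q n \<omega> - exp (a - c) * p' n \<omega>) \<le> 0"
      proof (cases "S > a")
        case True
        then show ?thesis
          unfolding q sum_test_def S_def[symmetric] using \<open>p' n \<omega> \<ge> 0\<close> \<psi>01[OF \<omega>]
          by (intro mult_nonpos_nonneg mult_nonneg_nonneg) auto
      next
        case False
        then show ?thesis
          unfolding q sum_test_def S_def[symmetric] using \<open>p' n \<omega> \<ge> 0\<close> \<psi>01[OF \<omega>]
          by (intro mult_nonneg_nonpos) (auto intro: mult_nonneg_nonpos)
      qed
      moreover have "(\<psi> n \<omega> - ?\<chi> n \<omega>) * (p n \<omega> - q n \<omega>) \<le> \<bar>p n \<omega> - q n \<omega>\<bar>"
        using mult_right_mono[OF \<psi>\<chi>[OF \<omega>], of "\<bar>p n \<omega> - q n \<omega>\<bar>"]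
        by (simp add: abs_mult[symmetric])
      ultimately show "(\<psi> n \<omega> - ?\<chi> n \<omega>) * (p n \<omega> - exp (a - c) * p' n \<omega>) \<le> \<bar>p n \<omega> - q n \<omega>\<bar>"
        by (simp add: algebra_simps)
    qed
    also have "\<dots> \<le> e n" by (rule e)
    finally have "?I \<psi> p \<le> ?I ?\<chi> p + exp (a - c) * (?I \<psi> p' - ?I ?\<chi> p') + e n" by simp
    also have "exp (a - c) * (?I \<psi> p' - ?I ?\<chi> p') \<le> exp (a - c) * (power_fn \<psi> Q' n - power_fn ?\<chi> Q' n + 2 * \<delta>' n)"
      using 2 by (intro mult_left_mono) auto
    finally show ?thesis using 1 by linarith
  qed
  have Rlim: "(\<lambda>n. power_fn ?\<chi> Q n + 2 * \<delta> n + exp (a - c) * (power_fn \<psi> Q' n - power_fn ?\<chi> Q' n + 2 * \<delta>' n) + e n)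
    \<longlonglongrightarrow> 1 - \<Phi> ((a - (\<integral>x. X x * g x \<partial>P)) / L2_norm P X) + 2 * 0
      + exp (a - c) * (\<beta> - (1 - \<Phi> ((a - (\<integral>x. X x * g' x \<partial>P)) / L2_norm P X)) + 2 * 0)
      + hellinger_err (\<integral>x. (g x - g' x - X x)\<^sup>2 \<partial>P)"
    by (intro tendsto_add tendsto_mult tendsto_diff[of "power_fn \<psi> Q'"] tendsto_const \<delta> \<delta>' lim elim
        density_sequence_power_sum_test[OF P d XL X0 pos] density_sequence_power_sum_test[OF P d' XL X0 pos])
  have "limsup (\<lambda>n. ereal (power_fn \<psi> Q n)) \<le> limsup (\<lambda>n. ereal (power_fn ?\<chi> Q n + 2 * \<delta> n + exp (a - c) * (power_fn \<psi> Q' n - power_fn ?\<chi> Q' n + 2 * \<delta>' n) + e n))"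
    by (intro Limsup_mono always_eventually allI) (simp add: le)
  also have "\<dots> = ereal (1 - \<Phi> ((a - (\<integral>x. X x * g x \<partial>P)) / L2_norm P X) + 2 * 0
      + exp (a - c) * (\<beta> - (1 - \<Phi> ((a - (\<integral>x. X x * g' x \<partial>P)) / L2_norm P X)) + 2 * 0)
      + hellinger_err (\<integral>x. (g x - g' x - X x)\<^sup>2 \<partial>P))"
    using Rlim by (intro lim_imp_Limsup) auto
  finally show ?thesis by simp
qed

section \<open>From bounded tilts to general tangents\<close>

text \<open>Truncate \<open>w\<close> at level \<open>m\<close> and subtract the mean. Dominated
  convergence with \<open>w\<^sup>2\<close> controls the truncation, and the subtracted means tend
  to the mean of \<open>w\<close>, which is 0.\<close>

lemma bounded_centered_approximation:
  assumes P: "prob_space P" and w: "w \<in> L2 P" and w0: "(\<integral>x. w x \<partial>P) = 0"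
  obtains X B where "\<And>m. X m \<in> borel_measurable P" "\<And>m x. \<bar>X m x\<bar> \<le> B m"
    "\<And>m::nat. (\<integral>x. X m x \<partial>P) = 0" "L2_tendsto P X w"
proof -
  interpret prob_space P by fact
  note fin = finite_measure_axioms
  note [measurable] = L2_measurable[OF w]
  define T where "T m x = (if \<bar>w x\<bar> \<le> real m then w x else 0)" for m x
  have Tm [measurable]: "T m \<in> borel_measurable P" for m
    unfolding T_def by measurable
  have Tb: "\<bar>T m x\<bar> \<le> real m" for m x by (simp add: T_def)
  have TL: "T m \<in> L2 P" for m by (rule L2_bounded[OF fin Tm Tb])
  have "(\<lambda>m. \<integral>x. (T m x - w x)\<^sup>2 \<partial>P) \<longlonglongrightarrow> (\<integral>x. 0 \<partial>P)"
  proof (rule integral_dominated_convergence[where w="\<lambda>x. (w x)\<^sup>2"])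
    show "integrable P (\<lambda>x. (w x)\<^sup>2)" by (rule L2_square_integrable[OF w])
    show "AE x in P. (\<lambda>m. (T m x - w x)\<^sup>2) \<longlonglongrightarrow> 0"
    proof (intro AE_I2)
      fix x
      obtain N where "\<bar>w x\<bar> \<le> real N" using real_arch_simple by blast
      then have "\<forall>\<^sub>F m in sequentially. (T m x - w x)\<^sup>2 = 0"
        unfolding eventually_sequentially T_def by (intro exI[of _ N]) auto
      then show "(\<lambda>m. (T m x - w x)\<^sup>2) \<longlonglongrightarrow> 0" by (rule tendsto_eventually)
    qed
    show "AE x in P. norm ((T m x - w x)\<^sup>2) \<le> (w x)\<^sup>2" for m
      by (intro AE_I2) (simp add: T_def)
  qed measurable
  then have "(\<lambda>m. L2_norm P (\<lambda>x. T m x - w x)) \<longlonglongrightarrow> 0"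
    unfolding L2_norm_def using tendsto_real_sqrt by fastforce
  then have Tw: "L2_tendsto P T w"
    using TL w by (simp add: L2_tendsto_def)
  define \<mu> where "\<mu> m = (\<integral>x. T m x \<partial>P)" for m
  have "\<mu> \<longlonglongrightarrow> 0"
    using L2_tendsto_inner[OF Tw L2_tendsto_const[OF L2_const[OF fin, of 1]]] w0
    by (simp add: \<mu>_def[abs_def])
  then have "L2_tendsto P (\<lambda>m x. \<mu> m) (\<lambda>x. 0)"
    using L2_const[OF fin] by (auto simp: L2_tendsto_def L2_norm_def prob_space intro: tendsto_rabs_zero)
  note L = L2_tendsto_diff[OF Tw this]
  show thesis
  proof
    show "(\<lambda>x. T m x - \<mu> m) \<in> borel_measurable P" for m by measurable
    show "\<bar>T m x - \<mu> m\<bar> \<le> real m + \<bar>\<mu> m\<bar>" for m x using Tb[of m x] by linarith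
    show "(\<integral>x. T m x - \<mu> m \<partial>P) = 0" for m
      using L2_integrable[OF fin TL] by (simp add: \<mu>_def prob_space)
    show "L2_tendsto P (\<lambda>m x. T m x - \<mu> m) w" using L by simp
  qed
qed

text \<open>Two successive limits: \<open>n\<close> first, for fixed approximations
  \<open>X m\<close> of \<open>w\<close> and \<open>g' m\<close> of \<open>g - w\<close>, and then
  \<open>m\<close>. Along \<open>Q' m\<close> the comparison statistic has a mean tending to 0 and a
  standard deviation tending to \<open>\<sigma>\<close>, so the threshold
  \<open>\<sigma> * u\<close> gives it level \<open>\<beta>\<close> in the limit. The multiplier
  term and the Hellinger error then disappear, and only the Gaussian shift by
  \<open>\<sigma>\<close> remains.\<close>

lemma asymptotic_power_bound:
  fixes \<psi> :: "nat \<Rightarrow> (nat \<Rightarrow> 'a) \<Rightarrow> real"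
  assumes P: "prob_space P" and d: "density_sequence P Q L g"
    and w: "w \<in> L2 P" and w0: "(\<integral>x. w x \<partial>P) = 0" and pos: "L2_norm P w > 0"
    and orth: "(\<integral>x. w x * (g x - w x) \<partial>P) = 0"
    and \<psi>: "\<And>n. \<psi> n \<in> borel_measurable (\<Pi>\<^sub>M i\<in>{..<n}. P)"
    and \<psi>01: "\<And>n \<omega>. \<omega> \<in> space (\<Pi>\<^sub>M i\<in>{..<n}. P) \<Longrightarrow> 0 \<le> \<psi> n \<omega> \<and> \<psi> n \<omega> \<le> 1"
    and approx: "\<And>e. e > 0 \<Longrightarrow> \<exists>Q' L' g'. density_sequence P Q' L' g' \<and>
      L2_norm P (\<lambda>x. (g x - w x) - g' x) < e \<and> power_fn \<psi> Q' \<longlonglongrightarrow> \<beta>"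
    and u: "\<Phi> u = 1 - \<beta>"
  shows "limsup (\<lambda>n. ereal (power_fn \<psi> Q n)) \<le> ereal (1 - \<Phi> (u - L2_norm P w))"
proof -
  note D = density_sequenceD[OF d]
  define \<sigma> where "\<sigma> = L2_norm P w"
  have \<sigma>: "\<sigma> > 0" using pos by (simp add: \<sigma>_def)
  obtain X B where X: "\<And>m. X m \<in> borel_measurable P" "\<And>m x. \<bar>X m x\<bar> \<le> B m"
    "\<And>m::nat. (\<integral>x. X m x \<partial>P) = 0" and Xw: "L2_tendsto P X w"
    using bounded_centered_approximation[OF P w w0] by blast
  have "\<forall>m. \<exists>Q' L' g'. density_sequence P Q' L' g' \<and>
      L2_norm P (\<lambda>x. (g x - w x) - g' x) < 1 / real (Suc m) \<and> power_fn \<psi> Q' \<longlonglongrightarrow> \<beta>"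
    by (intro allI approx) simp
  then obtain Q' L' g' where d': "\<And>m. density_sequence P (Q' m) (L' m) (g' m)"
    and g': "\<And>m. L2_norm P (\<lambda>x. (g x - w x) - g' m x) < 1 / real (Suc m)"
    and lim': "\<And>m. power_fn \<psi> (Q' m) \<longlonglongrightarrow> \<beta>"
    by metis
  have gw: "(\<lambda>x. g x - w x) \<in> L2 P" using D(6) w by (rule L2_diff)
  have "(\<lambda>m. L2_norm P (\<lambda>x. (g x - w x) - g' m x)) \<longlonglongrightarrow> 0"
  proof (rule Lim_null_comparison[OF _ LIMSEQ_inverse_real_of_nat], intro always_eventually allI)
    fix m
    show "norm (L2_norm P (\<lambda>x. (g x - w x) - g' m x)) \<le> inverse (real (Suc m))"
      using g'[of m] by (simp add: inverse_eq_divide)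
  qed
  then have g'lim: "L2_tendsto P g' (\<lambda>x. g x - w x)"
    using density_sequenceD(6)[OF d'] gw
    by (simp add: L2_tendsto_def L2_norm_minus_commute[of P "g' _"])
  define c where "c m = (\<integral>x. X m x * g' m x \<partial>P) + (\<integral>x. (X m x)\<^sup>2 \<partial>P) / 2" for m
  define R where "R m = 1 - \<Phi> ((\<sigma> * u - (\<integral>x. X m x * g x \<partial>P)) / L2_norm P (X m))
      + exp (\<sigma> * u - c m) * (\<beta> - (1 - \<Phi> ((\<sigma> * u - (\<integral>x. X m x * g' m x \<partial>P)) / L2_norm P (X m))))
      + hellinger_err (\<integral>x. (g x - g' m x - X m x)\<^sup>2 \<partial>P)" for m
  have nX: "(\<lambda>m. L2_norm P (X m)) \<longlonglongrightarrow> \<sigma>"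
    unfolding \<sigma>_def by (rule L2_tendsto_norm[OF Xw])
  \<comment> \<open>An early truncation may vanish identically, so the bound is available only for
    large \<open>m\<close>.\<close>
  have "\<forall>\<^sub>F m in sequentially. L2_norm P (X m) > 0"
    using order_tendstoD(1)[OF nX \<sigma>] .
  then have ev: "\<forall>\<^sub>F m in sequentially. limsup (\<lambda>n. ereal (power_fn \<psi> Q n)) \<le> ereal (R m)"
  proof eventually_elim
    case (elim m)
    show ?case
      unfolding R_def c_def
      by (rule neyman_pearson_limsup[OF P d d' X elim \<psi> \<psi>01 lim'])
  qed
  \<comment> \<open>Orthogonality of \<open>w\<close> and \<open>g - w\<close> turns the drift along
    \<open>Q\<close> into the squared norm of \<open>w\<close>.\<close>
  have Xg: "(\<lambda>m. \<integral>x. X m x * g x \<partial>P) \<longlonglongrightarrow> \<sigma>\<^sup>2"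
  proof -
    have "(\<integral>x. w x * g x \<partial>P) = (\<integral>x. w x * (g x - w x) + (w x)\<^sup>2 \<partial>P)"
      by (intro Bochner_Integration.integral_cong refl) (simp add: power2_eq_square algebra_simps)
    also have "\<dots> = \<sigma>\<^sup>2"
      using L2_mult_integrable[OF w gw] L2_square_integrable[OF w] orth
      by (simp add: \<sigma>_def L2_norm_power2)
    finally show ?thesis
      using L2_tendsto_inner[OF Xw L2_tendsto_const[OF D(6)]] by simp
  qed
  have Xg': "(\<lambda>m. \<integral>x. X m x * g' m x \<partial>P) \<longlonglongrightarrow> 0"
    using L2_tendsto_inner[OF Xw g'lim] orth by simp
  have err: "(\<lambda>m. hellinger_err (\<integral>x. (g x - g' m x - X m x)\<^sup>2 \<partial>P)) \<longlonglongrightarrow> 0"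
  proof -
    have "L2_tendsto P (\<lambda>m x. g x - g' m x - X m x) (\<lambda>x. g x - (g x - w x) - w x)"
      by (intro L2_tendsto_diff L2_tendsto_const g'lim Xw D(6))
    from L2_tendsto_square[OF this] have "(\<lambda>m. \<integral>x. (g x - g' m x - X m x)\<^sup>2 \<partial>P) \<longlonglongrightarrow> 0" by simp
    then have "(\<lambda>m. hellinger_err (\<integral>x. (g x - g' m x - X m x)\<^sup>2 \<partial>P))
      \<longlonglongrightarrow> sqrt (2 - 2 * exp (- 0 / 8)) * sqrt (2 + 2 * exp (- 0 / 8))"
      unfolding hellinger_err_def by (intro tendsto_intros) simp_all
    then show ?thesis by simp
  qed
  have clim: "c \<longlonglongrightarrow> 0 + (\<integral>x. (w x)\<^sup>2 \<partial>P) / 2"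
    unfolding c_def by (intro tendsto_add Xg' tendsto_divide tendsto_const L2_tendsto_square[OF Xw]) simp
  have "R \<longlonglongrightarrow> 1 - \<Phi> ((\<sigma> * u - \<sigma>\<^sup>2) / \<sigma>)
      + exp (\<sigma> * u - (0 + (\<integral>x. (w x)\<^sup>2 \<partial>P) / 2)) * (\<beta> - (1 - \<Phi> ((\<sigma> * u - 0) / \<sigma>))) + 0"
    unfolding R_def
    by (intro tendsto_add tendsto_diff tendsto_mult tendsto_const tendsto_exp err clim
        isCont_tendsto_compose[OF isCont_std_normal_cdf] tendsto_divide Xg Xg' nX)
      (use \<sigma> in auto)
  moreover have "(\<sigma> * u - \<sigma>\<^sup>2) / \<sigma> = u - \<sigma>" "(\<sigma> * u - 0) / \<sigma> = u"
    using \<sigma> by (simp_all add: power2_eq_square diff_divide_distrib)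
  ultimately have "R \<longlonglongrightarrow> 1 - \<Phi> (u - \<sigma>)"
    using u by simp
  \<comment> \<open>The upper limit over \<open>n\<close> does not depend on \<open>m\<close>, hence
    is bounded by the limit of \<open>R m\<close>.\<close>
  then have "(\<lambda>m. ereal (R m)) \<longlonglongrightarrow> ereal (1 - \<Phi> (u - \<sigma>))" by simp
  then show ?thesis
    unfolding \<sigma>_def using ev by (rule tendsto_lowerbound) simp
qed

section \<open>Local sequences along differentiable curves, and the tangent space\<close>

lemma L2_diff_curve_density_sequence:
  assumes \<P>: "\<P> \<subseteq> space (prob_algebra M)" and curve: "L2_diff_curve \<P> P0 \<epsilon> f g"
    and t: "t \<longlonglongrightarrow> 0" and c: "c > 0" "(\<lambda>n. t n * sqrt (real n)) \<longlonglongrightarrow> c"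
    and tQ: "\<And>n. \<bar>t n\<bar> < \<epsilon>" "\<And>n. f (t n) = Q n"
  shows "\<exists>L. density_sequence P0 Q L (\<lambda>x. c * g x)"
proof -
  obtain L where \<epsilon>: "\<epsilon> > 0" and f: "\<And>t. \<bar>t\<bar> < \<epsilon> \<Longrightarrow> f t \<in> \<P>" "f 0 = P0" and g: "g \<in> L2 P0"
    and L: "\<And>t. \<bar>t\<bar> < \<epsilon> \<Longrightarrow> is_density_quotient (f t) P0 (L t)"
    and o1: "(\<lambda>t. L2_norm P0 (\<lambda>x. 2 * (sqrt (enn2real (L t x)) - 1) - t * g x)) \<in> o[at 0](\<lambda>t. \<bar>t\<bar>)"
    and o2: "(\<lambda>t. measure (f t) {x \<in> space P0. L t x = \<infinity>}) \<in> o[at 0](\<lambda>t. t\<^sup>2)"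
    using curve unfolding L2_diff_curve_def by blast
  have fM: "prob_space (f t)" "sets (f t) = sets M" if "\<bar>t\<bar> < \<epsilon>" for t
    using f(1)[OF that] \<P> by (auto simp: space_prob_algebra)
  have P: "prob_space P0" and setsP: "sets P0 = sets M"
    using fM[of 0] f(2) \<epsilon> by auto
  interpret prob_space P0 by fact
  have setsf: "sets (f t) = sets P0" if "\<bar>t\<bar> < \<epsilon>" for t
    using fM(2)[OF that] setsP by simp
  note R = density_quotient_restrict[OF P fM(1) setsf L]
  define s where "s n x = sqrt (enn2real (L (t n) x))" for n x
  have Lm: "L (t n) \<in> borel_measurable P0" for n
    using L[OF tQ(1)] by (simp add: is_density_quotient_def)
  have s2: "(s n x)\<^sup>2 = enn2real (L (t n) x)" for n x by (simp add: s_def)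
  have sL: "s n \<in> L2 P0" for n
    unfolding L2_def s2 using R(2)[OF tQ(1) tQ(1) tQ(1)] Lm[of n] by (simp add: s_def[abs_def])
  have "\<forall>\<^sub>F n in sequentially. t n * sqrt (real n) > 0"
    using order_tendstoD(1)[OF c(2,1)] .
  \<comment> \<open>The limits at 0 are punctured, so \<open>t n\<close> must avoid 0; positivity of
    \<open>c\<close> ensures this for all large \<open>n\<close>.\<close>
  then have tpos: "\<forall>\<^sub>F n in sequentially. t n > 0"
    by eventually_elim (auto simp: zero_less_mult_iff)
  then have t0: "filterlim t (at 0) sequentially"
    by (intro filterlim_atI t) (auto elim!: eventually_mono)
  let ?N = "\<lambda>t. L2_norm P0 (\<lambda>x. 2 * (sqrt (enn2real (L t x)) - 1) - t * g x)"
  have "(\<lambda>n. ?N (t n) / \<bar>t n\<bar> * (t n * sqrt (real n))) \<longlonglongrightarrow> 0 * c"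
    by (intro tendsto_mult c(2) filterlim_compose[OF smalloD_tendsto[OF o1] t0])
  moreover have "\<forall>\<^sub>F n in sequentially. ?N (t n) / \<bar>t n\<bar> * (t n * sqrt (real n)) = sqrt n * ?N (t n)"
    using tpos by eventually_elim simp
  ultimately have N: "(\<lambda>n. sqrt n * ?N (t n)) \<longlonglongrightarrow> 0"
    using tendsto_cong by fastforce
  let ?e = "\<lambda>n. L2_norm P0 (\<lambda>x. sqrt n * (s n x - 1) - c * g x / 2)"
  have "?e \<longlonglongrightarrow> 0"
  proof (rule Lim_null_comparison)
    show "(\<lambda>n. (sqrt n * ?N (t n) + \<bar>t n * sqrt (real n) - c\<bar> * L2_norm P0 g) / 2) \<longlonglongrightarrow> 0"
    proof -
      have "(\<lambda>n. (sqrt n * ?N (t n) + \<bar>t n * sqrt (real n) - c\<bar> * L2_norm P0 g) / 2)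
        \<longlonglongrightarrow> (0 + \<bar>c - c\<bar> * L2_norm P0 g) / 2"
        by (intro tendsto_intros N c(2)) simp
      then show ?thesis by simp
    qed
    show "\<forall>\<^sub>F n in sequentially. norm (?e n) \<le> (sqrt n * ?N (t n) + \<bar>t n * sqrt (real n) - c\<bar> * L2_norm P0 g) / 2"
    proof (intro always_eventually allI)
      fix n :: nat
      let ?h = "\<lambda>x. 2 * (s n x - 1) - t n * g x"
      have h: "?h \<in> L2 P0"
        by (intro L2_diff L2_cmult sL L2_const finite_measure_axioms g)
      have "?e n = L2_norm P0 (\<lambda>x. (1/2) * (sqrt n * ?h x + (t n * sqrt n - c) * g x))"
        by (intro arg_cong[where f="L2_norm P0"] ext) (simp add: field_simps)
      also have "\<dots> = (1/2) * L2_norm P0 (\<lambda>x. sqrt n * ?h x + (t n * sqrt n - c) * g x)"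
        by (simp only: L2_norm_cmult)
      also have "\<dots> \<le> (1/2) * (L2_norm P0 (\<lambda>x. sqrt n * ?h x) + L2_norm P0 (\<lambda>x. (t n * sqrt n - c) * g x))"
        by (intro mult_left_mono L2_norm_triangle L2_cmult h g) simp
      finally show "norm (?e n) \<le> (sqrt n * ?N (t n) + \<bar>t n * sqrt (real n) - c\<bar> * L2_norm P0 g) / 2"
        unfolding L2_norm_cmult by (simp add: s_def)
    qed
  qed
  then have exp1: "L2_tendsto P0 (\<lambda>n x. sqrt n * (s n x - 1)) (\<lambda>x. c * g x / 2)"
    using L2_cmult[OF g, of "c/2"]
    by (auto simp: L2_tendsto_def intro!: L2_cmult L2_diff sL L2_const finite_measure_axioms)
  let ?m = "\<lambda>t. measure (f t) {x \<in> space P0. L t x = \<infinity>}"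
  have "(\<lambda>n. - (?m (t n) / (t n)\<^sup>2 * (t n * sqrt (real n))\<^sup>2)) \<longlonglongrightarrow> - (0 * c\<^sup>2)"
    by (intro tendsto_minus tendsto_mult tendsto_power c(2) filterlim_compose[OF smalloD_tendsto[OF o2] t0])
  moreover have "\<forall>\<^sub>F n in sequentially. - (?m (t n) / (t n)\<^sup>2 * (t n * sqrt (real n))\<^sup>2) = n * ((\<integral>x. (s n x)\<^sup>2 \<partial>P0) - 1)"
    using tpos
  proof eventually_elim
    case (elim n)
    then show ?case
      unfolding s2 R(4)[OF tQ(1) tQ(1) tQ(1)] by (simp add: power_mult_distrib)
  qed
  ultimately have "(\<lambda>n. n * ((\<integral>x. (s n x)\<^sup>2 \<partial>P0) - 1)) \<longlonglongrightarrow> 0"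
    using tendsto_cong by fastforce
  then have "L2_root_expansion P0 s (\<lambda>x. c * g x)"
    using exp1 sL L2_cmult[OF g] by (simp add: L2_root_expansion_def)
  then have "density_sequence P0 Q (\<lambda>n. L (t n)) (\<lambda>x. c * g x)"
    unfolding density_sequence_def using fM(1)[OF tQ(1)] setsf[OF tQ(1)] L[OF tQ(1)]
    by (simp add: tQ(2) s_def[abs_def])
  then show ?thesis
    by (rule exI[where x="\<lambda>n. L (t n)"])
qed

text \<open>The scaled increment is \<open>t n * sqrt n\<close> times the difference quotient. Since
  \<open>c > 0\<close>, the points \<open>t n\<close> are eventually positive, as the one-sided
  derivative in the definition of a gradient requires.\<close>

lemma gradient_limit:
  assumes grad: "is_gradient \<P> P0 k kt" and curve: "L2_diff_curve \<P> P0 \<epsilon> f g"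
    and t: "t \<longlonglongrightarrow> 0" and c: "c > 0" "(\<lambda>n. t n * sqrt (real n)) \<longlonglongrightarrow> c"
    and Q: "\<And>n. f (t n) = Q n"
  shows "(\<lambda>n. sqrt (real n) * (k (Q n) - k P0)) \<longlonglongrightarrow> c * (\<integral>x. kt x * g x \<partial>P0)"
proof -
  have lim: "((\<lambda>t. (k (f t) - k P0) / t) \<longlongrightarrow> (\<integral>x. kt x * g x \<partial>P0)) (at_right 0)"
    using grad curve unfolding is_gradient_def by blast
  have "\<forall>\<^sub>F n in sequentially. t n * sqrt (real n) > 0"
    using order_tendstoD(1)[OF c(2,1)] .
  then have tpos: "\<forall>\<^sub>F n in sequentially. t n > 0"
    by eventually_elim (auto simp: zero_less_mult_iff)
  have "filterlim t (at_right 0) sequentially"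
    unfolding filterlim_at using t tpos by (auto elim!: eventually_mono)
  from tendsto_mult[OF c(2) filterlim_compose[OF lim this]]
  have "(\<lambda>n. t n * sqrt (real n) * ((k (f (t n)) - k P0) / t n)) \<longlonglongrightarrow> c * (\<integral>x. kt x * g x \<partial>P0)" .
  moreover have "\<forall>\<^sub>F n in sequentially. t n * sqrt (real n) * ((k (f (t n)) - k P0) / t n) = sqrt (real n) * (k (Q n) - k P0)"
    using tpos by eventually_elim (simp add: Q)
  ultimately show ?thesis
    using tendsto_cong by fastforce
qed

text \<open>The same function \<open>c * g\<close> governs the densities and the functional. Thus
  the drift of the gradient statistic equals the limit of the scaled increments of \<open>k\<close>,
  the quantity that separates hypotheses from alternatives.\<close>

lemma F1_seqs_expansion:
  assumes \<P>: "\<P> \<subseteq> space (prob_algebra M)" and grad: "is_gradient \<P> P0 k kt"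
    and Q: "Q \<in> F1_seqs \<P> P0"
  obtains L c g where "c > 0" "g \<in> tangent_cone P0 \<P>" "density_sequence P0 Q L (\<lambda>x. c * g x)"
    "(\<lambda>n. sqrt (real n) * (k (Q n) - k P0)) \<longlonglongrightarrow> (\<integral>x. kt x * (c * g x) \<partial>P0)"
proof -
  obtain t \<epsilon> f g c where h: "t \<longlonglongrightarrow> 0" "c > 0" "(\<lambda>n. t n * sqrt (real n)) \<longlonglongrightarrow> c"
    "L2_diff_curve \<P> P0 \<epsilon> f g" "\<And>n. \<bar>t n\<bar> < \<epsilon>" "\<And>n. f (t n) = Q n"
    using Q unfolding F1_seqs_def by blast
  have "(\<integral>x. kt x * (c * g x) \<partial>P0) = (\<integral>x. c * (kt x * g x) \<partial>P0)"
    by (simp only: mult_ac)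
  then have eq: "(\<integral>x. kt x * (c * g x) \<partial>P0) = c * (\<integral>x. kt x * g x \<partial>P0)" by simp
  obtain L where "density_sequence P0 Q L (\<lambda>x. c * g x)"
    using L2_diff_curve_density_sequence[OF \<P> h(4,1-3,5,6)] by blast
  then show thesis
    using that[of c g L] h(2,4) gradient_limit[OF grad h(4,1-3,6)]
    unfolding eq tangent_cone_def by blast
qed

text \<open>Following the curve at \<open>t n = 1 / sqrt n\<close> gives \<open>c = 1\<close>, so
  every tangent in the cone occurs itself as a local tangent.\<close>

lemma tangent_cone_sequence:
  assumes \<P>: "\<P> \<subseteq> space (prob_algebra M)" and grad: "is_gradient \<P> P0 k kt"
    and g: "g \<in> tangent_cone P0 \<P>"
  obtains Q L where "Q \<in> F1_seqs \<P> P0" "density_sequence P0 Q L g"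
    "(\<lambda>n. sqrt (real n) * (k (Q n) - k P0)) \<longlonglongrightarrow> (\<integral>x. kt x * g x \<partial>P0)"
proof -
  obtain \<epsilon> f where curve: "L2_diff_curve \<P> P0 \<epsilon> f g"
    using g unfolding tangent_cone_def by blast
  then have \<epsilon>: "\<epsilon> > 0" by (simp add: L2_diff_curve_def)
  \<comment> \<open>\<open>F1_seqs\<close> asks for \<open>\<bar>t n\<bar> < \<epsilon>\<close> at
    every index, so the finitely many values of \<open>1 / sqrt n\<close> outside the domain of the
    curve are replaced by 0.\<close>
  define t where "t n = (if 1 / sqrt (real n) < \<epsilon> then 1 / sqrt (real n) else 0)" for n :: nat
  have inv: "(\<lambda>n::nat. 1 / sqrt n) \<longlonglongrightarrow> 0"
    by (intro tendsto_divide_0[OF tendsto_const] filterlim_at_top_imp_at_infinity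
        filterlim_compose[OF sqrt_at_top] filterlim_real_sequentially)
  have ev: "\<forall>\<^sub>F n in sequentially. t n = 1 / sqrt (real n)"
    using order_tendstoD(2)[OF inv \<epsilon>] by eventually_elim (simp add: t_def)
  have t0: "t \<longlonglongrightarrow> 0"
    using inv tendsto_cong[OF ev] by simp
  have "\<forall>\<^sub>F n in sequentially. t n * sqrt (real n) = 1"
    using ev eventually_gt_at_top[of 0] by eventually_elim simp
  then have t1: "(\<lambda>n. t n * sqrt (real n)) \<longlonglongrightarrow> 1"
    by (rule tendsto_eventually)
  have te: "\<bar>t n\<bar> < \<epsilon>" for n using \<epsilon> by (simp add: t_def)
  obtain L where "density_sequence P0 (\<lambda>n. f (t n)) L (\<lambda>x. 1 * g x)"
    using L2_diff_curve_density_sequence[OF \<P> curve t0 zero_less_one t1 te refl] by blast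
  moreover have "(\<lambda>n. f (t n)) \<in> F1_seqs \<P> P0"
    unfolding F1_seqs_def using t0 t1 curve te zero_less_one by blast
  moreover have "(\<lambda>n. sqrt (real n) * (k (f (t n)) - k P0)) \<longlonglongrightarrow> 1 * (\<integral>x. kt x * g x \<partial>P0)"
    by (rule gradient_limit[OF grad curve t0 zero_less_one t1 refl])
  ultimately show thesis using that by simp
qed

text \<open>Approximate \<open>h\<close> by some \<open>s\<close> in the span; then
  \<open>c g - b s\<close> is again in the span, at distance \<open>\<bar>b\<bar>\<close> times that
  of \<open>h\<close> and \<open>s\<close>.\<close>

lemma tangent_space_combination:
  assumes g: "g \<in> tangent_cone P0 \<P>" and h: "h \<in> tangent_space P0 \<P>"
  shows "(\<lambda>x. c * g x - b * h x) \<in> tangent_space P0 \<P>"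
  unfolding tangent_space_def L2_closure_def
proof (intro CollectI conjI allI impI)
  have "g \<in> L2 P0" "h \<in> L2 P0"
    using g h by (auto simp: tangent_cone_def L2_diff_curve_def tangent_space_def L2_closure_def)
  then show "(\<lambda>x. c * g x - b * h x) \<in> L2 P0"
    by (intro L2_diff L2_cmult)
  fix e :: real assume "e > 0"
  \<comment> \<open>The summand 1 also covers \<open>b = 0\<close>.\<close>
  then have "e / (\<bar>b\<bar> + 1) > 0" by (simp add: add_nonneg_pos)
  then obtain s where s: "s \<in> lin_span (tangent_cone P0 \<P>)" and le: "L2_norm P0 (\<lambda>x. h x - s x) < e / (\<bar>b\<bar> + 1)"
    using h unfolding tangent_space_def L2_closure_def by blast
  obtain m :: nat and a G where s_eq: "s = (\<lambda>x. \<Sum>i<m. a i * G i x)" and G: "\<forall>i<m. G i \<in> tangent_cone P0 \<P>"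
    using s unfolding lin_span_def by blast
  let ?s = "\<lambda>x. c * g x - b * s x"
  \<comment> \<open>\<open>g\<close> is appended to the linear combination as its last summand, with
    index \<open>m\<close>.\<close>
  have "?s = (\<lambda>x. \<Sum>i<Suc m. (if i < m then - b * a i else c) * (if i < m then G i else g) x)"
    by (simp add: s_eq sum_distrib_left sum_negf mult.assoc)
  moreover have "\<forall>i<Suc m. (if i < m then G i else g) \<in> tangent_cone P0 \<P>"
    using G g by simp
  ultimately have "?s \<in> lin_span (tangent_cone P0 \<P>)"
    unfolding lin_span_def mem_Collect_eq
    by (intro exI[of _ "Suc m"] exI[of _ "\<lambda>i. if i < m then - b * a i else c"]
        exI[of _ "\<lambda>i. if i < m then G i else g"]) (rule conjI)
  moreover have "L2_norm P0 (\<lambda>x. c * g x - b * h x - ?s x) < e"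
  proof -
    have "(\<lambda>x. c * g x - b * h x - ?s x) = (\<lambda>x. - b * (h x - s x))"
      by (simp add: algebra_simps)
    then have "L2_norm P0 (\<lambda>x. c * g x - b * h x - ?s x) = \<bar>b\<bar> * L2_norm P0 (\<lambda>x. h x - s x)"
      by (simp only: L2_norm_cmult abs_minus_cancel)
    also have "\<dots> \<le> (\<bar>b\<bar> + 1) * L2_norm P0 (\<lambda>x. h x - s x)"
      by (intro mult_right_mono) auto
    also have "\<dots> < e"
      using le by (simp add: pos_less_divide_eq add_nonneg_pos mult.commute)
    finally show ?thesis .
  qed
  ultimately show "\<exists>s\<in>lin_span (tangent_cone P0 \<P>). L2_norm P0 (\<lambda>x. c * g x - b * h x - s x) < e"
    by (intro bexI[where x="?s"])
qed

section \<open>Optimality of the gradient test\<close>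

lemma gradient_test_eq_sum_test:
  "gradient_test kt P0 \<alpha> = sum_test kt (std_normal_quantile (1 - \<alpha>) * L2_norm P0 kt)"
  by (intro ext) (simp add: gradient_test_def sum_test_def)

lemma gradient_test_power:
  assumes P: "prob_space P0" and d: "density_sequence P0 Q L g"
    and kt: "kt \<in> L2_zero P0" and pos: "L2_norm P0 kt > 0"
  shows "power_fn (gradient_test kt P0 \<alpha>) Q
    \<longlonglongrightarrow> 1 - \<Phi> (std_normal_quantile (1 - \<alpha>) - (\<integral>x. kt x * g x \<partial>P0) / L2_norm P0 kt)"
proof -
  have "(\<lambda>n. power_fn (sum_test kt (std_normal_quantile (1 - \<alpha>) * L2_norm P0 kt)) Q n)
    \<longlonglongrightarrow> 1 - \<Phi> ((std_normal_quantile (1 - \<alpha>) * L2_norm P0 kt - (\<integral>x. kt x * g x \<partial>P0)) / L2_norm P0 kt)"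
    using kt by (intro density_sequence_power_sum_test[OF P d _ _ pos]) (auto simp: L2_zero_def)
  then show ?thesis
    using pos by (simp add: gradient_test_eq_sum_test diff_divide_distrib)
qed

text \<open>Project \<open>c g\<close> onto the gradient: the component \<open>w\<close> has norm
  \<open>\<bar>\<theta>\<bar> / L2_norm P0 kt\<close>, and the remainder lies in the nuisance space,
  where tangents from \<open>D\<close> are dense. The sign of \<open>\<theta>\<close> does not
  affect the norm, and the level \<open>\<beta>\<close> is arbitrary, so the bound can be applied to
  \<open>\<psi>\<close> and to \<open>1 - \<psi>\<close>.\<close>

lemma similar_test_power_bound:
  fixes \<psi> :: "nat \<Rightarrow> (nat \<Rightarrow> 'a) \<Rightarrow> real"
  assumes \<P>: "\<P> \<subseteq> space (prob_algebra M)" and P0: "P0 \<in> \<P>"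
    and can: "is_canonical_gradient \<P> P0 k kt" and pos: "L2_norm P0 kt > 0"
    and D: "D \<subseteq> tangent_cone P0 \<P> \<inter> nuisance_space kt P0 \<P>"
    and dense: "nuisance_space kt P0 \<P> \<subseteq> L2_closure P0 D"
    and test: "is_test_seq M \<psi>"
    and sim: "\<And>Q. Q \<in> F1_seqs \<P> P0 \<Longrightarrow> (\<lambda>n. sqrt (real n) * (k (Q n) - k P0)) \<longlonglongrightarrow> 0 \<Longrightarrow> power_fn \<psi> Q \<longlonglongrightarrow> \<beta>"
    and g: "g \<in> tangent_cone P0 \<P>" and d: "density_sequence P0 Q L (\<lambda>x. c * g x)"
    and \<theta>: "\<theta> = (\<integral>x. kt x * (c * g x) \<partial>P0)" "\<theta> \<noteq> 0" and u: "\<Phi> u = 1 - \<beta>"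
  shows "limsup (\<lambda>n. ereal (power_fn \<psi> Q n)) \<le> ereal (1 - \<Phi> (u - \<bar>\<theta>\<bar> / L2_norm P0 kt))"
proof -
  have P: "prob_space P0" and sets: "sets P0 = sets M"
    using \<P> P0 by (auto simp: space_prob_algebra)
  interpret prob_space P0 by fact
  have grad: "is_gradient \<P> P0 k kt" and ktT: "kt \<in> tangent_space P0 \<P>"
    using can by (auto simp: is_canonical_gradient_def)
  have ktL: "kt \<in> L2 P0" and kt0: "(\<integral>x. kt x \<partial>P0) = 0"
    using grad by (auto simp: is_gradient_def L2_zero_def)
  have gL: "(\<lambda>x. c * g x) \<in> L2 P0" using density_sequenceD(6)[OF d] .
  \<comment> \<open>The coefficient of the orthogonal projection of \<open>c * g\<close> onto
    \<open>kt\<close>.\<close>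
  define b where "b = \<theta> / (L2_norm P0 kt)\<^sup>2"
  define w where "w x = b * kt x" for x
  have wL: "w \<in> L2 P0" unfolding w_def[abs_def] by (rule L2_cmult[OF ktL])
  have w0: "(\<integral>x. w x \<partial>P0) = 0" unfolding w_def using kt0 by simp
  have "L2_norm P0 w = \<bar>b\<bar> * L2_norm P0 kt" unfolding w_def[abs_def] by (rule L2_norm_cmult)
  also have "\<dots> = \<bar>\<theta>\<bar> / L2_norm P0 kt"
    using pos by (simp add: b_def abs_divide power2_eq_square)
  finally have wn: "L2_norm P0 w = \<bar>\<theta>\<bar> / L2_norm P0 kt" .
  have orth: "(\<integral>x. kt x * (c * g x - w x) \<partial>P0) = 0"
  proof -
    have "(\<integral>x. kt x * (c * g x - w x) \<partial>P0) = (\<integral>x. kt x * (c * g x) - b * (kt x)\<^sup>2 \<partial>P0)"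
      by (intro Bochner_Integration.integral_cong refl) (simp add: w_def power2_eq_square algebra_simps)
    also have "\<dots> = \<theta> - b * (L2_norm P0 kt)\<^sup>2"
      using L2_mult_integrable[OF ktL gL] L2_square_integrable[OF ktL] by (simp add: \<theta> L2_norm_power2)
    also have "\<dots> = 0" using pos by (simp add: b_def)
    finally show ?thesis .
  qed
  have nuis: "(\<lambda>x. c * g x - w x) \<in> nuisance_space kt P0 \<P>"
    unfolding nuisance_space_def using orth tangent_space_combination[OF g ktT, of c b]
    by (simp add: w_def)
  have "limsup (\<lambda>n. ereal (power_fn \<psi> Q n)) \<le> ereal (1 - \<Phi> (u - L2_norm P0 w))"
  proof (rule asymptotic_power_bound[OF P d wL w0 _ _ _ _ _ u])
    show "L2_norm P0 w > 0" using wn pos \<theta>(2) by simp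
    have "(\<integral>x. w x * (c * g x - w x) \<partial>P0) = (\<integral>x. b * (kt x * (c * g x - w x)) \<partial>P0)"
      by (simp add: w_def mult.assoc)
    then show "(\<integral>x. w x * (c * g x - w x) \<partial>P0) = 0" using orth by simp
    have PM: "sets (\<Pi>\<^sub>M i\<in>{..<n}. P0) = sets (\<Pi>\<^sub>M i\<in>{..<n}. M)" for n :: nat
      by (intro sets_PiM_cong refl sets)
    show "\<psi> n \<in> borel_measurable (\<Pi>\<^sub>M i\<in>{..<n}. P0)" for n
      using test PM[of n] by (simp add: is_test_seq_def cong: measurable_cong_sets)
    show "0 \<le> \<psi> n \<omega> \<and> \<psi> n \<omega> \<le> 1" if "\<omega> \<in> space (\<Pi>\<^sub>M i\<in>{..<n}. P0)" for n \<omega>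
      using test that sets_eq_imp_space_eq[OF PM[of n]] by (auto simp: is_test_seq_def)
    fix e :: real assume "e > 0"
    then obtain g' where g': "g' \<in> D" "L2_norm P0 (\<lambda>x. c * g x - w x - g' x) < e"
      using nuis dense unfolding L2_closure_def by blast
    \<comment> \<open>An element of \<open>D\<close> is itself a tangent, not just a limit of
      combinations of tangents. Some local sequence therefore realizes it, and orthogonality to the
      gradient puts that sequence on the boundary, where similarity fixes the limiting
      power.\<close>
    then have g'T: "g' \<in> tangent_cone P0 \<P>" and g'0: "(\<integral>x. kt x * g' x \<partial>P0) = 0"
      using D by (auto simp: nuisance_space_def)
    obtain Q' L' where "Q' \<in> F1_seqs \<P> P0" "density_sequence P0 Q' L' g'"
      "(\<lambda>n. sqrt (real n) * (k (Q' n) - k P0)) \<longlonglongrightarrow> 0"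
      using tangent_cone_sequence[OF \<P> grad g'T] g'0 by metis
    then show "\<exists>Q' L' g'. density_sequence P0 Q' L' g' \<and>
      L2_norm P0 (\<lambda>x. (c * g x - w x) - g' x) < e \<and> power_fn \<psi> Q' \<longlonglongrightarrow> \<beta>"
      using sim g'(2) by blast
  qed
  then show ?thesis unfolding wn .
qed

theorem mainTheorem8:
  fixes M :: "'a measure" and \<P> :: "'a measure set" and P0 :: "'a measure"
    and k :: "'a measure \<Rightarrow> real" and kt :: "'a \<Rightarrow> real" and \<alpha> :: real
    and D :: "('a \<Rightarrow> real) set"
  assumes "\<P> \<noteq> {}" and "\<P> \<subseteq> space (prob_algebra M)" and "P0 \<in> \<P>"
    and "is_canonical_gradient \<P> P0 k kt"
    and "(\<integral>x. (kt x)\<^sup>2 \<partial>P0) \<noteq> 0"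
    and "0 < \<alpha>" and "\<alpha> < 1"
    and "D \<subseteq> tangent_cone P0 \<P> \<inter> nuisance_space kt P0 \<P>"
    and "nuisance_space kt P0 \<P> \<subseteq> L2_closure P0 D"
  shows "asymp_optimal (asymp_similar_tests M \<P> P0 k \<alpha>)
           (implicit_hypotheses \<P> P0 k) (implicit_alternatives \<P> P0 k)
           (gradient_test kt P0 \<alpha>)"
proof -
  note \<P> = assms(2)
  have P: "prob_space P0" and sets: "sets P0 = sets M"
    using \<P> assms(3) by (auto simp: space_prob_algebra)
  have grad: "is_gradient \<P> P0 k kt"
    using assms(4) by (auto simp: is_canonical_gradient_def)
  then have ktZ: "kt \<in> L2_zero P0" by (auto simp: is_gradient_def)
  define \<sigma> where "\<sigma> = L2_norm P0 kt"
  have \<sigma>: "\<sigma> > 0"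
    using assms(5) by (simp add: \<sigma>_def L2_norm_def less_le Bochner_Integration.integral_nonneg)
  define u where "u = std_normal_quantile (1 - \<alpha>)"
  have u: "\<Phi> u = 1 - \<alpha>"
    unfolding u_def using assms(6,7) by (intro std_normal_cdf_quantile) auto
  let ?\<phi> = "gradient_test kt P0 \<alpha>"
  let ?r = "\<lambda>Q n. sqrt (real n) * (k (Q n) - k P0)"
  \<comment> \<open>The limiting power depends on the sequence only through \<open>\<theta>\<close>;
    at \<open>\<theta> = 0\<close> it is \<open>\<alpha>\<close>, which makes the gradient test
    similar.\<close>
  have \<phi>: "power_fn ?\<phi> Q \<longlonglongrightarrow> 1 - \<Phi> (u - \<theta> / \<sigma>)"
    if Q: "Q \<in> F1_seqs \<P> P0" and lim: "?r Q \<longlonglongrightarrow> \<theta>" for Q \<theta>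
  proof -
    obtain L c g where h: "density_sequence P0 Q L (\<lambda>x. c * g x)" "?r Q \<longlonglongrightarrow> (\<integral>x. kt x * (c * g x) \<partial>P0)"
      using F1_seqs_expansion[OF \<P> grad Q] by blast
    have "\<theta> = (\<integral>x. kt x * (c * g x) \<partial>P0)" using LIMSEQ_unique[OF lim h(2)] .
    then show ?thesis
      using gradient_test_power[OF P h(1) ktZ \<sigma>[unfolded \<sigma>_def], of \<alpha>] by (simp add: u_def \<sigma>_def)
  qed
  have test: "is_test_seq M ?\<phi>"
  proof -
    have "kt \<in> borel_measurable M"
      using ktZ sets by (simp add: L2_zero_def L2_def cong: measurable_cong_sets)
    then show ?thesis
      unfolding is_test_seq_def gradient_test_eq_sum_test by (auto simp: sum_test_01)
  qed
  have bound: "limsup (\<lambda>n. ereal (power_fn \<psi> Q n)) \<le> ereal (1 - \<Phi> (v - \<bar>\<theta>\<bar> / \<sigma>))"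
    if Q: "Q \<in> F1_seqs \<P> P0" and lim: "?r Q \<longlonglongrightarrow> \<theta>" and \<theta>: "\<theta> \<noteq> 0" and \<psi>: "is_test_seq M \<psi>"
      and sim: "\<And>Q. Q \<in> F1_seqs \<P> P0 \<Longrightarrow> ?r Q \<longlonglongrightarrow> 0 \<Longrightarrow> power_fn \<psi> Q \<longlonglongrightarrow> \<beta>" and v: "\<Phi> v = 1 - \<beta>"
    for Q \<theta> \<psi> \<beta> v
  proof -
    obtain L c g where h: "g \<in> tangent_cone P0 \<P>" "density_sequence P0 Q L (\<lambda>x. c * g x)"
      "?r Q \<longlonglongrightarrow> (\<integral>x. kt x * (c * g x) \<partial>P0)"
      using F1_seqs_expansion[OF \<P> grad Q] by blast
    have eq: "\<theta> = (\<integral>x. kt x * (c * g x) \<partial>P0)" using LIMSEQ_unique[OF lim h(3)] .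
    show ?thesis
      unfolding \<sigma>_def
      by (rule similar_test_power_bound[OF \<P> assms(3,4) \<sigma>[unfolded \<sigma>_def] assms(8,9) \<psi> sim h(1,2) eq \<theta> v])
  qed
  have F: "Q \<in> F1_seqs \<P> P0" if "Q \<in> implicit_hypotheses \<P> P0 k \<union> implicit_alternatives \<P> P0 k" for Q
    using that by (auto simp: implicit_hypotheses_def implicit_alternatives_def)
  \<comment> \<open>The sequences with limit 0 all belong to the implicit hypotheses, so similarity
    may be used for any of them in \<open>F1_seqs\<close>.\<close>
  have sim: "power_fn \<psi> Q \<longlonglongrightarrow> \<alpha>"
    if "\<psi> \<in> asymp_similar_tests M \<P> P0 k \<alpha>" "Q \<in> F1_seqs \<P> P0" "?r Q \<longlonglongrightarrow> 0" for \<psi> Q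
    using that unfolding asymp_similar_tests_def implicit_hypotheses_def by blast
  have ps: "prob_space (\<Pi>\<^sub>M i\<in>{..<n}. Q n)" and setsQ: "sets (Q n) = sets M" if "Q \<in> F1_seqs \<P> P0" for Q and n :: nat
    using F1_seqs_expansion[OF \<P> grad that] density_sequenceD(1,2) sets
    by (metis prob_space_PiM)+
  have compl: "power_fn (\<lambda>n \<omega>. 1 - \<psi> n \<omega>) Q n = 1 - power_fn \<psi> Q n"
    if \<psi>: "is_test_seq M \<psi>" and Q: "Q \<in> F1_seqs \<P> P0" for \<psi> Q n
  proof -
    interpret prob_space "\<Pi>\<^sub>M i\<in>{..<n}. Q n" by (rule ps[OF Q])
    have QM: "sets (\<Pi>\<^sub>M i\<in>{..<n}. Q n) = sets (\<Pi>\<^sub>M i\<in>{..<n}. M)"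
      by (intro sets_PiM_cong refl setsQ Q)
    have "\<psi> n \<in> borel_measurable (\<Pi>\<^sub>M i\<in>{..<n}. Q n)"
      using \<psi> QM by (simp add: is_test_seq_def cong: measurable_cong_sets)
    then have "integrable (\<Pi>\<^sub>M i\<in>{..<n}. Q n) (\<psi> n)"
      using \<psi> sets_eq_imp_space_eq[OF QM]
      by (intro integrable_const_bound[where B=1]) (auto simp: is_test_seq_def)
    then show ?thesis by (simp add: power_fn_def prob_space)
  qed
  show ?thesis
    unfolding asymp_optimal_def
  proof (intro conjI ballI)
    show "?\<phi> \<in> asymp_similar_tests M \<P> P0 k \<alpha>"
      unfolding asymp_similar_tests_def using test \<phi>[of _ 0] u by (auto simp: implicit_hypotheses_def)
  next
    fix Q assume Q: "Q \<in> implicit_hypotheses \<P> P0 k \<union> implicit_alternatives \<P> P0 k"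
    then obtain \<theta> where "?r Q \<longlonglongrightarrow> \<theta>"
      by (auto simp: implicit_hypotheses_def implicit_alternatives_def)
    then show "convergent (power_fn ?\<phi> Q)"
      using \<phi>[OF F[OF Q]] by (auto simp: convergent_def)
  next
    fix \<psi> Q assume \<psi>: "\<psi> \<in> asymp_similar_tests M \<P> P0 k \<alpha>" and Q: "Q \<in> implicit_alternatives \<P> P0 k"
    obtain \<theta> where \<theta>: "\<theta> > 0" "?r Q \<longlonglongrightarrow> \<theta>"
      using Q by (auto simp: implicit_alternatives_def)
    have QF: "Q \<in> F1_seqs \<P> P0" using F Q by blast
    have \<psi>t: "is_test_seq M \<psi>" using \<psi> by (simp add: asymp_similar_tests_def)
    \<comment> \<open>For positive \<open>\<theta>\<close> the bound coincides with the limiting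
      power of the gradient test.\<close>
    have "limsup (\<lambda>n. ereal (power_fn \<psi> Q n)) \<le> ereal (1 - \<Phi> (u - \<bar>\<theta>\<bar> / \<sigma>))"
      using \<theta>(1) by (intro bound[OF QF \<theta>(2) _ \<psi>t sim[OF \<psi>] u]) auto
    then show "limsup (\<lambda>n. ereal (power_fn \<psi> Q n)) \<le> ereal (lim (power_fn ?\<phi> Q))"
      using limI[OF \<phi>[OF QF \<theta>(2)]] \<theta>(1) by simp
  next
    fix \<psi> Q assume \<psi>: "\<psi> \<in> asymp_similar_tests M \<P> P0 k \<alpha>" and Q: "Q \<in> implicit_hypotheses \<P> P0 k"
    obtain \<theta> where \<theta>: "\<theta> \<le> 0" "?r Q \<longlonglongrightarrow> \<theta>"
      using Q by (auto simp: implicit_hypotheses_def)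
    have QF: "Q \<in> F1_seqs \<P> P0" using F Q by blast
    have \<psi>t: "is_test_seq M \<psi>" using \<psi> by (simp add: asymp_similar_tests_def)
    have lim\<phi>: "lim (power_fn ?\<phi> Q) = 1 - \<Phi> (u - \<theta> / \<sigma>)"
      using limI[OF \<phi>[OF QF \<theta>(2)]] .
    show "ereal (lim (power_fn ?\<phi> Q)) \<le> liminf (\<lambda>n. ereal (power_fn \<psi> Q n))"
    proof (cases "\<theta> = 0")
      \<comment> \<open>On the boundary both powers tend to \<open>\<alpha>\<close>; the bound,
        which assumes \<open>\<theta> \<noteq> 0\<close>, is reserved for the other case.\<close>
      case True
      then have "(\<lambda>n. ereal (power_fn \<psi> Q n)) \<longlonglongrightarrow> ereal \<alpha>"
        using sim[OF \<psi> QF] \<theta>(2) by simp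
      then have "liminf (\<lambda>n. ereal (power_fn \<psi> Q n)) = ereal \<alpha>"
        by (intro lim_imp_Liminf) auto
      then show ?thesis using True u by (simp add: lim\<phi>)
    next
      case False
      let ?\<psi>' = "\<lambda>n \<omega>. 1 - \<psi> n \<omega>"
      have \<psi>t': "is_test_seq M ?\<psi>'"
        using \<psi>t by (auto simp: is_test_seq_def intro!: borel_measurable_diff)
      \<comment> \<open>The complementary test is similar of level \<open>1 - \<alpha>\<close>, with
        critical value \<open>- u\<close> by symmetry. An upper bound for its power is a lower bound
        for that of \<open>\<psi>\<close>, and \<open>\<bar>\<theta>\<bar> = - \<theta>\<close>
        makes it agree with the limit for the gradient test.\<close>
      have "limsup (\<lambda>n. ereal (power_fn ?\<psi>' Q n)) \<le> ereal (1 - \<Phi> (- u - \<bar>\<theta>\<bar> / \<sigma>))"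
      proof (rule bound[OF QF \<theta>(2) False \<psi>t'])
        show "\<Phi> (- u) = 1 - (1 - \<alpha>)" by (simp add: std_normal_cdf_minus u)
        show "power_fn ?\<psi>' Q' \<longlonglongrightarrow> 1 - \<alpha>" if "Q' \<in> F1_seqs \<P> P0" "?r Q' \<longlonglongrightarrow> 0" for Q'
        proof -
          have "power_fn ?\<psi>' Q' = (\<lambda>n. 1 - power_fn \<psi> Q' n)"
            by (intro ext compl \<psi>t that)
          then show ?thesis
            using tendsto_diff[OF tendsto_const sim[OF \<psi> that], of 1] by simp
        qed
      qed
      also have "1 - \<Phi> (- u - \<bar>\<theta>\<bar> / \<sigma>) = \<Phi> (u - \<theta> / \<sigma>)"
        using std_normal_cdf_minus[of "u - \<theta> / \<sigma>"] \<theta>(1) by simp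
      finally have le: "limsup (\<lambda>n. ereal (power_fn ?\<psi>' Q n)) \<le> ereal (\<Phi> (u - \<theta> / \<sigma>))" .
      have "(\<lambda>n. ereal (power_fn \<psi> Q n)) = (\<lambda>n. ereal 1 - ereal (power_fn ?\<psi>' Q n))"
        by (simp add: compl[OF \<psi>t QF])
      then have "liminf (\<lambda>n. ereal (power_fn \<psi> Q n)) = ereal 1 - limsup (\<lambda>n. ereal (power_fn ?\<psi>' Q n))"
        by (simp only:, intro liminf_ereal_cminus) simp
      also have "\<dots> \<ge> ereal 1 - ereal (\<Phi> (u - \<theta> / \<sigma>))"
        by (intro ereal_minus_mono order_refl le)
      finally show ?thesis
        unfolding lim\<phi> by simp
    qed
  qed
qed

end
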